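(* Let $a,b$ be positive computable real numbers and let $\mathcal{R}=\mathcal{R}_1\times\mathcal{R}_2$ with $\mathcal{R}_1=[-a,a]$ and $\mathcal{R}_2=[-b,b]$. There exists a function $f_2:\mathbb{R}^2\to\mathbb{R}$ whose restriction to $\mathcal{R}$ is a computable continuous function and which has the following properties: (1) $f_2\in\mathcal{C}^1(\mathbb{R}^2)$, i.e. $f_2$ is continuously differentiable on $\mathbb{R}^2$. (2) The function $f_2(\cdot,x_2)$ is strictly convex for every fixed $x_2\in\mathbb{R}$ with $x_2\neq 0$, and $f_2(\cdot,x_2)$ is a computable continuous function for every computable $x_2\in\mathbb{R}$. (3) The function $f_2(x_1,\cdot)$ is strictly convex for every fixed $x_1\in\mathbb{R}$, and $f_2(x_1,\cdot)$ is a computable continuous function for every computable $x_1\in\mathbb{R}$. (4) On $\mathcal{R}$, $f_2$ has only global minimizers (every local minimizer is a global minimizer), and the set $\mathcal{MIN}_{\mathcal{R}}(f_2)$ of all global minimizers is a closed interval on the $x_1$-axis. (5) Every $(\widehat{x}_1,\widehat{x}_2)\in\mathcal{MIN}_{\mathcal{R}}(f_2)$ that is reachable along the coordinate $x_2$ is not a computable vector in $\mathbb{R}^2$.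
   Context: Computability notions. A sequence (or double sequence) of rational numbers is computable if it is generated by a Turing machine from its index (indices). A real number $x$ is computable if there is a computable sequence $\{r_k\}_{k\in\mathbb{N}}\subset\mathbb{Q}$ with $|x-r_k|\le 2^{-k}$ for all $k$. A vector is computable if all its components are. A sequence $\{x_n\}$ of reals is computable if there is a computable double sequence $\{r_{n,k}\}\subset\mathbb{Q}$ with $|x_n-r_{n,k}|<2^{-k}$ for all $n,k$; a sequence of vectors is computable if each component sequence is. A computable rectangle is a product of closed intervals with computable endpoints. A real-valued function on a computable rectangle is Banach--Mazur computable if it maps every computable sequence of vectors in the rectangle to a computable sequence of reals. It is effectively uniformly continuous if there is a recursive function $d:\mathbb{N}\to\mathbb{N}$ such that for every $k$, with $n=d(k)$, $\|\mathbf{x}_1-\mathbf{x}_2\|\le 2^{-n}$ implies $|f(\mathbf{x}_1)-f(\mathbf{x}_2)|\le 2^{-k}$. A computable continuous function on a computable rectangle is a function that is both Banach--Mazur computable and effectively uniformly continuous. A function on all of $\mathbb{R}$ is called a computable continuous function if its restriction to every compact interval with computable endpoints is one. Minimizers and assignment functions. For $f$ defined on (a set containing) $\mathcal{R}$, $\mathcal{MIN}_{\mathcal{R}}(f)=\{\widehat{\mathbf{x}}\in\mathcal{R}: f(\widehat{\mathbf{x}})=\min_{\mathbf{x}\in\mathcal{R}}f(\mathbf{x})\}$. An assignment function of $f$ for the first coordinate is a function $G_1:\mathcal{R}_2\to\mathcal{R}_1$ such that, for every $x_2\in\mathcal{R}_2$, $G_1(x_2)$ is a minimizer of $y\mapsto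 f(y,x_2)$ over $y\in\mathcal{R}_1$. The set of all such functions is $\mathcal{A}_1(f)$. Reachability. For a global minimizer $(\widehat{x}_1,\widehat{x}_2)\in\mathcal{MIN}_{\mathcal{R}}(f)$ let $\mathcal{G}_1^{+}(\widehat{x}_2)$ be the set of all limits $\lim_{x_2\to\widehat{x}_2,\,x_2>\widehat{x}_2}(G_1(x_2),x_2)$ (where they exist) with $G_1\in\mathcal{A}_1(f)$, and $\mathcal{G}_1^{-}(\widehat{x}_2)$ the set of all limits $\lim_{x_2\to\widehat{x}_2,\,x_2<\widehat{x}_2}(G_1(x_2),x_2)$ (where they exist) with $G_1\in\mathcal{A}_1(f)$. The minimizer $(\widehat{x}_1,\widehat{x}_2)$ is reachable along the coordinate $x_2$ if $(\widehat{x}_1,\widehat{x}_2)\in\mathcal{G}_1^{+}(\widehat{x}_2)\cup\mathcal{G}_1^{-}(\widehat{x}_2)$. *)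

theory Defs
  imports "HOL-Analysis.Analysis"
begin

section \<open>Turing machines\<close>

text \<open>
  Deterministic Turing machines with finitely many two-way infinite tapes, states
  \<open>{..<states M}\<close> and tape alphabet \<open>{..<symbols M}\<close>, where symbol 0 is the blank and symbol 1 is
  the mark used for unary notation.  \<open>delta M q cs\<close> is the action in state \<open>q\<close> when the list of
  symbols under the heads is \<open>cs\<close>: the new state and, for each tape, the symbol to write and the
  head move.
\<close>

datatype move = Left | Stay | Right

record tm =
  tapes :: nat
  states :: nat
  symbols :: nat
  start :: nat
  halt :: nat
  delta :: "nat \<Rightarrow> nat list \<Rightarrow> nat \<times> (nat \<times> move) list"

text \<open>
  By this condition \<open>delta M\<close> restricts to a map on a finite set, and only this restriction is
  ever used in a computation.
\<close>

definition wf_tm :: "tm \<Rightarrow> bool" where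
  "wf_tm M \<longleftrightarrow>
     0 < tapes M \<and> 2 \<le> symbols M \<and> start M < states M \<and> halt M < states M \<and>
     (\<forall>q < states M. \<forall>cs. length cs = tapes M \<and> set cs \<subseteq> {..<symbols M} \<longrightarrow>
        fst (delta M q cs) < states M \<and>
        length (snd (delta M q cs)) = tapes M \<and>
        fst ` set (snd (delta M q cs)) \<subseteq> {..<symbols M})"

text \<open>A tape is given by the position of its head and its contents.\<close>

type_synonym tape = "int \<times> (int \<Rightarrow> nat)"

fun head_move :: "move \<Rightarrow> int \<Rightarrow> int" where
  "head_move Left h = h - 1"
| "head_move Stay h = h"
| "head_move Right h = h + 1"

fun read_tape :: "tape \<Rightarrow> nat" where
  "read_tape (h, t) = t h"

fun act_tape :: "nat \<times> move \<Rightarrow> tape \<Rightarrow> tape" where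
  "act_tape (c, m) (h, t) = (head_move m h, t(h := c))"

fun step :: "tm \<Rightarrow> nat \<times> tape list \<Rightarrow> nat \<times> tape list" where
  "step M (q, ts) =
     (if q = halt M then (q, ts)
      else let (q', as) = delta M q (map read_tape ts) in (q', map2 act_tape as ts))"

definition unary_tape :: "nat \<Rightarrow> tape" where
  "unary_tape n = (0, \<lambda>i. if 0 \<le> i \<and> i < int n then 1 else 0)"

text \<open>
  The standard configuration for \<open>xs\<close> has the numbers \<open>xs\<close> in unary on the first tapes, one on
  each; the other tapes are blank, and all heads are at the origin.
\<close>

definition standard_tapes :: "tm \<Rightarrow> nat list \<Rightarrow> tape list" where
  "standard_tapes M xs =
     map (\<lambda>i. unary_tape (if i < length xs then xs ! i else 0)) [0..<tapes M]"

text \<open>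
  \<open>M\<close> computes the \<open>n\<close>-ary function \<open>f\<close> if, started in the standard configuration for any
  arguments, it halts in the standard configuration for the value of \<open>f\<close>.
\<close>

definition tm_computes :: "tm \<Rightarrow> nat \<Rightarrow> (nat list \<Rightarrow> nat) \<Rightarrow> bool" where
  "tm_computes M n f \<longleftrightarrow>
     wf_tm M \<and> n \<le> tapes M \<and>
     (\<forall>xs. length xs = n \<longrightarrow>
        (\<exists>t. (step M ^^ t) (start M, standard_tapes M xs) = (halt M, standard_tapes M [f xs])))"

definition recursive1 :: "(nat \<Rightarrow> nat) \<Rightarrow> bool" where
  "recursive1 f \<longleftrightarrow> (\<exists>M. tm_computes M 1 (\<lambda>xs. f (xs ! 0)))"

definition recursive2 :: "(nat \<Rightarrow> nat \<Rightarrow> nat) \<Rightarrow> bool" where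
  "recursive2 f \<longleftrightarrow> (\<exists>M. tm_computes M 2 (\<lambda>xs. f (xs ! 0) (xs ! 1)))"


section \<open>Computable numbers, vectors and sequences\<close>

text \<open>A rational number is generated as a sign, a numerator and a nonzero denominator.\<close>

definition computable_rat_seq :: "(nat \<Rightarrow> rat) \<Rightarrow> bool" where
  "computable_rat_seq r \<longleftrightarrow>
     (\<exists>s p q. recursive1 s \<and> recursive1 p \<and> recursive1 q \<and>
        (\<forall>k. q k \<noteq> 0 \<and> r k = (-1) ^ s k * of_nat (p k) / of_nat (q k)))"

definition computable_rat_seq2 :: "(nat \<Rightarrow> nat \<Rightarrow> rat) \<Rightarrow> bool" where
  "computable_rat_seq2 r \<longleftrightarrow>
     (\<exists>s p q. recursive2 s \<and> recursive2 p \<and> recursive2 q \<and>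
        (\<forall>n k. q n k \<noteq> 0 \<and> r n k = (-1) ^ s n k * of_nat (p n k) / of_nat (q n k)))"

definition computable_real :: "real \<Rightarrow> bool" where
  "computable_real x \<longleftrightarrow>
     (\<exists>r. computable_rat_seq r \<and> (\<forall>k. \<bar>x - of_rat (r k)\<bar> \<le> (1/2) ^ k))"

definition computable_real_seq :: "(nat \<Rightarrow> real) \<Rightarrow> bool" where
  "computable_real_seq x \<longleftrightarrow>
     (\<exists>r. computable_rat_seq2 r \<and> (\<forall>n k. \<bar>x n - of_rat (r n k)\<bar> < (1/2) ^ k))"

definition computable_vec :: "'a::euclidean_space \<Rightarrow> bool" where
  "computable_vec x \<longleftrightarrow> (\<forall>i\<in>Basis. computable_real (x \<bullet> i))"

definition computable_vec_seq :: "(nat \<Rightarrow> 'a::euclidean_space) \<Rightarrow> bool" where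
  "computable_vec_seq x \<longleftrightarrow> (\<forall>i\<in>Basis. computable_real_seq (\<lambda>n. x n \<bullet> i))"


section \<open>Computable continuous functions\<close>

definition computable_rectangle :: "'a::euclidean_space set \<Rightarrow> bool" where
  "computable_rectangle R \<longleftrightarrow>
     (\<exists>l u. computable_vec l \<and> computable_vec u \<and> (\<forall>i\<in>Basis. l \<bullet> i \<le> u \<bullet> i) \<and> R = cbox l u)"

definition banach_mazur_computable_on ::
    "'a::euclidean_space set \<Rightarrow> ('a \<Rightarrow> real) \<Rightarrow> bool" where
  "banach_mazur_computable_on R f \<longleftrightarrow>
     (\<forall>x. computable_vec_seq x \<and> range x \<subseteq> R \<longrightarrow> computable_real_seq (\<lambda>n. f (x n)))"

definition effectively_uniformly_continuous_on ::
    "'a::euclidean_space set \<Rightarrow> ('a \<Rightarrow> real) \<Rightarrow> bool" where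
  "effectively_uniformly_continuous_on R f \<longleftrightarrow>
     (\<exists>d. recursive1 d \<and>
        (\<forall>k. \<forall>x\<in>R. \<forall>y\<in>R. norm (x - y) \<le> (1/2) ^ d k \<longrightarrow> \<bar>f x - f y\<bar> \<le> (1/2) ^ k))"

definition computable_continuous_on :: "'a::euclidean_space set \<Rightarrow> ('a \<Rightarrow> real) \<Rightarrow> bool" where
  "computable_continuous_on R f \<longleftrightarrow>
     computable_rectangle R \<and> banach_mazur_computable_on R f \<and>
     effectively_uniformly_continuous_on R f"

definition computable_continuous :: "(real \<Rightarrow> real) \<Rightarrow> bool" where
  "computable_continuous f \<longleftrightarrow>
     (\<forall>l u. computable_real l \<and> computable_real u \<and> l \<le> u \<longrightarrow> computable_continuous_on {l..u} f)"


section \<open>Smoothness and convexity\<close>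

definition continuously_differentiable :: "('a::real_normed_vector \<Rightarrow> real) \<Rightarrow> bool" where
  "continuously_differentiable f \<longleftrightarrow>
     (\<exists>f' :: 'a \<Rightarrow> 'a \<Rightarrow>\<^sub>L real.
        (\<forall>x. (f has_derivative blinfun_apply (f' x)) (at x)) \<and> continuous_on UNIV f')"

definition strictly_convex_on :: "'a::real_vector set \<Rightarrow> ('a \<Rightarrow> real) \<Rightarrow> bool" where
  "strictly_convex_on S f \<longleftrightarrow>
     convex S \<and>
     (\<forall>x\<in>S. \<forall>y\<in>S. \<forall>t. x \<noteq> y \<and> 0 < t \<and> t < 1 \<longrightarrow>
        f ((1 - t) *\<^sub>R x + t *\<^sub>R y) < (1 - t) * f x + t * f y)"


section \<open>Minimizers and reachability\<close>

definition minimizers :: "'a set \<Rightarrow> ('a \<Rightarrow> real) \<Rightarrow> 'a set" where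
  "minimizers S f = {x. is_arg_min f (\<lambda>x. x \<in> S) x}"

definition local_minimizers :: "'a::metric_space set \<Rightarrow> ('a \<Rightarrow> real) \<Rightarrow> 'a set" where
  "local_minimizers S f = {x \<in> S. \<exists>e>0. \<forall>y\<in>S. dist y x < e \<longrightarrow> f x \<le> f y}"

text \<open>Assignment functions are only constrained on \<open>R2\<close>; their values elsewhere are irrelevant.\<close>

definition assignments1 ::
    "real set \<Rightarrow> real set \<Rightarrow> (real \<times> real \<Rightarrow> real) \<Rightarrow> (real \<Rightarrow> real) set" where
  "assignments1 R1 R2 f = {G. \<forall>x2\<in>R2. G x2 \<in> minimizers R1 (\<lambda>y. f (y, x2))}"

text \<open>
  \<open>side\<close> is \<open>{c<..}\<close> or \<open>{..<c}\<close> below.  The requirement that the filter be nontrivial excludes the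
  case where \<open>c\<close> is the endpoint of \<open>R2\<close> on that side: no one-sided limit exists there, while every
  point would be a limit along the trivial filter.
\<close>

definition one_sided_limits ::
    "real set \<Rightarrow> real set \<Rightarrow> (real \<times> real \<Rightarrow> real) \<Rightarrow> real \<Rightarrow> real set \<Rightarrow> (real \<times> real) set" where
  "one_sided_limits R1 R2 f c side =
     {p. at c within (R2 \<inter> side) \<noteq> bot \<and>
         (\<exists>G \<in> assignments1 R1 R2 f. ((\<lambda>x2. (G x2, x2)) \<longlongrightarrow> p) (at c within (R2 \<inter> side)))}"

definition G1_plus ::
    "real set \<Rightarrow> real set \<Rightarrow> (real \<times> real \<Rightarrow> real) \<Rightarrow> real \<Rightarrow> (real \<times> real) set" where
  "G1_plus R1 R2 f c = one_sided_limits R1 R2 f c {c<..}"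

definition G1_minus ::
    "real set \<Rightarrow> real set \<Rightarrow> (real \<times> real \<Rightarrow> real) \<Rightarrow> real \<Rightarrow> (real \<times> real) set" where
  "G1_minus R1 R2 f c = one_sided_limits R1 R2 f c {..<c}"

definition reachable_along_x2 ::
    "real set \<Rightarrow> real set \<Rightarrow> (real \<times> real \<Rightarrow> real) \<Rightarrow> real \<times> real \<Rightarrow> bool" where
  "reachable_along_x2 R1 R2 f p \<longleftrightarrow>
     p \<in> minimizers (R1 \<times> R2) f \<and> p \<in> G1_plus R1 R2 f (snd p) \<union> G1_minus R1 R2 f (snd p)"

end

theory Submission
  imports Defs "HOL-Library.Nat_Bijection"
begin

text \<open>
Let \<open>l\<close> be a noncomputable real number in the interval from \<open>0\<close> to \<open>a\<close> which is the supremum of a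
computable sequence of rational numbers \<open>q n \<ge> 0\<close>.  The function
\<open>ramps q x = (\<Sum>n. 2 ^ -n * (max 0 (q n - x))\<^sup>2)\<close> is convex, has a Lipschitz continuous derivative
and vanishes exactly for \<open>x \<ge> l\<close>.  Although the left end of its zero set is not computable, its
values are: the series converges effectively, and its terms are computed from \<open>x\<close> and \<open>n\<close>.
The function of the theorem is \<open>valley q (x, y) = ramps q x + y\<^sup>2 * (1 + x\<^sup>2)\<close>.

It is nonnegative and vanishes exactly where \<open>l \<le> x\<close> and \<open>y = 0\<close>, so that its global minimizers on the
rectangle form the segment from \<open>(l, 0)\<close> to \<open>(a, 0)\<close>.  Away from the \<open>x\<close>-axis it decreases strictly
towards the axis, and on the axis it is convex; hence each local minimizer is global.  For
\<open>y \<noteq> 0\<close> a minimizer \<open>x\<close> of \<open>valley q (x, y)\<close> satisfies \<open>x\<^sup>2 \<le> l\<^sup>2\<close>, because at \<open>l\<close> the first summand is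
already zero and the second one is smaller than at each \<open>x\<close> with \<open>x\<^sup>2 > l\<^sup>2\<close>.  So among the points \<open>(x, 0)\<close> with \<open>x \<ge> l\<close> only \<open>(l, 0)\<close> can be a limit of minimizers of the
slices, and \<open>l\<close> is not computable (\<open>valley_one_sided_limit\<close>).

The number \<open>l\<close> is Specker's: after some leading zeros, its base 8 digit number \<open>e\<close> is \<open>4\<close> or \<open>0\<close> according
to whether \<open>e\<close> lies in a computably enumerable set that is not computable.  Digits \<open>0\<close> and \<open>4\<close> are so far apart that a
rational approximation of \<open>l\<close> of known quality reveals the digit at a given position; thus a computable \<open>l\<close>
would make the set computable (\<open>noncomputable_limit\<close>).

The existence of such a set is a fact about the machines \<open>tm\<close>, and so is the computability of
\<open>valley q\<close>, which needs compositions of functions given by machines.  Both rest on two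
translations.  Programs with registers, increment, decrement and loops are compiled to
machines (\<open>tm_code_correct\<close>); they compute a class of functions, \<open>rec_fun\<close>, with the
closure properties of the recursive functions, which is lifted to functions \<open>computable\<close> between encoded
types such as pairs and lists.  Conversely, the run of a machine on finite descriptions of its tapes is a
computable function of a finite description of the machine (\<open>simulation\<close>).  So the unary and binary functions
computed by machines are exactly the computable ones, and the usual diagonal
argument applies to the simulation (\<open>exists_undecidable_ce_predicate\<close>).
\<close>

section \<open>Register programs and their compilation to Turing machines\<close>

datatype prog = Inc nat | Dec nat | Seq prog prog (infixr ";;" 60) | While nat prog

inductive exec :: "prog \<Rightarrow> (nat \<Rightarrow> nat) \<Rightarrow> (nat \<Rightarrow> nat) \<Rightarrow> bool" where
  Inc: "exec (Inc r) s (s(r := Suc (s r)))"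
| Dec: "exec (Dec r) s (s(r := s r - 1))"
| Seq: "exec p s t \<Longrightarrow> exec q t u \<Longrightarrow> exec (p ;; q) s u"
| While_stop: "s r = 0 \<Longrightarrow> exec (While r p) s s"
| While_loop: "s r \<noteq> 0 \<Longrightarrow> exec p s t \<Longrightarrow> exec (While r p) t u \<Longrightarrow> exec (While r p) s u"

fun regs :: "prog \<Rightarrow> nat set" where
  "regs (Inc r) = {r}"
| "regs (Dec r) = {r}"
| "regs (p ;; q) = regs p \<union> regs q"
| "regs (While r p) = insert r (regs p)"

lemma finite_regs: "finite (regs p)"
  by (induction p) auto

text \<open>
Only tape \<open>r\<close> is changed by this action: each other tape gets back the symbol that was read on it.
\<close>
definition act_on :: "nat \<Rightarrow> nat \<times> move \<Rightarrow> nat list \<Rightarrow> (nat \<times> move) list" where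
  "act_on r a cs = (map (\<lambda>c. (c, Stay)) cs)[r := a]"

fun num_states :: "prog \<Rightarrow> nat" where
  "num_states (Inc r) = 2"
| "num_states (Dec r) = 3"
| "num_states (p ;; q) = num_states p + num_states q"
| "num_states (While r p) = num_states p + 2"

text \<open>
The program occupies the states from \<open>b\<close> to \<open>b + num_states p - 1\<close> and leaves them for the state
\<open>b + num_states p\<close>.  Between instructions all heads are at the origin and each tape holds its register in
unary, so that the symbol at the origin tells whether the register is zero.  To change a register, the
head runs to the first blank at the right, adds or deletes a mark there, and returns; the blank at
position \<open>-1\<close> shows it the origin.
\<close>
fun tm_code :: "prog \<Rightarrow> nat \<Rightarrow> nat \<Rightarrow> nat list \<Rightarrow> nat \<times> (nat \<times> move) list" where
  "tm_code (Inc r) b q cs =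
     (if q = b then
        (if cs ! r = 1 then (b, act_on r (1, Right) cs) else (b + 1, act_on r (1, Left) cs))
      else
        (if cs ! r = 1 then (b + 1, act_on r (1, Left) cs) else (b + 2, act_on r (0, Right) cs)))"
| "tm_code (Dec r) b q cs =
     (if q = b then
        (if cs ! r = 1 then (b, act_on r (1, Right) cs) else (b + 1, act_on r (0, Left) cs))
      else if q = b + 1 then
        (if cs ! r = 1 then (b + 2, act_on r (0, Left) cs) else (b + 3, act_on r (0, Right) cs))
      else
        (if cs ! r = 1 then (b + 2, act_on r (1, Left) cs) else (b + 3, act_on r (0, Right) cs)))"
| "tm_code (p1 ;; p2) b q cs =
     (if q < b + num_states p1 then tm_code p1 b q cs else tm_code p2 (b + num_states p1) q cs)"
| "tm_code (While r p) b q cs =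
     (if q = b then
        (if cs ! r = 1 then (b + 1, act_on r (1, Stay) cs)
         else (b + num_states p + 2, act_on r (0, Stay) cs))
      else if q < b + 1 + num_states p then tm_code p (b + 1) q cs
      else (b, act_on r (cs ! r, Stay) cs))"

definition prog_tm :: "nat \<Rightarrow> prog \<Rightarrow> tm" where
  "prog_tm K p = \<lparr>tapes = K, states = Suc (num_states p), symbols = 2, start = 0,
     halt = num_states p, delta = tm_code p 0\<rparr>"

lemma length_act_on [simp]: "length (act_on r a cs) = length cs"
  by (simp add: act_on_def)

lemma set_act_on: "fst ` set (act_on r a cs) \<subseteq> insert (fst a) (set cs)"
proof -
  have "set (act_on r a cs) \<subseteq> insert a (set (map (\<lambda>c. (c, Stay)) cs))"
    unfolding act_on_def by (rule set_update_subset_insert)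
  thus ?thesis by auto
qed

lemma act_on_symbols:
  assumes "(c, m) \<in> set (act_on r a cs)" and "set cs \<subseteq> {..<2}" and "fst a < 2"
  shows "c < 2"
  using set_act_on[of r a cs] assms by force

lemma tm_code_wf:
  assumes "set cs \<subseteq> {..<2::nat}" and "\<forall>r\<in>regs p. r < length cs"
  shows "fst (tm_code p b q cs) \<le> b + num_states p \<and>
    length (snd (tm_code p b q cs)) = length cs \<and>
    (\<forall>x\<in>set (snd (tm_code p b q cs)). fst x < 2)"
  using assms
proof (induction p arbitrary: b)
  case (Seq p1 p2)
  from Seq.IH(1)[of b] Seq.IH(2)[of "b + num_states p1"] Seq.prems show ?case by auto
next
  case (While r p)
  have "cs ! r < 2" using While.prems nth_mem[of r cs] by (force simp: subset_iff)
  with While.IH[of "b + 1"] While.prems show ?case by (auto elim!: act_on_symbols)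
qed (auto elim!: act_on_symbols)

lemma wf_prog_tm:
  assumes "0 < K" and "\<forall>r\<in>regs p. r < K"
  shows "wf_tm (prog_tm K p)"
proof -
  have "fst (tm_code p 0 q cs) < Suc (num_states p) \<and> length (snd (tm_code p 0 q cs)) = K \<and>
      fst ` set (snd (tm_code p 0 q cs)) \<subseteq> {..<2}"
    if "length cs = K" "set cs \<subseteq> {..<2}" for q cs
    using tm_code_wf[of cs p 0 q] assms that by auto
  thus ?thesis using assms(1) by (simp add: wf_tm_def prog_tm_def)
qed

definition reach :: "tm \<Rightarrow> nat \<times> tape list \<Rightarrow> nat \<times> tape list \<Rightarrow> bool" where
  "reach M c c' \<longleftrightarrow> (\<exists>n. (step M ^^ n) c = c')"

lemma reach_refl: "reach M c c"
  unfolding reach_def by (rule exI[of _ 0]) simp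

lemma reach_trans [trans]: "reach M c c' \<Longrightarrow> reach M c' c'' \<Longrightarrow> reach M c c''"
  unfolding reach_def by (metis funpow_add comp_apply)

lemma reach_step: "step M c = c' \<Longrightarrow> reach M c c'"
  unfolding reach_def by (rule exI[of _ 1]) simp

lemma map2_act_on:
  assumes "r < length ts"
  shows "map2 act_tape (act_on r a (map read_tape ts)) ts = ts[r := act_tape a (ts ! r)]"
proof (rule nth_equalityI)
  show "length (map2 act_tape (act_on r a (map read_tape ts)) ts) =
      length (ts[r := act_tape a (ts ! r)])" by simp
  fix i assume "i < length (map2 act_tape (act_on r a (map read_tape ts)) ts)"
  hence i: "i < length ts" by simp
  obtain h t where ht: "ts ! i = (h, t)" by force
  show "map2 act_tape (act_on r a (map read_tape ts)) ts ! i = ts[r := act_tape a (ts ! r)] ! i"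
    using i assms ht by (auto simp: act_on_def nth_list_update)
qed

lemma reach_act:
  assumes "q \<noteq> halt M" and "r < length ts"
    and "delta M q (map read_tape ts) = (q', act_on r a (map read_tape ts))"
    and "act_tape a (ts ! r) = t'"
  shows "reach M (q, ts) (q', ts[r := t'])"
  by (rule reach_step) (use assms map2_act_on[of r ts a] in simp)

definition unary :: "nat \<Rightarrow> int \<Rightarrow> nat" where
  "unary n = (\<lambda>i. if 0 \<le> i \<and> i < int n then 1 else 0)"

lemma unary_tape: "unary_tape n = (0, unary n)"
  by (simp add: unary_tape_def unary_def)

definition reg_tapes :: "nat \<Rightarrow> (nat \<Rightarrow> nat) \<Rightarrow> tape list" where
  "reg_tapes K s = map (\<lambda>i. unary_tape (s i)) [0..<K]"

lemma length_reg_tapes [simp]: "length (reg_tapes K s) = K"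
  by (simp add: reg_tapes_def)

lemma reg_tapes_update:
  "r < K \<Longrightarrow> (reg_tapes K s)[r := (0, unary n)] = reg_tapes K (s(r := n))"
  by (rule nth_equalityI) (auto simp: reg_tapes_def nth_list_update unary_tape)

lemma reg_tapes_nth: "r < K \<Longrightarrow> reg_tapes K s ! r = (0, unary (s r))"
  by (simp add: reg_tapes_def unary_tape)

text \<open>
The two movements of \<open>Inc\<close> and \<open>Dec\<close>: to the right across a block of marks, and back to the left as
far as the blank before the origin.
\<close>
lemma scan_right:
  assumes "q \<noteq> halt M" "r < length ts"
    and d: "\<And>cs. cs ! r = 1 \<Longrightarrow> delta M q cs = (q, act_on r (1, Right) cs)"
    and "j \<le> n"
  shows "reach M (q, ts[r := (0, unary n)]) (q, ts[r := (int j, unary n)])"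
  using assms(4)
proof (induction j)
  case 0
  show ?case by (simp add: reach_refl)
next
  case (Suc j)
  hence "reach M (q, ts[r := (0, unary n)]) (q, ts[r := (int j, unary n)])" by simp
  also have "reach M \<dots> (q, (ts[r := (int j, unary n)])[r := (int (Suc j), unary n)])"
    by (rule reach_act[where a = "(1, Right)"])
       (use assms Suc.prems in \<open>auto intro!: d simp: unary_def\<close>)
  finally show ?case by simp
qed

lemma scan_left:
  assumes "q \<noteq> halt M" "r < length ts"
    and d1: "\<And>cs. cs ! r = 1 \<Longrightarrow> delta M q cs = (q, act_on r (1, Left) cs)"
    and d0: "\<And>cs. cs ! r = 0 \<Longrightarrow> delta M q cs = (q', act_on r (0, Right) cs)"
    and "j \<le> n"
  shows "reach M (q, ts[r := (int j - 1, unary n)]) (q', ts[r := (0, unary n)])"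
  using assms(5)
proof (induction j)
  case 0
  have "reach M (q, ts[r := (- 1, unary n)]) (q', (ts[r := (- 1, unary n)])[r := (0, unary n)])"
    by (rule reach_act[where a = "(0, Right)"])
       (use assms in \<open>auto intro!: d0 simp: unary_def\<close>)
  thus ?case by simp
next
  case (Suc j)
  have "reach M (q, ts[r := (int j, unary n)])
      (q, (ts[r := (int j, unary n)])[r := (int j - 1, unary n)])"
    by (rule reach_act[where a = "(1, Left)"])
       (use assms Suc.prems in \<open>auto intro!: d1 simp: unary_def\<close>)
  hence "reach M (q, ts[r := (int j, unary n)]) (q, ts[r := (int j - 1, unary n)])" by simp
  also have "reach M \<dots> (q', ts[r := (0, unary n)])" using Suc by simp
  finally show ?case by simp
qed

text \<open>
By induction on the execution.  The machine \<open>M\<close> is only required to agree with the compiled code on the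
states of \<open>p\<close>, so that the claim can be used for the parts of a larger program.
\<close>
lemma tm_code_correct:
  assumes "exec p s s'" and "\<forall>r\<in>regs p. r < K"
    and "\<And>q cs. b \<le> q \<Longrightarrow> q < b + num_states p \<Longrightarrow> delta M q cs = tm_code p b q cs"
    and "b + num_states p \<le> halt M"
  shows "reach M (b, reg_tapes K s) (b + num_states p, reg_tapes K s')"
  using assms
proof (induction arbitrary: b rule: exec.induct)
  case (Inc r s)
  let ?ts = "reg_tapes K s" and ?n = "s r"
  have r: "r < K" and h: "b \<noteq> halt M" "b + 1 \<noteq> halt M" using Inc.prems by auto
  have d: "delta M b cs = tm_code (Inc r) b b cs"
    "delta M (b + 1) cs = tm_code (Inc r) b (b + 1) cs" for cs
    by (rule Inc.prems(2); simp)+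
  have "reach M (b, ?ts) (b, ?ts[r := (int ?n, unary ?n)])"
    using scan_right[of b M r ?ts "?n" "?n"] h r
    by (simp add: d reg_tapes_update[OF r])
  also have "reach M \<dots> (b + 1, (?ts[r := (int ?n, unary ?n)])[r := (int (Suc ?n) - 1 - 1, unary (Suc ?n))])"
    by (rule reach_act[where a = "(1, Left)"])
       (use h r in \<open>auto simp: d d[simplified] unary_def fun_eq_iff\<close>)
  also have "\<dots> = (b + 1, ?ts[r := (int ?n - 1, unary (Suc ?n))])" by simp
  also have "reach M \<dots> (b + 2, ?ts[r := (0, unary (Suc ?n))])"
    by (rule scan_left) (use h r in \<open>auto simp: d[simplified]\<close>)
  finally show ?case by (simp add: reg_tapes_update[OF r] fun_upd_def)
next
  case (Dec r s)
  let ?ts = "reg_tapes K s" and ?n = "s r"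
  have r: "r < K" and h: "b \<noteq> halt M" "b + 1 \<noteq> halt M" "b + 2 \<noteq> halt M" using Dec.prems by auto
  have d: "delta M b cs = tm_code (Dec r) b b cs"
    "delta M (b + 1) cs = tm_code (Dec r) b (b + 1) cs"
    "delta M (b + 2) cs = tm_code (Dec r) b (b + 2) cs" for cs
    by (rule Dec.prems(2); simp)+
  have "reach M (b, ?ts) (b, ?ts[r := (int ?n, unary ?n)])"
    using scan_right[of b M r ?ts "?n" "?n"] h r
    by (simp add: d reg_tapes_update[OF r])
  also have "reach M \<dots> (b + 1, (?ts[r := (int ?n, unary ?n)])[r := (int ?n - 1, unary ?n)])"
    by (rule reach_act[where a = "(0, Left)"])
       (use h r in \<open>auto simp: d d[simplified] unary_def fun_eq_iff\<close>)
  also have "\<dots> = (b + 1, ?ts[r := (int ?n - 1, unary ?n)])" by simp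
  also have "reach M \<dots> (b + 3, ?ts[r := (0, unary (?n - 1))])"
  proof (cases "?n")
    case 0
    have "reach M (b + 1, ?ts[r := (int ?n - 1, unary ?n)])
      (b + 3, (?ts[r := (int ?n - 1, unary ?n)])[r := (0, unary (?n - 1))])"
      by (rule reach_act[where a = "(0, Right)"])
         (use h r 0 in \<open>auto simp: d d[simplified] unary_def fun_eq_iff\<close>)
    thus ?thesis by simp
  next
    case (Suc m)
    have "reach M (b + 1, ?ts[r := (int ?n - 1, unary ?n)])
      (b + 2, (?ts[r := (int ?n - 1, unary ?n)])[r := (int m - 1, unary m)])"
      by (rule reach_act[where a = "(0, Left)"])
         (use h r Suc in \<open>auto simp: d d[simplified] unary_def fun_eq_iff\<close>)
    also have "\<dots> = (b + 2, ?ts[r := (int m - 1, unary m)])" by simp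
    also have "reach M \<dots> (b + 3, ?ts[r := (0, unary m)])"
      by (rule scan_left) (use h r in \<open>auto simp: d d[simplified]\<close>)
    finally show ?thesis using Suc by simp
  qed
  finally show ?case by (simp add: reg_tapes_update[OF r] fun_upd_def)
next
  case (Seq p s t q u)
  have "reach M (b, reg_tapes K s) (b + num_states p, reg_tapes K t)"
    by (rule Seq.IH(1)) (use Seq.prems in auto)
  also have "reach M \<dots> (b + num_states p + num_states q, reg_tapes K u)"
    by (rule Seq.IH(2)) (use Seq.prems in auto)
  finally show ?case by (simp add: add.assoc)
next
  case (While_stop s r p)
  have "reach M (b, reg_tapes K s)
    (b + num_states p + 2, (reg_tapes K s)[r := (0, unary (s r))])"
    by (rule reach_act[where a = "(0, Stay)"])
       (use While_stop in \<open>auto simp: reg_tapes_nth unary_def fun_eq_iff\<close>)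
  thus ?case using While_stop.prems by (simp add: reg_tapes_update)
next
  case (While_loop s r p t u)
  have r: "r < K" using While_loop.prems by simp
  have "reach M (b, reg_tapes K s) (b + 1, (reg_tapes K s)[r := (0, unary (s r))])"
    by (rule reach_act[where a = "(1, Stay)"])
       (use While_loop in \<open>auto simp: reg_tapes_nth unary_def fun_eq_iff\<close>)
  also have "\<dots> = (b + 1, reg_tapes K s)" using r by (simp add: reg_tapes_update)
  also have "reach M \<dots> (b + 1 + num_states p, reg_tapes K t)"
    by (rule While_loop.IH(1)) (use While_loop.prems in auto)
  also have "reach M \<dots> (b, (reg_tapes K t)[r := (0, unary (t r))])"
    by (rule reach_act[where a = "(unary (t r) 0, Stay)"])
       (use r While_loop.prems in \<open>auto simp: reg_tapes_nth\<close>)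
  also have "\<dots> = (b, reg_tapes K t)" using r by (simp add: reg_tapes_update)
  also have "reach M \<dots> (b + num_states (While r p), reg_tapes K u)"
    by (rule While_loop.IH(2)) (use While_loop.prems in auto)
  finally show ?case .
qed

definition input :: "nat list \<Rightarrow> nat \<Rightarrow> nat" where
  "input xs = (\<lambda>i. if i < length xs then xs ! i else 0)"

lemma tm_computes_prog:
  assumes "\<And>xs. length xs = n \<Longrightarrow> exec p (input xs) (input [f xs])"
  shows "\<exists>M. tm_computes M n f"
proof -
  obtain m where m: "\<forall>r\<in>regs p. r < m"
    using finite_regs[of p] finite_nat_set_iff_bounded by auto
  define K where "K = Suc (m + n)"
  let ?M = "prog_tm K p"
  have K: "\<forall>r\<in>regs p. r < K" using m by (auto simp: K_def)
  have std: "standard_tapes ?M xs = reg_tapes K (input xs)" for xs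
    by (simp add: standard_tapes_def reg_tapes_def input_def prog_tm_def)
  have "reach ?M (0, reg_tapes K (input xs)) (0 + num_states p, reg_tapes K (input [f xs]))"
    if "length xs = n" for xs
    by (rule tm_code_correct[OF assms[OF that] K]) (simp_all add: prog_tm_def)
  hence "tm_computes ?M n f"
    unfolding tm_computes_def std reach_def
    using wf_prog_tm[of K p] K by (simp add: prog_tm_def K_def)
  thus ?thesis ..
qed

section \<open>Functions computed by register programs\<close>

text \<open>
The registers are used as a stack with top \<open>r\<close>: all registers above are free and are returned
empty, those below must not be touched.  Because a program has to exist for every \<open>r\<close>, programs for two functions
can be combined without renaming registers.
\<close>
definition rec_fun :: "(nat \<Rightarrow> nat) \<Rightarrow> bool" where
  "rec_fun f \<longleftrightarrow> (\<forall>r. \<exists>p. \<forall>s. (\<forall>i>r. s i = 0) \<longrightarrow> exec p s (s(r := f (s r))))"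

lemma exec_cong: "exec p s t \<Longrightarrow> t = t' \<Longrightarrow> exec p s t'" by simp

lemma exec_Inc': "s' = s(r := Suc (s r)) \<Longrightarrow> exec (Inc r) s s'"
  by (simp add: exec.Inc)

lemma exec_Dec': "s' = s(r := s r - 1) \<Longrightarrow> exec (Dec r) s s'"
  using exec.Dec by simp

text \<open>
In the applications the states \<open>S k\<close> after \<open>k\<close> rounds are known in closed form.
\<close>
lemma exec_While_seq:
  assumes "\<And>k. k < n \<Longrightarrow> S k r \<noteq> 0 \<and> exec p (S k) (S (Suc k))" and "S n r = 0"
  shows "exec (While r p) (S 0) (S n)"
proof -
  have "j \<le> n \<Longrightarrow> exec (While r p) (S (n - j)) (S n)" for j
  proof (induction j)
    case 0
    thus ?case using assms(2) by (simp add: exec.While_stop)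
  next
    case (Suc j)
    hence *: "n - Suc j < n" "Suc (n - Suc j) = n - j" by auto
    show ?case using assms(1)[OF *(1)] Suc unfolding *(2) by (auto intro: exec.While_loop)
  qed
  from this[of n] show ?thesis by simp
qed

definition clear :: "nat \<Rightarrow> prog" where
  "clear a = While a (Dec a)"

definition move :: "nat \<Rightarrow> nat \<Rightarrow> prog" where
  "move a b = While a (Dec a ;; Inc b)"

definition move2 :: "nat \<Rightarrow> nat \<Rightarrow> nat \<Rightarrow> prog" where
  "move2 a b c = While a (Dec a ;; Inc b ;; Inc c)"

definition copy :: "nat \<Rightarrow> nat \<Rightarrow> nat \<Rightarrow> prog" where
  "copy a b t = (move2 a b t ;; move t a)"

lemma exec_clear: "exec (clear a) s (s(a := 0))"
proof -
  define S where "S k = s(a := s a - k)" for k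
  have "exec (While a (Dec a)) (S 0) (S (s a))"
    by (rule exec_While_seq) (auto simp: S_def fun_eq_iff intro!: exec_Dec')
  thus ?thesis by (simp add: clear_def S_def)
qed

lemma exec_move:
  assumes "a \<noteq> b"
  shows "exec (move a b) s (s(a := 0, b := s b + s a))"
proof -
  define S where "S k = s(a := s a - k, b := s b + k)" for k
  have "exec (While a (Dec a ;; Inc b)) (S 0) (S (s a))"
  proof (rule exec_While_seq)
    fix k assume "k < s a"
    thus "S k a \<noteq> 0 \<and> exec (Dec a ;; Inc b) (S k) (S (Suc k))"
      using assms by (auto simp: S_def fun_eq_iff intro!: exec.Seq[OF exec.Dec exec_Inc'])
  qed (use assms in \<open>simp add: S_def\<close>)
  thus ?thesis by (simp add: move_def S_def)
qed

lemma exec_move2: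
  assumes "a \<noteq> b" "a \<noteq> c" "b \<noteq> c"
  shows "exec (move2 a b c) s (s(a := 0, b := s b + s a, c := s c + s a))"
proof -
  define S where "S k = s(a := s a - k, b := s b + k, c := s c + k)" for k
  have "exec (While a (Dec a ;; Inc b ;; Inc c)) (S 0) (S (s a))"
  proof (rule exec_While_seq)
    fix k assume "k < s a"
    thus "S k a \<noteq> 0 \<and> exec (Dec a ;; Inc b ;; Inc c) (S k) (S (Suc k))"
      using assms
      by (auto simp: S_def fun_eq_iff intro!: exec.Seq[OF exec.Dec exec.Seq[OF exec.Inc exec_Inc']])
  qed (use assms in \<open>simp add: S_def\<close>)
  thus ?thesis by (simp add: move2_def S_def)
qed

lemma exec_copy:
  assumes "a \<noteq> b" "a \<noteq> t" "b \<noteq> t" "s t = 0"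
  shows "exec (copy a b t) s (s(b := s b + s a))"
  unfolding copy_def
  apply (rule exec.Seq[OF exec_move2 exec_cong[OF exec_move]])
  using assms by (auto simp: fun_eq_iff)

definition pack :: "nat \<Rightarrow> prog" where
  "pack r = (While (r+1) (Dec (r+1) ;; Inc r ;; Inc (r+2)) ;;
     While (r+2) (copy (r+2) r (r+1) ;; Dec (r+2)))"

text \<open>
After the first loop, register \<open>r+2\<close> holds the sum \<open>s\<close> of both arguments; the second loop adds
\<open>s\<close>, \<open>s - 1\<close>, ..., \<open>1\<close> to \<open>r\<close>, that is the triangular number in the definition of \<open>prod_encode\<close>.
\<close>
lemma exec_pack:
  assumes "s r = 0"
  shows "exec (pack r) s (s(r := prod_encode (s (r+1), s (r+2)), r+1 := 0, r+2 := 0))"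
proof -
  let ?m = "s (r+1)" and ?n = "s (r+2)"
  define t where "t = s(r+1 := 0, r := ?m, r+2 := ?n + ?m)"
  have 1: "exec (While (r+1) (Dec (r+1) ;; Inc r ;; Inc (r+2))) s t"
    using exec_move2[of "r+1" r "r+2" s] assms by (simp add: move2_def t_def)
  define S where "S k = t(r := ?m + (triangle (?n + ?m) - triangle (?n + ?m - k)), r+2 := ?n + ?m - k)" for k
  have mono: "triangle a \<le> triangle b" if "a \<le> b" for a b
    using that by (induction rule: dec_induct) auto
  have step: "triangle (?n + ?m) - triangle (?n + ?m - Suc k) =
      (triangle (?n + ?m) - triangle (?n + ?m - k)) + (?n + ?m - k)" if "k < ?n + ?m" for k
  proof -
    have "triangle (?n + ?m - k) = triangle (?n + ?m - Suc k) + (?n + ?m - k)"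
      using that triangle_Suc[of "?n + ?m - Suc k"] by (simp add: Suc_diff_Suc)
    moreover have "triangle (?n + ?m - k) \<le> triangle (?n + ?m)" by (rule mono) simp
    ultimately show ?thesis by linarith
  qed
  have 2: "exec (While (r+2) (copy (r+2) r (r+1) ;; Dec (r+2))) (S 0) (S (?n + ?m))"
  proof (rule exec_While_seq)
    fix k assume k: "k < ?n + ?m"
    have "exec (copy (r+2) r (r+1) ;; Dec (r+2)) (S k) (S (Suc k))"
      by (rule exec.Seq[OF exec_copy exec_Dec'])
         (use step[OF k] in \<open>auto simp: S_def t_def fun_eq_iff\<close>)
    thus "S k (r+2) \<noteq> 0 \<and> exec (copy (r+2) r (r+1) ;; Dec (r+2)) (S k) (S (Suc k))"
      using k by (simp add: S_def)
  qed (simp add: S_def)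
  have "S 0 = t" by (auto simp: S_def t_def fun_eq_iff)
  show ?thesis unfolding pack_def
    by (rule exec.Seq[OF 1 exec_cong[OF 2[unfolded \<open>S 0 = t\<close>]]])
       (auto simp: S_def t_def fun_eq_iff prod_encode_def add.commute)
qed

text \<open>
The pairing function runs through the antidiagonals.  This gives a way to decode \<open>z\<close> without
arithmetic: count from the pair \<open>(0, 0)\<close> up to the pair with number \<open>z\<close>.
\<close>
lemma prod_decode_Suc:
  "prod_decode (Suc z) =
     (case prod_decode z of (m, n) \<Rightarrow> if n = 0 then (0, Suc m) else (Suc m, n - 1))"
proof -
  obtain m n where z: "prod_decode z = (m, n)" by force
  hence z': "z = prod_encode (m, n)" by (metis prod_decode_inverse)
  have "Suc z = prod_encode (if n = 0 then (0, Suc m) else (Suc m, n - 1))"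
    by (cases n) (simp_all add: z' prod_encode_def)
  thus ?thesis by (simp add: z)
qed

text \<open>
Register \<open>r+3\<close> is a flag for the end of an antidiagonal: it is set before the second component is tested, and
reset if that component is positive.  The loop on \<open>r+2\<close> serves as a conditional: its body empties \<open>r+2\<close>
into \<open>r+4\<close>, so that it is executed at most once.  If the flag is still set after that, the
incremented first component becomes the second one, and the first one becomes zero.
\<close>
definition unpack :: "nat \<Rightarrow> prog" where
  "unpack r = While r (Dec r ;; Inc (r+1) ;; Inc (r+3) ;;
     While (r+2) (Dec (r+2) ;; Dec (r+3) ;; move (r+2) (r+4)) ;; move (r+4) (r+2) ;;
     While (r+3) (Dec (r+3) ;; move (r+1) (r+2)))"

lemma exec_While_once:
  assumes "s r \<noteq> 0" "exec p s t" "t r = 0"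
  shows "exec (While r p) s t"
  by (rule exec.While_loop[OF assms(1,2)]) (simp add: exec.While_stop assms(3))

lemma exec_unpack:
  assumes "\<forall>i>r. s i = 0"
  shows "exec (unpack r) s
    (s(r := 0, r+1 := fst (prod_decode (s r)), r+2 := snd (prod_decode (s r))))"
proof -
  let ?d = "\<lambda>k. prod_decode k"
  define S where "S k = s(r := s r - k, r+1 := fst (?d k), r+2 := snd (?d k))" for k
  have d0: "?d 0 = (0, 0)" by (simp add: prod_decode_def prod_decode_aux.simps)
  have z: "s (Suc r) = 0" "s (Suc (Suc r)) = 0" "s (r+3) = 0" "s (r+4) = 0" using assms by auto
  have "S 0 = s" using z d0 by (auto simp: S_def fun_eq_iff)
  have "exec (unpack r) (S 0) (S (s r))"
    unfolding unpack_def
  proof (rule exec_While_seq)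
    fix k assume k: "k < s r"
    obtain m n where mn: "?d k = (m, n)" by force
    define t where "t = (S k)(r := s r - Suc k, r+1 := Suc m, r+3 := 1)"
    have 1: "exec (Dec r) (S k) ((S k)(r := s r - Suc k))"
      by (rule exec_Dec') (auto simp: S_def fun_eq_iff)
    have 2: "exec (Inc (r+1)) ((S k)(r := s r - Suc k)) ((S k)(r := s r - Suc k, r+1 := Suc m))"
      by (rule exec_Inc') (auto simp: S_def mn fun_eq_iff)
    have 3: "exec (Inc (r+3)) ((S k)(r := s r - Suc k, r+1 := Suc m)) t"
      by (rule exec_Inc') (auto simp: S_def t_def mn z fun_eq_iff)
    define u where "u = (if n = 0 then t else t(r+2 := n - 1, r+3 := 0))"
    define v where "v = (if n = 0 then t else t(r+2 := 0, r+3 := 0, r+4 := n - 1))"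
    have 4: "exec (While (r+2) (Dec (r+2) ;; Dec (r+3) ;; move (r+2) (r+4))) t v"
    proof (cases "n = 0")
      case True
      thus ?thesis by (simp add: v_def t_def S_def mn exec.While_stop)
    next
      case False
      have "exec (Dec (r+2) ;; Dec (r+3) ;; move (r+2) (r+4)) t v"
        by (rule exec.Seq[OF exec.Dec exec.Seq[OF exec.Dec exec_cong[OF exec_move]]])
           (use False in \<open>auto simp: v_def t_def S_def mn z fun_eq_iff\<close>)
      thus ?thesis by (rule exec_While_once[rotated]) (use False in \<open>auto simp: t_def S_def mn v_def\<close>)
    qed
    have 5: "exec (move (r+4) (r+2)) v u"
      by (rule exec_cong[OF exec_move]) (auto simp: u_def v_def t_def S_def mn z fun_eq_iff)
    have Sk: "S (Suc k) = (if n = 0 then t(r+1 := 0, r+2 := Suc m, r+3 := 0) else u)"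
      by (auto simp: S_def t_def u_def prod_decode_Suc mn z fun_eq_iff)
    have 6: "exec (While (r+3) (Dec (r+3) ;; move (r+1) (r+2))) u (S (Suc k))"
    proof (cases "n = 0")
      case True
      have "exec (Dec (r+3) ;; move (r+1) (r+2)) u (S (Suc k))"
        by (rule exec.Seq[OF exec.Dec exec_cong[OF exec_move]])
           (use True in \<open>auto simp: prod_decode_Suc u_def t_def S_def mn z fun_eq_iff\<close>)
      thus ?thesis by (rule exec_While_once[rotated]) (use True in \<open>auto simp: t_def Sk u_def\<close>)
    next
      case False
      thus ?thesis using Sk by (simp add: exec.While_stop u_def)
    qed
    have 7: "exec (Dec r ;; Inc (r+1) ;; Inc (r+3) ;;
     While (r+2) (Dec (r+2) ;; Dec (r+3) ;; move (r+2) (r+4)) ;; move (r+4) (r+2) ;;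
     While (r+3) (Dec (r+3) ;; move (r+1) (r+2))) (S k) (S (Suc k))"
      by (rule exec.Seq[OF 1 exec.Seq[OF 2 exec.Seq[OF 3 exec.Seq[OF 4 exec.Seq[OF 5 6]]]]])
    have "S k r \<noteq> 0" using k by (simp add: S_def)
    from this 7 show "S k r \<noteq> 0 \<and> exec (Dec r ;; Inc (r+1) ;; Inc (r+3) ;;
     While (r+2) (Dec (r+2) ;; Dec (r+3) ;; move (r+2) (r+4)) ;; move (r+4) (r+2) ;;
     While (r+3) (Dec (r+3) ;; move (r+1) (r+2))) (S k) (S (Suc k))" ..
  qed (simp add: S_def)
  thus ?thesis unfolding \<open>S 0 = s\<close> by (simp add: S_def)
qed

abbreviation "pfst z \<equiv> fst (prod_decode z)"
abbreviation "psnd z \<equiv> snd (prod_decode z)"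

lemma rec_fun_id: "rec_fun (\<lambda>x. x)"
  unfolding rec_fun_def
  by (intro allI exI[of _ "clear (Suc _)"] impI exec_cong[OF exec_clear]) (auto simp: fun_eq_iff)

lemma rec_fun_Suc: "rec_fun Suc"
  unfolding rec_fun_def using exec.Inc by blast

lemma rec_fun_pred: "rec_fun (\<lambda>x. x - 1)"
  unfolding rec_fun_def using exec.Dec by blast

lemma rec_fun_zero: "rec_fun (\<lambda>x. 0)"
  unfolding rec_fun_def using exec_clear by blast

lemma rec_fun_comp:
  assumes "rec_fun f" "rec_fun g"
  shows "rec_fun (\<lambda>x. f (g x))"
  unfolding rec_fun_def
proof
  fix r
  obtain p q where
    p: "\<And>s. (\<forall>i>r. s i = 0) \<Longrightarrow> exec p s (s(r := f (s r)))" and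
    q: "\<And>s. (\<forall>i>r. s i = 0) \<Longrightarrow> exec q s (s(r := g (s r)))"
    using assms unfolding rec_fun_def by metis
  have "exec (q ;; p) s (s(r := f (g (s r))))" if "\<forall>i>r. s i = 0" for s
    by (rule exec.Seq[OF q[OF that] exec_cong[OF p]]) (use that in auto)
  thus "\<exists>p. \<forall>s. (\<forall>i>r. s i = 0) \<longrightarrow> exec p s (s(r := f (g (s r))))" by blast
qed

lemma rec_fun_pfst: "rec_fun pfst"
  unfolding rec_fun_def
proof (intro allI exI impI)
  fix r :: nat and s :: "nat \<Rightarrow> nat" assume s: "\<forall>i>r. s i = 0"
  show "exec (unpack r ;; clear (r+2) ;; move (r+1) r) s (s(r := pfst (s r)))"
    by (rule exec.Seq[OF exec_unpack exec.Seq[OF exec_clear exec_cong[OF exec_move]]])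
       (use s in \<open>auto simp: fun_eq_iff\<close>)
qed

lemma rec_fun_psnd: "rec_fun psnd"
  unfolding rec_fun_def
proof (intro allI exI impI)
  fix r :: nat and s :: "nat \<Rightarrow> nat" assume s: "\<forall>i>r. s i = 0"
  show "exec (unpack r ;; clear (r+1) ;; move (r+2) r) s (s(r := psnd (s r)))"
    by (rule exec.Seq[OF exec_unpack exec.Seq[OF exec_clear exec_cong[OF exec_move]]])
       (use s in \<open>auto simp: fun_eq_iff\<close>)
qed

lemma rec_fun_pair:
  assumes "rec_fun f" "rec_fun g"
  shows "rec_fun (\<lambda>x. prod_encode (f x, g x))"
  unfolding rec_fun_def
proof
  fix r
  obtain p where p: "\<And>s. (\<forall>i>r+1. s i = 0) \<Longrightarrow> exec p s (s(r+1 := f (s (r+1))))"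
    using assms(1) unfolding rec_fun_def by metis
  obtain q where q: "\<And>s. (\<forall>i>r+2. s i = 0) \<Longrightarrow> exec q s (s(r+2 := g (s (r+2))))"
    using assms(2) unfolding rec_fun_def by metis
  let ?p = "copy r (r+1) (r+2) ;; p ;; copy r (r+2) (r+3) ;; q ;; clear r ;; pack r"
  have "exec ?p s (s(r := prod_encode (f (s r), g (s r))))" if s: "\<forall>i>r. s i = 0" for s
    by (rule exec.Seq[OF exec_copy exec.Seq[OF p exec.Seq[OF exec_copy
          exec.Seq[OF q exec.Seq[OF exec_clear exec_cong[OF exec_pack]]]]]])
       (use s in \<open>auto simp: fun_eq_iff\<close>)
  thus "\<exists>p. \<forall>s. (\<forall>i>r. s i = 0) \<longrightarrow> exec p s (s(r := prod_encode (f (s r), g (s r))))"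
    by blast
qed

lemma rec_fun_iterate:
  assumes "rec_fun f"
  shows "rec_fun (\<lambda>z. (f ^^ pfst z) (psnd z))"
  unfolding rec_fun_def
proof
  fix r
  obtain p where p: "\<And>s. (\<forall>i>r+2. s i = 0) \<Longrightarrow> exec p s (s(r+2 := f (s (r+2))))"
    using assms(1) unfolding rec_fun_def by metis
  let ?p = "unpack r ;; While (r+1) (Dec (r+1) ;; p) ;; move (r+2) r"
  have "exec ?p s (s(r := (f ^^ pfst (s r)) (psnd (s r))))" if s: "\<forall>i>r. s i = 0" for s
  proof -
    let ?n = "pfst (s r)" and ?x = "psnd (s r)"
    define S where "S k = s(r := 0, r+1 := ?n - k, r+2 := (f ^^ k) ?x)" for k
    have 1: "exec (unpack r) s (S 0)"
      using exec_unpack[OF s] by (simp add: S_def)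
    have 2: "exec (While (r+1) (Dec (r+1) ;; p)) (S 0) (S ?n)"
    proof (rule exec_While_seq)
      fix k assume k: "k < ?n"
      have "exec (Dec (r+1) ;; p) (S k) (S (Suc k))"
        by (rule exec.Seq[OF exec.Dec exec_cong[OF p]]) (use s in \<open>auto simp: S_def fun_eq_iff\<close>)
      thus "S k (r+1) \<noteq> 0 \<and> exec (Dec (r+1) ;; p) (S k) (S (Suc k))" using k by (simp add: S_def)
    qed (simp add: S_def)
    show ?thesis
      by (rule exec.Seq[OF 1 exec.Seq[OF 2 exec_cong[OF exec_move]]])
         (use s in \<open>auto simp: S_def fun_eq_iff\<close>)
  qed
  thus "\<exists>p. \<forall>s. (\<forall>i>r. s i = 0) \<longrightarrow> exec p s (s(r := (f ^^ pfst (s r)) (psnd (s r))))"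
    by blast
qed

text \<open>
The initialization \<open>h\<close> restricts the search to start values for which it ends.
\<close>
lemma rec_fun_while:
  assumes "rec_fun f" "rec_fun t" "rec_fun h" and ex: "\<And>x. \<exists>n. t ((f ^^ n) (h x)) = 0"
  shows "rec_fun (\<lambda>x. (f ^^ (LEAST n. t ((f ^^ n) (h x)) = 0)) (h x))"
  unfolding rec_fun_def
proof
  fix r
  obtain p where p: "\<And>s. (\<forall>i>r. s i = 0) \<Longrightarrow> exec p s (s(r := f (s r)))"
    using assms(1) unfolding rec_fun_def by metis
  obtain q where q: "\<And>s. (\<forall>i>r+1. s i = 0) \<Longrightarrow> exec q s (s(r+1 := t (s (r+1))))"
    using assms(2) unfolding rec_fun_def by metis
  obtain u where u: "\<And>s. (\<forall>i>r. s i = 0) \<Longrightarrow> exec u s (s(r := h (s r)))"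
    using assms(3) unfolding rec_fun_def by metis
  let ?p = "(u ;; copy r (r+1) (r+2) ;; q) ;;
    While (r+1) (clear (r+1) ;; p ;; copy r (r+1) (r+2) ;; q)"
  have "exec ?p s (s(r := (f ^^ (LEAST n. t ((f ^^ n) (h (s r))) = 0)) (h (s r))))"
    if s: "\<forall>i>r. s i = 0" for s
  proof -
    let ?n = "LEAST n. t ((f ^^ n) (h (s r))) = 0"
    have n: "t ((f ^^ ?n) (h (s r))) = 0" using LeastI_ex[OF ex] .
    define S where "S k = s(r := (f ^^ k) (h (s r)), r+1 := t ((f ^^ k) (h (s r))))" for k
    have 1: "exec (u ;; copy r (r+1) (r+2) ;; q) s (S 0)"
      by (rule exec.Seq[OF u exec.Seq[OF exec_copy exec_cong[OF q]]])
         (use s in \<open>auto simp: S_def fun_eq_iff\<close>)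
    have 2: "exec (While (r+1) (clear (r+1) ;; p ;; copy r (r+1) (r+2) ;; q)) (S 0) (S ?n)"
    proof (rule exec_While_seq)
      fix k assume k: "k < ?n"
      have "exec (clear (r+1) ;; p ;; copy r (r+1) (r+2) ;; q) (S k) (S (Suc k))"
        by (rule exec.Seq[OF exec_clear exec.Seq[OF p exec.Seq[OF exec_copy exec_cong[OF q]]]])
           (use s in \<open>auto simp: S_def fun_eq_iff\<close>)
      moreover have "t ((f ^^ k) (h (s r))) \<noteq> 0" using not_less_Least[OF k] .
      ultimately show "S k (r+1) \<noteq> 0 \<and>
        exec (clear (r+1) ;; p ;; copy r (r+1) (r+2) ;; q) (S k) (S (Suc k))"
        by (simp add: S_def)
    qed (simp add: S_def n)
    show ?thesis
      by (rule exec.Seq[OF 1 exec_cong[OF 2]]) (use s n in \<open>auto simp: S_def fun_eq_iff\<close>)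
  qed
  thus "\<exists>p. \<forall>s. (\<forall>i>r. s i = 0) \<longrightarrow>
      exec p s (s(r := (f ^^ (LEAST n. t ((f ^^ n) (h (s r))) = 0)) (h (s r))))"
    by blast
qed

lemma recursive1_if_rec_fun:
  assumes "rec_fun f"
  shows "recursive1 f"
proof -
  obtain p where p: "\<And>s. (\<forall>i>0. s i = 0) \<Longrightarrow> exec p s (s(0 := f (s 0)))"
    using assms unfolding rec_fun_def by metis
  show ?thesis unfolding recursive1_def
  proof (rule tm_computes_prog)
    fix xs :: "nat list" assume "length xs = 1"
    thus "exec p (input xs) (input [f (xs ! 0)])"
      by (intro exec_cong[OF p]) (auto simp: input_def fun_eq_iff)
  qed
qed

lemma recursive2_if_rec_fun:
  assumes "rec_fun (\<lambda>z. f (pfst z) (psnd z))"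
  shows "recursive2 f"
proof -
  obtain p where p: "\<And>s. (\<forall>i>0. s i = 0) \<Longrightarrow> exec p s (s(0 := f (pfst (s 0)) (psnd (s 0))))"
    using assms unfolding rec_fun_def by metis
  show ?thesis unfolding recursive2_def
  proof (rule tm_computes_prog)
    fix xs :: "nat list" assume "length xs = 2"
    thus "exec (move 1 2 ;; move 0 1 ;; pack 0 ;; p) (input xs) (input [f (xs ! 0) (xs ! 1)])"
      by (intro exec.Seq[OF exec_move exec.Seq[OF exec_move exec.Seq[OF exec_pack exec_cong[OF p]]]])
         (auto simp: input_def fun_eq_iff)
  qed
qed

section \<open>Computable functions between encoded types\<close>

class encodable =
  fixes enc :: "'a \<Rightarrow> nat"
  assumes inj_enc: "inj enc"

lemma enc_eq_iff [simp]: "enc x = enc y \<longleftrightarrow> x = y"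
  using inj_enc by (auto dest: injD)

instantiation nat :: encodable
begin
definition enc_nat :: "nat \<Rightarrow> nat" where "enc_nat n = n"
instance by standard (simp add: enc_nat_def inj_def)
end

instantiation bool :: encodable
begin
text \<open>
Truth has the code \<open>0\<close>, for which \<open>rec_fun_cond\<close> selects the first alternative.
\<close>
definition enc_bool :: "bool \<Rightarrow> nat" where "enc_bool b = (if b then 0 else 1)"
instance by standard (simp add: enc_bool_def inj_def)
end

instantiation prod :: (encodable, encodable) encodable
begin
definition enc_prod :: "'a \<times> 'b \<Rightarrow> nat" where
  "enc_prod p = prod_encode (enc (fst p), enc (snd p))"
instance by standard (simp add: enc_prod_def inj_def)
end

instantiation list :: (encodable) encodable
begin
primrec enc_list :: "'a list \<Rightarrow> nat" where
  "enc_list [] = 0"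
| "enc_list (x # xs) = Suc (prod_encode (enc x, enc_list xs))"
instance
proof
  have "enc xs = enc ys \<longrightarrow> xs = ys" for xs ys :: "'a list"
  proof (induction xs arbitrary: ys)
    case Nil
    show ?case by (cases ys) auto
  next
    case (Cons x xs)
    thus ?case by (cases ys) auto
  qed
  thus "inj (enc :: 'a list \<Rightarrow> nat)" by (auto simp: inj_def)
qed
end

lemma surj_enc_nat: "surj (enc :: nat \<Rightarrow> nat)"
  by (simp add: enc_nat_def)

lemma surj_enc_prod:
  assumes "surj (enc :: 'a::encodable \<Rightarrow> nat)" "surj (enc :: 'b::encodable \<Rightarrow> nat)"
  shows "surj (enc :: 'a \<times> 'b \<Rightarrow> nat)"
proof (rule surjI)
  fix n
  show "enc (inv (enc :: 'a \<Rightarrow> nat) (pfst n), inv (enc :: 'b \<Rightarrow> nat) (psnd n)) = n"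
    using assms by (simp add: enc_prod_def surj_f_inv_f)
qed

lemma surj_enc_list:
  assumes "surj (enc :: 'a::encodable \<Rightarrow> nat)"
  shows "surj (enc :: 'a list \<Rightarrow> nat)"
proof -
  have "\<exists>xs :: 'a list. enc xs = n" for n
  proof (induction n rule: less_induct)
    case (less n)
    show ?case
    proof (cases n)
      case 0
      thus ?thesis by (intro exI[of _ "[]"]) simp
    next
      case (Suc k)
      have "psnd k \<le> k" using le_prod_encode_2[of "psnd k" "pfst k"] by simp
      then obtain xs :: "'a list" where "enc xs = psnd k" using less Suc by fastforce
      moreover obtain x :: 'a where "enc x = pfst k" using assms by (metis surjD)
      ultimately have "enc (x # xs) = n" by (simp add: Suc)
      thus ?thesis ..
    qed
  qed
  thus ?thesis by (metis surj_def)
qed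

definition computable :: "('a::encodable \<Rightarrow> 'b::encodable) \<Rightarrow> bool" where
  "computable f \<longleftrightarrow> (\<exists>g. rec_fun g \<and> (\<forall>x. g (enc x) = enc (f x)))"

named_theorems computable_intros

lemma computable_I: "rec_fun g \<Longrightarrow> (\<And>x. g (enc x) = enc (f x)) \<Longrightarrow> computable f"
  unfolding computable_def by blast

lemma computable_compose:
  assumes "computable f" "computable g"
  shows "computable (\<lambda>x. f (g x))"
proof -
  obtain f' g' where "rec_fun f'" "\<And>x. f' (enc x) = enc (f x)"
    "rec_fun g'" "\<And>x. g' (enc x) = enc (g x)"
    using assms unfolding computable_def by metis
  thus ?thesis by (intro computable_I[OF rec_fun_comp[of f' g']]) auto
qed

lemma rec_fun_const: "rec_fun (\<lambda>x. c)"
  by (induction c) (auto intro: rec_fun_zero rec_fun_comp[OF rec_fun_Suc])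

lemma computable_const [computable_intros]: "computable (\<lambda>x. c)"
  by (rule computable_I[OF rec_fun_const]) simp

lemma computable_id [computable_intros]: "computable (\<lambda>x. x)"
  by (rule computable_I[OF rec_fun_id]) simp

lemma computable_Pair [computable_intros]:
  assumes "computable f" "computable g"
  shows "computable (\<lambda>x. (f x, g x))"
proof -
  obtain f' g' where "rec_fun f'" "\<And>x. f' (enc x) = enc (f x)"
    "rec_fun g'" "\<And>x. g' (enc x) = enc (g x)"
    using assms unfolding computable_def by metis
  thus ?thesis
    by (intro computable_I[OF rec_fun_pair[of f' g']]) (auto simp: enc_prod_def)
qed

lemma computable_fst [computable_intros]: "computable f \<Longrightarrow> computable (\<lambda>x. fst (f x))"
  by (rule computable_compose[OF computable_I[OF rec_fun_pfst]]) (simp_all add: enc_prod_def)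

lemma computable_snd [computable_intros]: "computable f \<Longrightarrow> computable (\<lambda>x. snd (f x))"
  by (rule computable_compose[OF computable_I[OF rec_fun_psnd]]) (simp_all add: enc_prod_def)

text \<open>
A curried function of several arguments is called computable if it is so as a function of a
tuple; this rule serves to apply it to computable arguments.
\<close>
lemma computable_app2:
  assumes "computable (\<lambda>p. f (fst p) (snd p))" "computable a" "computable b"
  shows "computable (\<lambda>x. f (a x) (b x))"
  using computable_compose[OF assms(1) computable_Pair[OF assms(2,3)]] by simp

lemma computable_Suc [computable_intros]: "computable f \<Longrightarrow> computable (\<lambda>x. Suc (f x))"
  by (rule computable_compose[OF computable_I[OF rec_fun_Suc]]) (simp_all add: enc_nat_def)

lemma computable_pred: "computable f \<Longrightarrow> computable (\<lambda>x. f x - 1 :: nat)"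
  by (rule computable_compose[OF computable_I[OF rec_fun_pred]]) (simp_all add: enc_nat_def)

text \<open>
Iterating \<open>(u, v) \<mapsto> (v, v)\<close> from \<open>(f z, g z)\<close> for \<open>c z\<close> rounds leaves \<open>f z\<close> as the first
component if \<open>c z = 0\<close>, and \<open>g z\<close> otherwise.
\<close>
lemma rec_fun_cond:
  assumes "rec_fun c" "rec_fun f" "rec_fun g"
  shows "rec_fun (\<lambda>z. if c z = 0 then f z else g z)"
proof -
  let ?h = "\<lambda>p. prod_encode (psnd p, psnd p)"
  have "rec_fun (\<lambda>z. pfst ((\<lambda>w. (?h ^^ pfst w) (psnd w))
      (prod_encode (c z, prod_encode (f z, g z)))))"
    by (intro rec_fun_comp[OF rec_fun_pfst] rec_fun_comp[OF rec_fun_iterate] rec_fun_pair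
        rec_fun_psnd assms)
  moreover have "pfst ((?h ^^ n) (prod_encode (a, b))) = (if n = 0 then a else b)" for n a b
  proof -
    have "(?h ^^ Suc k) (prod_encode (a, b)) = prod_encode (b, b)" for k
      by (induction k) auto
    thus ?thesis by (cases n) auto
  qed
  ultimately show ?thesis by simp
qed

lemma computable_If [computable_intros]:
  assumes "computable c" "computable f" "computable g"
  shows "computable (\<lambda>x. if c x then f x else g x)"
proof -
  obtain c' f' g' where "rec_fun c'" "\<And>x. c' (enc x) = enc (c x)"
    "rec_fun f'" "\<And>x. f' (enc x) = enc (f x)" "rec_fun g'" "\<And>x. g' (enc x) = enc (g x)"
    using assms unfolding computable_def by metis
  thus ?thesis
    by (intro computable_I[OF rec_fun_cond[of c' f' g']]) (auto simp: enc_bool_def)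
qed

lemma computable_eq_0:
  assumes "computable f"
  shows "computable (\<lambda>x. f x = (0::nat))"
proof (rule computable_compose[OF computable_I assms])
  show "rec_fun (\<lambda>z. if z = 0 then 0 else 1)"
    by (intro rec_fun_cond rec_fun_id rec_fun_const)
qed (simp add: enc_bool_def enc_nat_def)

lemma rec_fun_rec_nat:
  assumes "rec_fun b" "rec_fun s"
  shows "rec_fun (\<lambda>z. rec_nat (b (pfst z)) (\<lambda>i a. s (prod_encode (pfst z, prod_encode (i, a)))) (psnd z))"
proof -
  \<comment> \<open>The iterated state is \<open>(x, i, a)\<close>.\<close>
  let ?h = "\<lambda>w. prod_encode (pfst w, prod_encode (Suc (pfst (psnd w)), s w))"
  let ?r = "\<lambda>x. rec_nat (b x) (\<lambda>i a. s (prod_encode (x, prod_encode (i, a))))"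
  have "rec_fun (\<lambda>z. psnd (psnd ((\<lambda>w. (?h ^^ pfst w) (psnd w))
      (prod_encode (psnd z, prod_encode (pfst z, prod_encode (0, b (pfst z))))))))"
    by (intro rec_fun_comp[OF rec_fun_psnd] rec_fun_comp[OF rec_fun_iterate] rec_fun_pair
        rec_fun_psnd rec_fun_pfst rec_fun_comp[OF rec_fun_Suc] rec_fun_comp[OF rec_fun_pfst]
        rec_fun_comp[OF assms(1)] rec_fun_const assms(2))
  moreover have "(?h ^^ n) (prod_encode (x, prod_encode (0, b x))) =
      prod_encode (x, prod_encode (n, ?r x n))" for n x
    by (induction n) auto
  ultimately show ?thesis by simp
qed

lemma computable_rec_nat [computable_intros]:
  assumes "computable n" "computable b" "computable (\<lambda>p. s (fst p) (fst (snd p)) (snd (snd p)))"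
  shows "computable (\<lambda>x. rec_nat (b x) (s x) (n x))"
proof -
  obtain n' b' s' where n: "rec_fun n'" "\<And>x. n' (enc x) = enc (n x)"
    and b: "rec_fun b'" "\<And>x. b' (enc x) = enc (b x)"
    and s: "rec_fun s'" "\<And>p. s' (enc p) = enc (s (fst p) (fst (snd p)) (snd (snd p)))"
    using assms unfolding computable_def by metis
  let ?R = "\<lambda>z. rec_nat (b' (pfst z)) (\<lambda>i a. s' (prod_encode (pfst z, prod_encode (i, a)))) (psnd z)"
  have "rec_fun (\<lambda>z. ?R (prod_encode (z, n' z)))"
    by (intro rec_fun_comp[OF rec_fun_rec_nat[OF b(1) s(1)]] rec_fun_pair rec_fun_id n)
  moreover have "rec_nat (b' (enc x)) (\<lambda>i a. s' (prod_encode (enc x, prod_encode (i, a)))) k =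
      enc (rec_nat (b x) (s x) k)" for x k
  proof (induction k)
    case (Suc k)
    thus ?case using s(2)[of "(x, k, rec_nat (b x) (s x) k)"] by (simp add: enc_prod_def enc_nat_def)
  qed (simp add: b)
  ultimately show ?thesis by (intro computable_I) (auto simp: n enc_nat_def)
qed

lemma computable_funpow [computable_intros]:
  fixes f :: "'a::encodable \<Rightarrow> 'b::encodable \<Rightarrow> 'b"
  assumes "computable n" "computable (\<lambda>p. f (fst p) (snd p))" "computable a"
  shows "computable (\<lambda>x. (f x ^^ n x) (a x))"
proof -
  have "(f x ^^ k) (a x) = rec_nat (a x) (\<lambda>i. f x) k" for x k
    by (induction k) auto
  moreover have "computable (\<lambda>x. rec_nat (a x) (\<lambda>i. f x) (n x))"
    by (intro computable_rec_nat assms computable_app2[OF assms(2)] computable_intros)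
  ultimately show ?thesis by simp
qed

lemma computable_add [computable_intros]:
  assumes "computable f" "computable g"
  shows "computable (\<lambda>x. f x + g x :: nat)"
proof -
  have "(Suc ^^ m) n = m + n" for m n by (induction m) auto
  moreover have "computable (\<lambda>x. (Suc ^^ f x) (g x))" by (intro computable_intros assms)
  ultimately show ?thesis by simp
qed

lemma computable_diff [computable_intros]:
  assumes "computable f" "computable g"
  shows "computable (\<lambda>x. f x - g x :: nat)"
proof -
  have "((\<lambda>k. k - 1) ^^ m) n = n - m" for m n :: nat by (induction m) auto
  moreover have "computable (\<lambda>x. ((\<lambda>k. k - 1) ^^ g x) (f x))"
    by (intro computable_pred computable_intros assms)
  ultimately show ?thesis by simp
qed

lemma computable_mult [computable_intros]:
  assumes "computable f" "computable g"
  shows "computable (\<lambda>x. f x * g x :: nat)"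
proof -
  have "((\<lambda>k. n + k) ^^ m) 0 = m * n" for m n :: nat by (induction m) auto
  moreover have "computable (\<lambda>x. ((\<lambda>k. g x + k) ^^ f x) 0)"
    by (intro computable_intros assms computable_compose[OF assms(2)])
  ultimately show ?thesis by simp
qed

lemma computable_power [computable_intros]:
  assumes "computable f" "computable g"
  shows "computable (\<lambda>x. f x ^ g x :: nat)"
proof -
  have "((\<lambda>k. n * k) ^^ m) 1 = n ^ m" for m n :: nat by (induction m) auto
  moreover have "computable (\<lambda>x. ((\<lambda>k. f x * k) ^^ g x) 1)"
    by (intro computable_intros assms computable_compose[OF assms(1)])
  ultimately show ?thesis by simp
qed

lemma computable_Not [computable_intros]: "computable P \<Longrightarrow> computable (\<lambda>x. \<not> P x)"
proof -
  assume "computable P"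
  hence "computable (\<lambda>x. if P x then False else True)" by (intro computable_intros)
  moreover have "(\<lambda>x. if P x then False else True) = (\<lambda>x. \<not> P x)" by auto
  ultimately show ?thesis by (simp only:)
qed

lemma computable_conj [computable_intros]:
  "computable P \<Longrightarrow> computable Q \<Longrightarrow> computable (\<lambda>x. P x \<and> Q x)"
proof -
  assume "computable P" "computable Q"
  hence "computable (\<lambda>x. if P x then Q x else False)" by (intro computable_intros)
  moreover have "(\<lambda>x. if P x then Q x else False) = (\<lambda>x. P x \<and> Q x)" by auto
  ultimately show ?thesis by (simp only:)
qed

lemma computable_le [computable_intros]:
  "computable f \<Longrightarrow> computable g \<Longrightarrow> computable (\<lambda>x. f x \<le> (g x :: nat))"
  using computable_eq_0[OF computable_diff[of f g]] by simp

lemma computable_less [computable_intros]: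
  "computable f \<Longrightarrow> computable g \<Longrightarrow> computable (\<lambda>x. f x < (g x :: nat))"
  using computable_Not[OF computable_le[of g f]] by (simp add: not_le)

lemma computable_enc [computable_intros]: "computable f \<Longrightarrow> computable (\<lambda>x. enc (f x))"
  by (rule computable_compose[OF computable_I[OF rec_fun_id]]) (simp_all add: enc_nat_def)

lemma computable_eq [computable_intros]:
  assumes "computable f" "computable g"
  shows "computable (\<lambda>x. f x = g x)"
proof -
  have "computable (\<lambda>x. enc (f x) \<le> enc (g x) \<and> enc (g x) \<le> enc (f x))"
    by (intro computable_intros assms)
  moreover have "enc (f x) \<le> enc (g x) \<and> enc (g x) \<le> enc (f x) \<longleftrightarrow> f x = g x" for x
    by (metis enc_eq_iff order_antisym order_refl)
  ultimately show ?thesis by simp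
qed

lemma computable_div [computable_intros]:
  assumes "computable f" "computable g"
  shows "computable (\<lambda>x. f x div g x :: nat)"
proof -
  let ?d = "\<lambda>m n. rec_nat 0 (\<lambda>i a. if Suc a * n \<le> m then Suc a else a) (m::nat)"
  have "m div n = (if n = 0 then 0 else ?d m n)" for m n :: nat
  proof (cases "n = 0")
    case False
    have *: "rec_nat 0 (\<lambda>i a. if Suc a * n \<le> m then Suc a else a) k = min k (m div n)" for k
    proof (induction k)
      case (Suc k)
      have "Suc k * n \<le> m \<longleftrightarrow> Suc k \<le> m div n" "Suc (m div n) * n > m"
        using False by (simp_all add: less_eq_div_iff_mult_less_eq dividend_less_div_times)
      moreover have "Suc (m div n) * n \<le> m \<longleftrightarrow> Suc (m div n) \<le> m div n"
        using False by (simp only: less_eq_div_iff_mult_less_eq)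
      ultimately show ?case using Suc by (auto simp: min_def simp del: mult_Suc)
    qed simp
    have "m div n \<le> m" by simp
    thus ?thesis using False by (simp only: * if_False min.absorb2)
  qed simp
  moreover have "computable (\<lambda>x. if g x = 0 then 0 else ?d (f x) (g x))"
    by (intro computable_intros assms computable_compose[OF assms(1)] computable_compose[OF assms(2)])
  ultimately show ?thesis by simp
qed

lemma computable_mod [computable_intros]:
  assumes "computable f" "computable g"
  shows "computable (\<lambda>x. f x mod g x :: nat)"
proof -
  have "computable (\<lambda>x. f x - (f x div g x) * g x)" by (intro computable_intros assms)
  thus ?thesis by (simp add: minus_div_mult_eq_mod)
qed

lemma computable_Least:
  fixes P :: "nat \<Rightarrow> nat \<Rightarrow> bool"
  assumes "computable (\<lambda>p. P (fst p) (snd p))" and ex: "\<And>x. \<exists>n. P x n"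
  shows "computable (\<lambda>x. LEAST n. P x n)"
proof -
  obtain g where g: "rec_fun g" "\<And>p. g (enc p) = enc (P (fst p) (snd p))"
    using assms unfolding computable_def by metis
  let ?f = "\<lambda>z. prod_encode (pfst z, Suc (psnd z))"
  have pow: "(?f ^^ n) z = prod_encode (pfst z, psnd z + n)" for n z
    by (induction n) auto
  have g': "g (prod_encode (x, n)) = 0 \<longleftrightarrow> P x n" for x n
    using g(2)[of "(x, n)"] by (simp add: enc_prod_def enc_nat_def enc_bool_def)
  have "rec_fun (\<lambda>x. psnd ((?f ^^ (LEAST n. g ((?f ^^ n) (prod_encode (x, 0))) = 0)) (prod_encode (x, 0))))"
    by (intro rec_fun_comp[OF rec_fun_psnd] rec_fun_while rec_fun_pair rec_fun_pfst
        rec_fun_comp[OF rec_fun_Suc] rec_fun_psnd rec_fun_id rec_fun_const g(1))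
       (simp add: pow g' ex)
  thus ?thesis by (intro computable_I) (simp_all add: pow g' enc_nat_def)
qed

text \<open>
Head and tail are decoded from the predecessor of the code.  For the empty list this gives
meaningless numbers, which the conditional discards.
\<close>
lemma computable_list_case:
  assumes "computable l" "computable a" "computable (\<lambda>p. c (fst p) (fst (snd p)) (snd (snd p)))"
  shows "computable (\<lambda>x. case l x of [] \<Rightarrow> a x | y # ys \<Rightarrow> c x y ys)"
proof -
  obtain l' a' c' where l: "rec_fun l'" "\<And>x. l' (enc x) = enc (l x)"
    and a: "rec_fun a'" "\<And>x. a' (enc x) = enc (a x)"
    and c: "rec_fun c'" "\<And>p. c' (enc p) = enc (c (fst p) (fst (snd p)) (snd (snd p)))"
    using assms unfolding computable_def by metis
  have "rec_fun (\<lambda>z. if l' z = 0 then a' z else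
      c' (prod_encode (z, prod_encode (pfst (l' z - 1), psnd (l' z - 1)))))"
    by (intro rec_fun_cond rec_fun_comp[OF c(1)] rec_fun_pair rec_fun_id rec_fun_comp[OF rec_fun_pfst]
        rec_fun_comp[OF rec_fun_psnd] rec_fun_comp[OF rec_fun_pred] l a)
  moreover have "(if l' (enc x) = 0 then a' (enc x) else
      c' (prod_encode (enc x, prod_encode (pfst (l' (enc x) - 1), psnd (l' (enc x) - 1))))) =
      enc (case l x of [] \<Rightarrow> a x | y # ys \<Rightarrow> c x y ys)" for x
  proof (cases "l x")
    case (Cons y ys)
    thus ?thesis using c(2)[of "(x, y, ys)"] by (simp add: l enc_prod_def)
  qed (simp add: l a)
  ultimately show ?thesis by (rule computable_I)
qed

declare computable_list_case [computable_intros]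

lemma computable_Cons [computable_intros]:
  assumes "computable f" "computable g"
  shows "computable (\<lambda>x. f x # g x)"
proof -
  obtain f' g' where "rec_fun f'" "\<And>x. f' (enc x) = enc (f x)"
    "rec_fun g'" "\<And>x. g' (enc x) = enc (g x)"
    using assms unfolding computable_def by metis
  thus ?thesis
    by (intro computable_I[OF rec_fun_comp[OF rec_fun_Suc rec_fun_pair[of f' g']]]) auto
qed

text \<open>
The step on pairs of a remaining list and an accumulator is iterated too often: the number of
rounds is the code of the list, a bound for its length, and the step does nothing once the list is empty.
\<close>
lemma computable_fold [computable_intros]:
  assumes "computable (\<lambda>p. s (fst p) (fst (snd p)) (snd (snd p)))" "computable l" "computable b"
  shows "computable (\<lambda>x. fold (s x) (l x) (b x))"
proof -
  let ?h = "\<lambda>x w. case fst w of [] \<Rightarrow> ([], snd w) | y # ys \<Rightarrow> (ys, s x y (snd w))"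
  have *: "length xs \<le> n \<Longrightarrow> (?h x ^^ n) (xs, a) = ([], fold (s x) xs a)" for x xs a n
  proof (induction n arbitrary: xs a)
    case (Suc n)
    thus ?case by (cases xs) (auto simp: funpow_Suc_right simp del: funpow.simps)
  qed auto
  have len: "length xs \<le> enc xs" for xs :: "'b list"
  proof (induction xs)
    case (Cons y ys)
    thus ?case using le_prod_encode_2[of "enc ys" "enc y"] by simp
  qed simp
  have s: "computable (\<lambda>w. s (f w) (g w) (h w))"
    if "computable f" "computable g" "computable h" for f g h
    using computable_compose[OF assms(1) computable_Pair[OF that(1) computable_Pair[OF that(2,3)]]]
    by simp
  have "computable (\<lambda>x. snd ((?h x ^^ enc (l x)) (l x, b x)))"
    by (intro computable_intros s assms)
  thus ?thesis by (simp add: *[OF len])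
qed

lemma computable_rev [computable_intros]:
  assumes "computable l"
  shows "computable (\<lambda>x. rev (l x))"
proof -
  have "computable (\<lambda>x. fold (\<lambda>y a. y # a) (l x) [])" by (intro computable_intros assms)
  thus ?thesis by (simp add: fold_Cons_rev)
qed

lemma computable_map [computable_intros]:
  assumes "computable (\<lambda>p. f (fst p) (snd p))" "computable l"
  shows "computable (\<lambda>x. map (f x) (l x))"
proof -
  have "fold (\<lambda>y a. f x y # a) ys zs = rev (map (f x) ys) @ zs" for x ys zs
    by (induction ys arbitrary: zs) auto
  moreover have "computable (\<lambda>x. rev (fold (\<lambda>y a. f x y # a) (l x) []))"
    by (intro computable_intros assms computable_app2[OF assms(1)])
  ultimately show ?thesis by simp
qed

lemma computable_append [computable_intros]:
  assumes "computable l" "computable m"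
  shows "computable (\<lambda>x. l x @ m x)"
proof -
  have "computable (\<lambda>x. fold (\<lambda>y a. y # a) (rev (l x)) (m x))" by (intro computable_intros assms)
  moreover have "fold (\<lambda>y a. y # a) (rev ys) zs = ys @ zs" for ys zs :: "'b list"
    by (induction ys) auto
  ultimately show ?thesis by simp
qed

lemma computable_zip [computable_intros]:
  assumes "computable l" "computable m"
  shows "computable (\<lambda>x. zip (l x) (m x))"
proof -
  let ?s = "\<lambda>y w. case fst w of [] \<Rightarrow> ([], snd w) | z # zs \<Rightarrow> (zs, (y, z) # snd w)"
  have "snd (fold ?s ys (zs, a)) = rev (zip ys zs) @ a"
    for ys :: "'b list" and zs :: "'c list" and a
  proof (induction ys arbitrary: zs a)
    case (Cons y ys)
    thus ?case by (cases zs) auto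
  qed simp
  moreover have "computable (\<lambda>x. rev (snd (fold ?s (l x) (m x, []))))"
    by (intro computable_intros assms)
  ultimately show ?thesis by simp
qed

lemma computable_tl [computable_intros]: "computable l \<Longrightarrow> computable (\<lambda>x. tl (l x))"
  unfolding tl_def by (intro computable_intros)

lemma computable_replicate [computable_intros]:
  assumes "computable n" "computable f"
  shows "computable (\<lambda>x. replicate (n x) (f x))"
proof -
  have "((\<lambda>l. f x # l) ^^ k) [] = replicate k (f x)" for x k by (induction k) auto
  moreover have "computable (\<lambda>x. ((\<lambda>l. f x # l) ^^ n x) [])"
    by (intro computable_intros assms computable_compose[OF assms(2)])
  ultimately show ?thesis by simp
qed

lemma computable_sum_list [computable_intros]:
  assumes "computable l"
  shows "computable (\<lambda>x. sum_list (l x) :: nat)"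
proof -
  have "fold (+) ys a = sum_list ys + a" for ys and a :: nat by (induction ys arbitrary: a) auto
  moreover have "computable (\<lambda>x. fold (\<lambda>y a. y + a) (l x) 0)" by (intro computable_intros assms)
  ultimately show ?thesis by simp
qed

section \<open>Simulation of Turing machines\<close>

text \<open>
A tape is represented by two lists of symbols that are continued by blanks: the cells left
of the head, starting with the nearest one, and the cells from the head on to the right.  The
position of the head is not recorded; the output can be read off without it.
\<close>
type_synonym zipper = "nat list \<times> nat list"

definition zread :: "zipper \<Rightarrow> nat" where
  "zread z = (case snd z of [] \<Rightarrow> 0 | c # cs \<Rightarrow> c)"

definition zact :: "nat \<times> nat \<Rightarrow> zipper \<Rightarrow> zipper" where
  "zact a z =
     (if snd a = 0 then
        (tl (fst z), (case fst z of [] \<Rightarrow> 0 | c # cs \<Rightarrow> c) # fst a # tl (snd z))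
      else if snd a = 1 then (fst z, fst a # tl (snd z))
      else (fst a # fst z, tl (snd z)))"

text \<open>
A machine is described by its transition table, the halting state, the starting state and the
tapes that are blank at the start, those after the tapes for the arguments.
\<close>
type_synonym machine =
  "((nat \<times> nat list) \<times> (nat \<times> (nat \<times> nat) list)) list \<times> nat \<times> nat \<times> zipper list"

definition lookup :: "('k \<times> nat \<times> 'v list) list \<Rightarrow> 'k \<Rightarrow> nat \<times> 'v list" where
  "lookup tab k = fold (\<lambda>e v. if fst e = k then snd e else v) tab (0, [])"

definition sim_step :: "machine \<Rightarrow> nat \<times> zipper list \<Rightarrow> nat \<times> zipper list" where
  "sim_step m c =
     (if fst c = fst (snd m) then c
      else (fst (lookup (fst m) (fst c, map zread (snd c))),
        map (\<lambda>p. zact (fst p) (snd p))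
          (zip (snd (lookup (fst m) (fst c, map zread (snd c)))) (snd c))))"

definition sim :: "machine \<Rightarrow> nat list \<Rightarrow> nat \<Rightarrow> nat \<times> zipper list" where
  "sim m xs t = (sim_step m ^^ t)
     (fst (snd (snd m)), map (\<lambda>x. ([], replicate x 1)) xs @ snd (snd (snd m)))"

definition sim_halted :: "machine \<Rightarrow> nat list \<Rightarrow> nat \<Rightarrow> bool" where
  "sim_halted m xs t \<longleftrightarrow> fst (sim m xs t) = fst (snd m)"

definition sim_output :: "machine \<Rightarrow> nat list \<Rightarrow> nat \<Rightarrow> nat" where
  "sim_output m xs t = (case snd (sim m xs t) of [] \<Rightarrow> 0 | z # zs \<Rightarrow> sum_list (snd z))"

lemma computable_zread [computable_intros]: "computable z \<Longrightarrow> computable (\<lambda>x. zread (z x))"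
  unfolding zread_def by (intro computable_intros)

lemma computable_zact [computable_intros]:
  "computable a \<Longrightarrow> computable z \<Longrightarrow> computable (\<lambda>x. zact (a x) (z x))"
  unfolding zact_def by (intro computable_intros)

lemma computable_lookup [computable_intros]:
  fixes tab :: "'a::encodable \<Rightarrow> ('k::encodable \<times> nat \<times> 'v::encodable list) list"
  assumes "computable tab" "computable k"
  shows "computable (\<lambda>x. lookup (tab x) (k x))"
  unfolding lookup_def by (intro computable_intros assms computable_compose[OF assms(2)])

lemma computable_sim_step [computable_intros]:
  "computable m \<Longrightarrow> computable c \<Longrightarrow> computable (\<lambda>x. sim_step (m x) (c x))"
  unfolding sim_step_def by (intro computable_intros)

lemma computable_sim [computable_intros]:
  assumes "computable m" "computable xs" "computable t"
  shows "computable (\<lambda>x. sim (m x) (xs x) (t x))"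
  unfolding sim_def by (intro computable_intros assms computable_compose[OF assms(1)])

lemma computable_sim_halted [computable_intros]:
  "computable m \<Longrightarrow> computable xs \<Longrightarrow> computable t \<Longrightarrow>
    computable (\<lambda>x. sim_halted (m x) (xs x) (t x))"
  unfolding sim_halted_def by (intro computable_intros)

lemma computable_sim_output [computable_intros]:
  "computable m \<Longrightarrow> computable xs \<Longrightarrow> computable t \<Longrightarrow>
    computable (\<lambda>x. sim_output (m x) (xs x) (t x))"
  unfolding sim_output_def by (intro computable_intros)

primrec nth0 :: "nat list \<Rightarrow> nat \<Rightarrow> nat" where
  "nth0 [] i = 0"
| "nth0 (x # xs) i = (case i of 0 \<Rightarrow> x | Suc j \<Rightarrow> nth0 xs j)"

lemma nth0_tl: "nth0 (tl xs) i = nth0 xs (Suc i)"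
  by (cases xs) auto

lemma nth0_0: "nth0 xs 0 = (case xs of [] \<Rightarrow> 0 | c # cs \<Rightarrow> c)"
  by (cases xs) auto

lemma nth0_replicate: "nth0 (replicate n c) i = (if i < n then c else 0)"
  by (induction n arbitrary: i) (auto split: nat.split)

lemma sum_list_unary:
  "(\<And>i. nth0 xs i = (if i < n then 1 else 0)) \<Longrightarrow> sum_list xs = n"
proof (induction xs arbitrary: n)
  case Nil
  show ?case using Nil[of 0] by (cases n) auto
next
  case (Cons x xs)
  have "nth0 xs i = (if i < n - 1 then 1 else 0)" for i
    using Cons.prems[of "Suc i"] by (auto split: if_splits)
  hence "sum_list xs = n - 1" by (rule Cons.IH)
  thus ?case using Cons.prems[of 0] by (auto split: if_splits)
qed

text \<open>
Both lists may end in superfluous blanks, hence the comparison by \<open>nth0\<close>.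
\<close>
definition zrep :: "tape \<Rightarrow> zipper \<Rightarrow> bool" where
  "zrep tp z \<longleftrightarrow> (\<forall>i. snd tp (fst tp + int i) = nth0 (snd z) i \<and>
     snd tp (fst tp - 1 - int i) = nth0 (fst z) i)"

lemma zrep_read: "zrep tp z \<Longrightarrow> zread z = read_tape tp"
  unfolding zrep_def zread_def by (cases tp) (metis nth0_0 add_0_right fst_conv of_nat_0 read_tape.simps snd_conv)

fun move_num :: "move \<Rightarrow> nat" where
  "move_num Left = 0" | "move_num Stay = 1" | "move_num Right = 2"

lemma zrep_act:
  assumes "zrep tp z"
  shows "zrep (act_tape (c, mv) tp) (zact (c, move_num mv) z)"
proof -
  obtain h t where tp: "tp = (h, t)" by force
  have R: "t (h + int i) = nth0 (snd z) i" and L: "t (h - 1 - int i) = nth0 (fst z) i" for i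
    using assms by (auto simp: zrep_def tp)
  show ?thesis
  proof (cases mv)
    case Left
    have "(t(h := c)) (h - 1 + int i) =
        nth0 ((case fst z of [] \<Rightarrow> 0 | c # cs \<Rightarrow> c) # c # tl (snd z)) i" for i
    proof (cases i)
      case 0
      thus ?thesis using L[of 0] by (simp add: nth0_0)
    next
      case (Suc j)
      thus ?thesis using R[of j] by (cases j) (auto simp: nth0_tl algebra_simps)
    qed
    moreover have "(t(h := c)) (h - 1 - 1 - int i) = nth0 (tl (fst z)) i" for i
      using L[of "Suc i"] by (simp add: nth0_tl algebra_simps)
    ultimately show ?thesis by (simp add: zrep_def tp Left zact_def)
  next
    case Stay
    have "(t(h := c)) (h + int i) = nth0 (c # tl (snd z)) i" for i
      using R[of i] by (cases i) (auto simp: nth0_tl)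
    moreover have "(t(h := c)) (h - 1 - int i) = nth0 (fst z) i" for i
      using L[of i] by simp
    ultimately show ?thesis by (simp add: zrep_def tp Stay zact_def)
  next
    case Right
    have "(t(h := c)) (h + 1 + int i) = nth0 (tl (snd z)) i" for i
      using R[of "Suc i"] by (simp add: nth0_tl algebra_simps)
    moreover have "(t(h := c)) (h + 1 - 1 - int i) = nth0 (c # fst z) i" for i
    proof (cases i)
      case (Suc j)
      thus ?thesis using L[of j] by (simp add: algebra_simps)
    qed simp
    ultimately show ?thesis by (simp add: zrep_def tp Right zact_def)
  qed
qed

lemma lookup_graph:
  assumes "k \<in> set ks"
  shows "lookup (map (\<lambda>k. (k, F k)) ks) k = F k"
proof -
  have "fold (\<lambda>e v. if fst e = k then snd e else v) (map (\<lambda>k. (k, F k)) ks) a =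
      (if k \<in> set ks then F k else a)" for a
    by (induction ks arbitrary: a) auto
  thus ?thesis using assms by (simp add: lookup_def)
qed

definition valid_config :: "tm \<Rightarrow> nat \<times> tape list \<Rightarrow> bool" where
  "valid_config M c \<longleftrightarrow> fst c < states M \<and> length (snd c) = tapes M \<and>
     (\<forall>tp\<in>set (snd c). \<forall>i. snd tp i < symbols M)"

definition sim_rel :: "nat \<times> tape list \<Rightarrow> nat \<times> zipper list \<Rightarrow> bool" where
  "sim_rel c d \<longleftrightarrow> fst c = fst d \<and> list_all2 zrep (snd c) (snd d)"

definition action_code :: "nat \<times> (nat \<times> move) list \<Rightarrow> nat \<times> (nat \<times> nat) list" where
  "action_code v = (fst v, map (\<lambda>a. (fst a, move_num (snd a))) (snd v))"

definition describes :: "machine \<Rightarrow> tm \<Rightarrow> nat \<Rightarrow> bool" where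
  "describes m M n \<longleftrightarrow>
     (\<forall>q cs. q < states M \<and> length cs = tapes M \<and> set cs \<subseteq> {..<symbols M} \<longrightarrow>
        lookup (fst m) (q, cs) = action_code (delta M q cs)) \<and>
     fst (snd m) = halt M \<and> fst (snd (snd m)) = start M \<and>
     snd (snd (snd m)) = replicate (tapes M - n) ([], [])"

text \<open>
A state and a list of symbols under the heads can be combined in finitely many ways only, so the
relevant part of the transition function fits into a table.
\<close>
lemma describes_exists: "\<exists>m. describes m M n"
proof -
  let ?K = "{..<states M} \<times> {cs. set cs \<subseteq> {..<symbols M} \<and> length cs = tapes M}"
  have "finite ?K" by (intro finite_cartesian_product finite_lists_length_eq) auto
  then obtain ks where ks: "set ks = ?K" using finite_list by blast
  let ?F = "\<lambda>k. action_code (delta M (fst k) (snd k))"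
  have "lookup (map (\<lambda>k. (k, ?F k)) ks) (q, cs) = action_code (delta M q cs)"
    if "q < states M" "length cs = tapes M" "set cs \<subseteq> {..<symbols M}" for q cs
    using lookup_graph[of "(q, cs)" ks ?F] that ks by simp
  hence "describes (map (\<lambda>k. (k, ?F k)) ks, halt M, start M, replicate (tapes M - n) ([], [])) M n"
    by (simp add: describes_def)
  thus ?thesis ..
qed

lemma sim_step_correct:
  assumes "wf_tm M" "describes m M n" "valid_config M c" "sim_rel c d"
  shows "valid_config M (step M c) \<and> sim_rel (step M c) (sim_step m d)"
proof (cases "fst c = halt M")
  case True
  thus ?thesis using assms
    by (cases c; cases d) (simp add: sim_rel_def sim_step_def describes_def)
next
  case False
  obtain q ts where c: "c = (q, ts)" by force
  obtain zs where d: "d = (q, zs)" and zs: "list_all2 zrep ts zs"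
    using assms(4) by (cases d) (simp add: sim_rel_def c)
  have len: "length ts = tapes M" "length zs = tapes M"
    using assms(3) list_all2_lengthD[OF zs] by (simp_all add: valid_config_def c)
  let ?cs = "map read_tape ts"
  have read: "map zread zs = ?cs"
    using zs by (auto simp: list_all2_conv_all_nth zrep_read intro!: nth_equalityI)
  have cs: "length ?cs = tapes M" "set ?cs \<subseteq> {..<symbols M}"
    using assms(3) len by (auto simp: valid_config_def c)
  have q: "q < states M" using assms(3) by (simp add: valid_config_def c)
  obtain q' as where qa: "delta M q ?cs = (q', as)" by force
  have wf: "q' < states M" "length as = tapes M" "\<forall>a\<in>set as. fst a < symbols M"
    using assms(1) q cs qa unfolding wf_tm_def by (fastforce)+
  have st: "step M c = (q', map2 act_tape as ts)" using False by (simp add: c qa)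
  have lk: "lookup (fst m) (q, ?cs) = action_code (q', as)"
    using assms(2) q cs qa by (simp add: describes_def)
  have sst: "sim_step m d = (q', map (\<lambda>p. zact (fst p) (snd p))
      (zip (map (\<lambda>a. (fst a, move_num (snd a))) as) zs))"
    using False assms(2) lk by (simp add: sim_step_def d c read describes_def action_code_def)
  have "snd (act_tape a tp) i < symbols M" if "fst a < symbols M" "\<forall>i. snd tp i < symbols M" for a tp i
    using that by (cases a; cases tp) auto
  hence "snd (act_tape a tp) i < symbols M" if "(a, tp) \<in> set (zip as ts)" for a tp i
    using wf(3) assms(3) set_zip_leftD[OF that] set_zip_rightD[OF that]
    by (simp add: valid_config_def c)
  hence "\<forall>tp\<in>set (map2 act_tape as ts). \<forall>i. snd tp i < symbols M" by auto
  hence 1: "valid_config M (step M c)"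
    using wf len by (simp add: valid_config_def st)
  have "zrep (act_tape a tp) (zact (fst a, move_num (snd a)) z)" if "zrep tp z" for a tp z
    using zrep_act[OF that] by (cases a) simp
  hence "list_all2 zrep (map2 act_tape as ts) (snd (sim_step m d))"
    using zs wf len by (auto simp: list_all2_conv_all_nth sst)
  hence "sim_rel (step M c) (sim_step m d)" by (simp add: sim_rel_def st sst)
  with 1 show ?thesis ..
qed

lemma sim_Suc: "sim m xs (Suc t) = sim_step m (sim m xs t)"
  by (simp add: sim_def)

lemma sim_correct:
  assumes "wf_tm M" "describes m M (length xs)" "length xs \<le> tapes M"
  shows "sim_rel ((step M ^^ t) (start M, standard_tapes M xs)) (sim m xs t)"
proof -
  let ?c = "(start M, standard_tapes M xs)"
  have tape: "zrep (unary_tape n) ([], replicate n 1)" for n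
    by (auto simp: zrep_def unary_tape_def nth0_replicate)
  have "list_all2 zrep (standard_tapes M xs)
      (map (\<lambda>x. ([], replicate x 1)) xs @ replicate (tapes M - length xs) ([], []))"
    using assms(3) tape[of 0]
    by (auto simp: list_all2_conv_all_nth standard_tapes_def nth_append tape[simplified])
  hence init: "sim_rel ?c (sim m xs 0)"
    using assms(2) by (simp add: sim_rel_def sim_def describes_def)
  have valid: "valid_config M ?c"
    using assms(1) by (auto simp: valid_config_def standard_tapes_def unary_tape_def wf_tm_def)
  have "valid_config M ((step M ^^ t) ?c) \<and> sim_rel ((step M ^^ t) ?c) (sim m xs t)"
  proof (induction t)
    case (Suc t)
    show ?case
      using sim_step_correct[OF assms(1,2) conjunct1[OF Suc] conjunct2[OF Suc]]
      by (simp add: sim_Suc)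
  qed (use init valid in simp)
  thus ?thesis ..
qed

lemma sim_halted_stays:
  assumes "sim_halted m xs t" "t \<le> u"
  shows "sim m xs u = sim m xs t"
  using assms(2)
proof (induction u rule: dec_induct)
  case (step u)
  have "sim m xs (Suc u) = sim_step m (sim m xs u)" by (rule sim_Suc)
  also have "\<dots> = sim m xs t" using assms(1) step by (simp add: sim_step_def sim_halted_def)
  finally show ?case .
qed simp

text \<open>
A halted simulation does not change any more, so the output does not depend on the number of
steps at which it is inspected.
\<close>
lemma simulation:
  assumes "tm_computes M n f"
  obtains m where "\<And>xs. length xs = n \<Longrightarrow> \<exists>t. sim_halted m xs t"
    and "\<And>xs t. length xs = n \<Longrightarrow> sim_halted m xs t \<Longrightarrow> sim_output m xs t = f xs"
proof -
  have wf: "wf_tm M" and n: "n \<le> tapes M" using assms by (auto simp: tm_computes_def)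
  obtain m where m: "describes m M n" using describes_exists by blast
  have final: "\<exists>t. sim_halted m xs t \<and> sim_output m xs t = f xs" if xs: "length xs = n" for xs
  proof -
    obtain t where t: "(step M ^^ t) (start M, standard_tapes M xs) = (halt M, standard_tapes M [f xs])"
      using assms xs by (auto simp: tm_computes_def)
    have rel: "sim_rel (halt M, standard_tapes M [f xs]) (sim m xs t)"
      using sim_correct[of M m xs t] wf m n xs t by simp
    have "sim_halted m xs t" using rel m by (simp add: sim_rel_def sim_halted_def describes_def)
    moreover have "sim_output m xs t = f xs"
    proof -
      have "standard_tapes M [f xs] \<noteq> []" and
        hd: "hd (standard_tapes M [f xs]) = unary_tape (f xs)"
        using wf by (auto simp: wf_tm_def standard_tapes_def upt_rec)
      then obtain tp ts where std: "standard_tapes M [f xs] = tp # ts" "tp = unary_tape (f xs)"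
        by (cases "standard_tapes M [f xs]") auto
      then obtain z zs where z: "snd (sim m xs t) = z # zs" "zrep (unary_tape (f xs)) z"
        using rel by (auto simp: sim_rel_def list_all2_Cons1)
      have "sum_list (snd z) = f xs"
      proof (rule sum_list_unary)
        fix i
        show "nth0 (snd z) i = (if i < f xs then 1 else 0)"
          using z(2)[unfolded zrep_def, rule_format, of i] by (simp add: unary_tape_def)
      qed
      thus ?thesis by (simp add: sim_output_def z)
    qed
    ultimately show ?thesis by blast
  qed
  show ?thesis
  proof (rule that)
    fix xs :: "nat list" assume "length xs = n"
    thus "\<exists>t. sim_halted m xs t" using final by blast
  next
    fix xs t assume xs: "length xs = n" and h: "sim_halted m xs t"
    obtain u where u: "sim_halted m xs u" "sim_output m xs u = f xs" using final[OF xs] by blast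
    have "sim m xs (max t u) = sim m xs t" "sim m xs (max t u) = sim m xs u"
      by (rule sim_halted_stays[OF h], simp, rule sim_halted_stays[OF u(1)], simp)
    thus "sim_output m xs t = f xs" using u(2) by (simp add: sim_output_def)
  qed
qed

text \<open>
From a machine to a computable function: simulate its description, search for the first step at which it has
halted, and read the output.
\<close>
lemma recursive1_iff: "recursive1 f \<longleftrightarrow> computable f"
proof
  assume "computable f"
  then obtain g where "rec_fun g" "\<And>x. g (enc x) = enc (f x)" unfolding computable_def by blast
  moreover have "g = f" using calculation(2) by (auto simp: enc_nat_def)
  ultimately show "recursive1 f" by (simp add: recursive1_if_rec_fun)
next
  assume "recursive1 f"
  then obtain M where M: "tm_computes M 1 (\<lambda>xs. f (xs ! 0))" by (auto simp: recursive1_def)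
  from simulation[OF M] obtain m where
    m: "\<And>xs. length xs = 1 \<Longrightarrow> \<exists>t. sim_halted m xs t"
      "\<And>xs t. length xs = 1 \<Longrightarrow> sim_halted m xs t \<Longrightarrow> sim_output m xs t = f (xs ! 0)" by blast
  have ex: "\<exists>t. sim_halted m [x] t" for x by (rule m(1)) simp
  have "f = (\<lambda>x. sim_output m [x] (LEAST t. sim_halted m [x] t))"
    using m(2)[of "[_]", OF _ LeastI_ex[OF ex]] by simp
  moreover have "computable \<dots>"
    by (intro computable_intros computable_Least ex)
  ultimately show "computable f" by simp
qed

lemma computable_prod_decode [computable_intros]:
  "computable f \<Longrightarrow> computable (\<lambda>x. prod_decode (f x))"
  by (rule computable_compose[OF computable_I[OF rec_fun_id]]) (simp_all add: enc_prod_def enc_nat_def)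

lemma recursive2_iff: "recursive2 f \<longleftrightarrow> computable (\<lambda>p. f (fst p) (snd p))"
proof
  assume "computable (\<lambda>p. f (fst p) (snd p))"
  then obtain g where g: "rec_fun g" "\<And>p. g (enc p) = enc (f (fst p) (snd p))"
    unfolding computable_def by blast
  have "g z = f (pfst z) (psnd z)" for z
    using g(2)[of "prod_decode z"] by (simp add: enc_prod_def enc_nat_def)
  hence "g = (\<lambda>z. f (pfst z) (psnd z))" by auto
  thus "recursive2 f" using g(1) by (simp add: recursive2_if_rec_fun)
next
  assume "recursive2 f"
  then obtain M where M: "tm_computes M 2 (\<lambda>xs. f (xs ! 0) (xs ! 1))" by (auto simp: recursive2_def)
  from simulation[OF M] obtain m where
    m: "\<And>xs. length xs = 2 \<Longrightarrow> \<exists>t. sim_halted m xs t"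
      "\<And>xs t. length xs = 2 \<Longrightarrow> sim_halted m xs t \<Longrightarrow> sim_output m xs t = f (xs ! 0) (xs ! 1)"
    by blast
  have ex: "\<exists>t. sim_halted m [pfst z, psnd z] t" for z by (rule m(1)) simp
  let ?F = "\<lambda>z. sim_output m [pfst z, psnd z] (LEAST t. sim_halted m [pfst z, psnd z] t)"
  have F: "?F z = f (pfst z) (psnd z)" for z
    using m(2)[of "[pfst z, psnd z]", OF _ LeastI_ex[OF ex]] by simp
  have "(\<lambda>p. ?F (enc p)) = (\<lambda>p. f (fst p) (snd p))"
  proof
    fix p :: "nat \<times> nat"
    show "?F (enc p) = f (fst p) (snd p)" unfolding F by (simp add: enc_prod_def enc_nat_def)
  qed
  moreover have "computable ?F"
    by (intro computable_intros computable_Least ex)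
  hence "computable (\<lambda>p :: nat \<times> nat. ?F (enc p))"
    by (rule computable_compose) (intro computable_intros)
  ultimately show "computable (\<lambda>p. f (fst p) (snd p))" by (simp only:)
qed

text \<open>
The halting problem in the form that the machine with number \<open>n\<close> yields \<open>0\<close> on input \<open>n\<close>.  All codes
are codes of machine descriptions since the encodings of numbers, pairs and lists are
surjective.  A machine that decided the predicate and answered with \<open>1\<close> for true and \<open>0\<close> for false would
contradict its own answer on its own number.
\<close>
lemma exists_undecidable_ce_predicate:
  "\<exists>H :: nat \<Rightarrow> nat \<Rightarrow> bool. computable (\<lambda>p. H (fst p) (snd p)) \<and> \<not> computable (\<lambda>n. \<exists>t. H n t)"
proof -
  define dec where "dec = (inv enc :: nat \<Rightarrow> machine)"
  have surj: "surj (enc :: machine \<Rightarrow> nat)"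
    by (intro surj_enc_prod surj_enc_list surj_enc_nat)
  have dec: "computable dec"
    by (rule computable_I[OF rec_fun_id]) (simp add: dec_def enc_nat_def surj_f_inv_f[OF surj])
  have dec_enc: "dec (enc m) = m" for m by (simp add: dec_def inj_enc)
  define H where "H n t \<longleftrightarrow> sim_halted (dec n) [n] t \<and> sim_output (dec n) [n] t = 0" for n t
  have "computable (\<lambda>p. H (fst p) (snd p))"
    unfolding H_def by (intro computable_intros computable_compose[OF dec])
  moreover have "\<not> computable (\<lambda>n. \<exists>t. H n t)"
  proof
    assume *: "computable (\<lambda>n. \<exists>t. H n t)"
    let ?F = "\<lambda>n. if \<exists>t. H n t then 1 else (0::nat)"
    have "computable ?F" by (intro computable_intros *)
    then obtain M where M: "tm_computes M 1 (\<lambda>xs. ?F (xs ! 0))"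
      by (auto simp: recursive1_iff[symmetric] recursive1_def)
    from simulation[OF M] obtain m where
      m: "\<And>xs. length xs = 1 \<Longrightarrow> \<exists>t. sim_halted m xs t"
        "\<And>xs t. length xs = 1 \<Longrightarrow> sim_halted m xs t \<Longrightarrow> sim_output m xs t = ?F (xs ! 0)" by blast
    let ?n = "enc m"
    obtain t where t: "sim_halted m [?n] t" using m(1)[of "[?n]"] by auto
    have "sim_output m [?n] u = ?F ?n" if "sim_halted m [?n] u" for u
      using m(2)[of "[?n]" u] that by simp
    hence "(\<exists>t. H ?n t) \<longleftrightarrow> ?F ?n = 0"
      using t unfolding H_def dec_enc by metis
    thus False by (auto split: if_splits)
  qed
  ultimately show ?thesis by blast
qed

section \<open>Computable real functions on encoded types\<close>

text \<open>
Numerators are differences of natural numbers.  Then sums and products of fractions are polynomials in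
the components, and the positive part is given by truncated subtraction.
\<close>
definition computable_frac :: "('a::encodable \<Rightarrow> real) \<Rightarrow> bool" where
  "computable_frac Q \<longleftrightarrow> (\<exists>P N D. computable P \<and> computable N \<and> computable D \<and>
     (\<forall>x. D x \<noteq> 0 \<and> Q x = (real (P x) - real (N x)) / real (D x)))"

text \<open>
For the argument type \<open>nat\<close> these are the computable sequences of real numbers, and for constant
functions the computable real numbers; other argument types serve for sequences with parameters.
\<close>
definition computable_real_fun :: "('a::encodable \<Rightarrow> real) \<Rightarrow> bool" where
  "computable_real_fun X \<longleftrightarrow>
     (\<exists>Q. computable_frac Q \<and> (\<forall>x k. \<bar>X x - Q (x, k)\<bar> \<le> (1/2) ^ k))"

lemma computable_frac_I:
  assumes "computable P" "computable N" "computable D"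
    and "\<And>x. D x \<noteq> 0" "\<And>x. Q x = (real (P x) - real (N x)) / real (D x)"
  shows "computable_frac Q"
  using assms unfolding computable_frac_def by blast

lemma computable_frac_E:
  assumes "computable_frac Q"
  obtains P N D where "computable P" "computable N" "computable D"
    "\<And>x. D x \<noteq> 0" "\<And>x. Q x = (real (P x) - real (N x)) / real (D x)"
  using assms unfolding computable_frac_def by blast

lemma computable_frac_ratio:
  assumes "computable f" "computable g" "\<And>x. g x \<noteq> 0"
  shows "computable_frac (\<lambda>x. real (f x) / real (g x))"
  by (rule computable_frac_I[of f "\<lambda>x. 0" g]) (use assms in \<open>auto intro: computable_intros\<close>)

lemma computable_frac_of_nat: "computable f \<Longrightarrow> computable_frac (\<lambda>x. real (f x))"
  using computable_frac_ratio[of f "\<lambda>x. 1"] by (simp add: computable_const)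

lemma computable_frac_half_power: "computable f \<Longrightarrow> computable_frac (\<lambda>x. (1/2) ^ f x)"
  using computable_frac_ratio[of "\<lambda>x. 1" "\<lambda>x. 2 ^ f x"]
  by (simp add: computable_intros power_one_over)

lemma computable_frac_compose:
  assumes "computable_frac Q" "computable f"
  shows "computable_frac (\<lambda>x. Q (f x))"
proof -
  from assms(1) obtain P N D where "computable P" "computable N" "computable D"
    "\<And>x. D x \<noteq> 0" "\<And>x. Q x = (real (P x) - real (N x)) / real (D x)" by (rule computable_frac_E) blast
  thus ?thesis
    by (intro computable_frac_I[of "\<lambda>x. P (f x)" "\<lambda>x. N (f x)" "\<lambda>x. D (f x)"])
       (auto intro: computable_compose assms(2))
qed

lemma computable_frac_add:
  assumes "computable_frac Q" "computable_frac R"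
  shows "computable_frac (\<lambda>x. Q x + R x)"
proof -
  from assms(1) obtain P N D where 1: "computable P" "computable N" "computable D"
    "\<And>x. D x \<noteq> 0" "\<And>x. Q x = (real (P x) - real (N x)) / real (D x)" by (rule computable_frac_E) blast
  from assms(2) obtain P' N' D' where 2: "computable P'" "computable N'" "computable D'"
    "\<And>x. D' x \<noteq> 0" "\<And>x. R x = (real (P' x) - real (N' x)) / real (D' x)" by (rule computable_frac_E) blast
  have "Q x + R x = (real (P x * D' x + P' x * D x) - real (N x * D' x + N' x * D x)) /
      real (D x * D' x)" for x
    unfolding 1(5) 2(5) using 1(4)[of x] 2(4)[of x] by (simp add: field_simps)
  thus ?thesis using 1 2
    by (intro computable_frac_I[of "\<lambda>x. P x * D' x + P' x * D x" "\<lambda>x. N x * D' x + N' x * D x"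
          "\<lambda>x. D x * D' x"] computable_intros) auto
qed

lemma computable_frac_minus:
  assumes "computable_frac Q"
  shows "computable_frac (\<lambda>x. - Q x)"
proof -
  from assms obtain P N D where 1: "computable P" "computable N" "computable D"
    "\<And>x. D x \<noteq> 0" "\<And>x. Q x = (real (P x) - real (N x)) / real (D x)" by (rule computable_frac_E) blast
  show ?thesis
    by (rule computable_frac_I[of N P D]) (use 1 in \<open>auto simp: field_simps\<close>)
qed

lemma computable_frac_mult:
  assumes "computable_frac Q" "computable_frac R"
  shows "computable_frac (\<lambda>x. Q x * R x)"
proof -
  from assms(1) obtain P N D where 1: "computable P" "computable N" "computable D"
    "\<And>x. D x \<noteq> 0" "\<And>x. Q x = (real (P x) - real (N x)) / real (D x)" by (rule computable_frac_E) blast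
  from assms(2) obtain P' N' D' where 2: "computable P'" "computable N'" "computable D'"
    "\<And>x. D' x \<noteq> 0" "\<And>x. R x = (real (P' x) - real (N' x)) / real (D' x)" by (rule computable_frac_E) blast
  have "Q x * R x = (real (P x * P' x + N x * N' x) - real (P x * N' x + N x * P' x)) /
      real (D x * D' x)" for x
    unfolding 1(5) 2(5) using 1(4)[of x] 2(4)[of x] by (simp add: field_simps)
  thus ?thesis using 1 2
    by (intro computable_frac_I[of "\<lambda>x. P x * P' x + N x * N' x" "\<lambda>x. P x * N' x + N x * P' x"
          "\<lambda>x. D x * D' x"] computable_intros) auto
qed

lemma computable_frac_max_0:
  assumes "computable_frac Q"
  shows "computable_frac (\<lambda>x. max 0 (Q x))"
proof -
  from assms obtain P N D where 1: "computable P" "computable N" "computable D"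
    "\<And>x. D x \<noteq> 0" "\<And>x. Q x = (real (P x) - real (N x)) / real (D x)" by (rule computable_frac_E) blast
  have "max 0 (Q x) = (real (P x - N x) - real 0) / real (D x)" for x
    using 1(4)[of x] by (cases "N x \<le> P x") (auto simp: 1(5) max_def divide_simps of_nat_diff)
  thus ?thesis
    by (intro computable_frac_I[of "\<lambda>x. P x - N x" "\<lambda>x. 0" D])
       (use 1 in \<open>auto intro!: computable_intros\<close>)
qed

lemma computable_frac_If:
  assumes "computable c" "computable_frac Q" "computable_frac R"
  shows "computable_frac (\<lambda>x. if c x then Q x else R x)"
proof -
  from assms(2) obtain P N D where 1: "computable P" "computable N" "computable D"
    "\<And>x. D x \<noteq> 0" "\<And>x. Q x = (real (P x) - real (N x)) / real (D x)" by (rule computable_frac_E) blast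
  from assms(3) obtain P' N' D' where 2: "computable P'" "computable N'" "computable D'"
    "\<And>x. D' x \<noteq> 0" "\<And>x. R x = (real (P' x) - real (N' x)) / real (D' x)" by (rule computable_frac_E) blast
  show ?thesis
    by (rule computable_frac_I[of "\<lambda>x. if c x then P x else P' x" "\<lambda>x. if c x then N x else N' x"
          "\<lambda>x. if c x then D x else D' x"])
       (use 1 2 assms(1) in \<open>auto intro!: computable_intros\<close>)
qed

lemma computable_frac_sum:
  fixes T :: "'a::encodable \<Rightarrow> nat \<Rightarrow> real"
  assumes "computable_frac (\<lambda>p. T (fst p) (snd p))" "computable n"
  shows "computable_frac (\<lambda>x. \<Sum>i<n x. T x i)"
proof -
  from assms(1) obtain P N D where 1: "computable P" "computable N" "computable D"
    "\<And>p. D p \<noteq> 0" "\<And>p. T (fst p) (snd p) = (real (P p) - real (N p)) / real (D p)"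
    by (rule computable_frac_E) blast
  \<comment> \<open>The triple holds the numerators and the common denominator of a partial sum.\<close>
  define s where "s x i w = (fst w * D (x, i) + P (x, i) * snd (snd w),
      fst (snd w) * D (x, i) + N (x, i) * snd (snd w), snd (snd w) * D (x, i))"
    for x :: 'a and i :: nat and w :: "nat \<times> nat \<times> nat"
  define S where "S x = rec_nat (0, 0, 1) (s x)" for x
  have "computable (\<lambda>x. S x (n x))"
    unfolding S_def s_def
    by (intro computable_intros assms(2) computable_compose[OF 1(1)] computable_compose[OF 1(2)]
        computable_compose[OF 1(3)])
  moreover have S: "snd (snd (S x m)) \<noteq> 0 \<and> (\<Sum>i<m. T x i) =
      (real (fst (S x m)) - real (fst (snd (S x m)))) / real (snd (snd (S x m)))" for x m
  proof (induction m)
    case (Suc m)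
    obtain a b d where S: "S x m = (a, b, d)" by (metis prod_cases3)
    have S': "S x (Suc m) = s x m (a, b, d)" using S by (simp add: S_def)
    have d: "d \<noteq> 0" "D (x, m) \<noteq> 0" using Suc S 1(4) by auto
    have "(\<Sum>i<Suc m. T x i) =
        (real a - real b) / real d + (real (P (x, m)) - real (N (x, m))) / real (D (x, m))"
      using Suc S 1(5)[of "(x, m)"] by simp
    thus ?case using d by (simp add: S' s_def field_simps)
  qed (simp add: S_def)
  ultimately show ?thesis
    by (intro computable_frac_I[of "\<lambda>x. fst (S x (n x))" "\<lambda>x. fst (snd (S x (n x)))"
          "\<lambda>x. snd (snd (S x (n x)))"] computable_intros) auto
qed

lemma computable_real_fun_I:
  "computable_frac Q \<Longrightarrow> (\<And>x k. \<bar>X x - Q (x, k)\<bar> \<le> (1/2) ^ k) \<Longrightarrow> computable_real_fun X"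
  unfolding computable_real_fun_def by blast

lemma computable_real_fun_E:
  assumes "computable_real_fun X"
  obtains Q where "computable_frac Q" "\<And>x k. \<bar>X x - Q (x, k)\<bar> \<le> (1/2) ^ k"
  using assms unfolding computable_real_fun_def by blast

lemma computable_real_fun_frac:
  assumes "computable_frac Q"
  shows "computable_real_fun Q"
  by (rule computable_real_fun_I[OF computable_frac_compose[OF assms computable_fst[OF computable_id]]])
     simp

lemma computable_real_fun_compose:
  assumes "computable_real_fun X" "computable f"
  shows "computable_real_fun (\<lambda>x. X (f x))"
proof -
  from assms(1) obtain Q where Q: "computable_frac Q" "\<And>x k. \<bar>X x - Q (x, k)\<bar> \<le> (1/2) ^ k"
    by (rule computable_real_fun_E) blast
  have "computable_frac (\<lambda>p. Q (f (fst p), snd p))"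
    by (intro computable_frac_compose[OF Q(1)] computable_intros computable_compose[OF assms(2)])
  thus ?thesis by (rule computable_real_fun_I) (simp add: Q(2))
qed

lemma computable_real_fun_bound:
  assumes "computable_real_fun X"
  obtains c where "computable c" "\<And>x. \<bar>X x\<bar> \<le> real (c x)"
proof -
  from assms obtain Q where Q: "computable_frac Q" "\<And>x k. \<bar>X x - Q (x, k)\<bar> \<le> (1/2) ^ k"
    by (rule computable_real_fun_E) blast
  from Q(1) obtain P N D where 1: "computable P" "computable N" "computable D"
    "\<And>x. D x \<noteq> 0" "\<And>x. Q x = (real (P x) - real (N x)) / real (D x)" by (rule computable_frac_E) blast
  have Qb: "\<bar>Q p\<bar> \<le> real (P p) + real (N p)" for p
  proof -
    have "\<bar>Q p\<bar> = \<bar>real (P p) - real (N p)\<bar> / real (D p)" by (simp add: 1(5) abs_divide)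
    also have "\<dots> \<le> \<bar>real (P p) - real (N p)\<bar> / 1"
      using 1(4)[of p] by (intro divide_left_mono) auto
    finally show ?thesis by simp
  qed
  show ?thesis
  proof (rule that)
    show "computable (\<lambda>x. P (x, 0) + N (x, 0) + 1)"
      by (intro computable_intros computable_compose[OF 1(1)] computable_compose[OF 1(2)])
    show "\<bar>X x\<bar> \<le> real (P (x, 0) + N (x, 0) + 1)" for x
      using Q(2)[of x 0] Qb[of "(x, 0)"] by simp
  qed
qed

lemma computable_real_fun_add:
  assumes "computable_real_fun X" "computable_real_fun Y"
  shows "computable_real_fun (\<lambda>x. X x + Y x)"
proof -
  from assms(1) obtain Q where Q: "computable_frac Q" "\<And>x k. \<bar>X x - Q (x, k)\<bar> \<le> (1/2) ^ k"
    by (rule computable_real_fun_E) blast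
  from assms(2) obtain R where R: "computable_frac R" "\<And>x k. \<bar>Y x - R (x, k)\<bar> \<le> (1/2) ^ k"
    by (rule computable_real_fun_E) blast
  show ?thesis
  proof (rule computable_real_fun_I)
    show "computable_frac (\<lambda>p. Q (fst p, Suc (snd p)) + R (fst p, Suc (snd p)))"
      by (intro computable_frac_add computable_frac_compose[OF Q(1)] computable_frac_compose[OF R(1)]
          computable_intros)
    show "\<bar>X x + Y x - (Q (fst (x, k), Suc (snd (x, k))) + R (fst (x, k), Suc (snd (x, k))))\<bar>
        \<le> (1/2) ^ k" for x k
      using Q(2)[of x "Suc k"] R(2)[of x "Suc k"] unfolding fst_conv snd_conv power_Suc by linarith
  qed
qed

lemma computable_real_fun_minus:
  assumes "computable_real_fun X"
  shows "computable_real_fun (\<lambda>x. - X x)"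
proof -
  from assms obtain Q where Q: "computable_frac Q" "\<And>x k. \<bar>X x - Q (x, k)\<bar> \<le> (1/2) ^ k"
    by (rule computable_real_fun_E) blast
  have "\<bar>- X x - - Q (x, k)\<bar> \<le> (1/2) ^ k" for x k using Q(2)[of x k] by linarith
  with computable_frac_minus[OF Q(1)] show ?thesis by (rule computable_real_fun_I)
qed

lemma computable_real_fun_diff:
  "computable_real_fun X \<Longrightarrow> computable_real_fun Y \<Longrightarrow> computable_real_fun (\<lambda>x. X x - Y x)"
  using computable_real_fun_add[OF _ computable_real_fun_minus, of X Y] by simp

lemma computable_real_fun_max_0:
  assumes "computable_real_fun X"
  shows "computable_real_fun (\<lambda>x. max 0 (X x))"
proof -
  from assms obtain Q where Q: "computable_frac Q" "\<And>x k. \<bar>X x - Q (x, k)\<bar> \<le> (1/2) ^ k"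
    by (rule computable_real_fun_E) blast
  have "\<bar>max 0 (X x) - max 0 (Q (x, k))\<bar> \<le> (1/2) ^ k" for x k using Q(2)[of x k] by linarith
  with computable_frac_max_0[OF Q(1)] show ?thesis by (rule computable_real_fun_I)
qed

lemma nat_le_power2: "real n \<le> 2 ^ n"
  using less_exp[of n] by (metis less_imp_le of_nat_le_iff of_nat_numeral of_nat_power)

text \<open>
If \<open>c\<close> and \<open>d\<close> bound the factors, errors \<open>e \<le> 1\<close> of both give an error of at most
\<open>(c + d + 1) * e\<close> of the product; \<open>c + d + 1\<close> additional binary digits make up for this factor.
\<close>
lemma computable_real_fun_mult:
  assumes "computable_real_fun X" "computable_real_fun Y"
  shows "computable_real_fun (\<lambda>x. X x * Y x)"
proof -
  from assms(1) obtain Q where Q: "computable_frac Q" "\<And>x k. \<bar>X x - Q (x, k)\<bar> \<le> (1/2) ^ k"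
    by (rule computable_real_fun_E) blast
  from assms(2) obtain R where R: "computable_frac R" "\<And>x k. \<bar>Y x - R (x, k)\<bar> \<le> (1/2) ^ k"
    by (rule computable_real_fun_E) blast
  from assms(1) obtain c where c: "computable c" "\<And>x. \<bar>X x\<bar> \<le> real (c x)"
    by (rule computable_real_fun_bound) blast
  from assms(2) obtain d where d: "computable d" "\<And>x. \<bar>Y x\<bar> \<le> real (d x)"
    by (rule computable_real_fun_bound) blast
  define m where "m p = snd p + (c (fst p) + d (fst p) + 1)" for p :: "'a \<times> nat"
  have m: "computable m"
    unfolding m_def by (intro computable_intros computable_compose[OF c(1)] computable_compose[OF d(1)])
  show ?thesis
  proof (rule computable_real_fun_I)
    show "computable_frac (\<lambda>p. Q (fst p, m p) * R (fst p, m p))"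
      by (intro computable_frac_mult computable_frac_compose[OF Q(1)] computable_frac_compose[OF R(1)]
          computable_intros m)
    show "\<bar>X x * Y x - Q (fst (x, k), m (x, k)) * R (fst (x, k), m (x, k))\<bar> \<le> (1/2) ^ k" for x k
    proof -
      let ?C = "c x + d x + 1"
      define e :: real where "e = (1/2) ^ (k + ?C)"
      let ?q = "Q (x, k + ?C)" and ?r = "R (x, k + ?C)"
      have e: "0 \<le> e" "e \<le> 1" unfolding e_def by (simp, intro power_le_one) simp_all
      have q: "\<bar>X x - ?q\<bar> \<le> e" and r: "\<bar>Y x - ?r\<bar> \<le> e"
        using Q(2)[of x "k + ?C"] R(2)[of x "k + ?C"] by (simp_all add: e_def)
      have "\<bar>X x * Y x - ?q * ?r\<bar> = \<bar>X x * (Y x - ?r) + ?r * (X x - ?q)\<bar>"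
        by (simp add: algebra_simps)
      also have "\<dots> \<le> \<bar>X x\<bar> * \<bar>Y x - ?r\<bar> + \<bar>?r\<bar> * \<bar>X x - ?q\<bar>"
        by (metis abs_mult abs_triangle_ineq)
      also have "\<dots> \<le> real (c x) * e + (real (d x) + 1) * e"
        using c(2)[of x] d(2)[of x] q r e by (intro add_mono mult_mono) auto
      also have "\<dots> = real ?C * e" by (simp add: algebra_simps)
      also have "\<dots> \<le> 2 ^ ?C * e" using e(1) nat_le_power2 by (rule mult_right_mono[rotated])
      also have "\<dots> = (1/2) ^ k" by (simp add: e_def power_add power_one_over field_simps)
      finally show ?thesis by (simp add: m_def)
    qed
  qed
qed

text \<open>
Effective convergence: \<open>n = k + 1 + C x\<close> terms leave a tail of at most \<open>2 ^ -(k + 1)\<close>, and computing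
each of them with the error \<open>2 ^ -(k + 1 + n)\<close> costs another \<open>2 ^ -(k + 1)\<close>, as \<open>n \<le> 2 ^ n\<close>.
\<close>
lemma computable_real_fun_series:
  fixes T :: "'a::encodable \<Rightarrow> nat \<Rightarrow> real"
  assumes T: "computable_real_fun (\<lambda>p. T (fst p) (snd p))"
    and C: "computable C"
    and tail: "\<And>x n. \<bar>L x - (\<Sum>i<n. T x i)\<bar> \<le> real (C x) * (1/2) ^ n"
  shows "computable_real_fun L"
proof -
  from T obtain Q where Q: "computable_frac Q"
    "\<And>p k. \<bar>T (fst p) (snd p) - Q (p, k)\<bar> \<le> (1/2) ^ k"
    by (rule computable_real_fun_E) blast
  define n where "n p = snd p + 1 + C (fst p)" for p
  have n: "computable n" unfolding n_def by (intro computable_intros computable_compose[OF C])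
  show ?thesis
  proof (rule computable_real_fun_I)
    show "computable_frac (\<lambda>p. \<Sum>i<n p. Q ((fst p, i), snd p + 1 + n p))"
      by (intro computable_frac_sum computable_frac_compose[OF Q(1)] computable_intros n
          computable_compose[OF n])
    show "\<bar>L x - (\<Sum>i<n (x, k). Q ((fst (x, k), i), snd (x, k) + 1 + n (x, k)))\<bar> \<le> (1/2) ^ k" for x k
    proof -
      let ?n = "k + 1 + C x"
      have "\<bar>(\<Sum>i<?n. T x i) - (\<Sum>i<?n. Q ((x, i), k + 1 + ?n))\<bar> \<le>
          (\<Sum>i<?n. \<bar>T x i - Q ((x, i), k + 1 + ?n)\<bar>)"
        by (simp only: sum_subtractf[symmetric]) (rule sum_abs)
      also have "\<dots> \<le> (\<Sum>i<?n. (1/2) ^ (k + 1 + ?n))"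
        by (rule sum_mono) (use Q(2)[of "(x, _)"] in \<open>simp only: fst_conv snd_conv\<close>)
      also have "\<dots> = real ?n * (1/2) ^ ?n * (1/2) ^ (k + 1)" by (simp add: power_add)
      also have "\<dots> \<le> 1 * (1/2) ^ (k + 1)"
        using nat_le_power2[of ?n] by (intro mult_right_mono) (simp_all add: power_one_over field_simps)
      finally have 1: "\<bar>(\<Sum>i<?n. T x i) - (\<Sum>i<?n. Q ((x, i), k + 1 + ?n))\<bar> \<le> (1/2) ^ (k + 1)"
        by simp
      have "real (C x) * (1/2) ^ ?n = real (C x) * (1/2) ^ C x * (1/2) ^ (k + 1)"
        by (simp add: power_add)
      also have "\<dots> \<le> 1 * (1/2) ^ (k + 1)"
        using nat_le_power2[of "C x"] by (intro mult_right_mono) (simp_all add: power_one_over field_simps)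
      finally have "\<bar>L x - (\<Sum>i<?n. T x i)\<bar> \<le> (1/2) ^ (k + 1)" using tail[of x ?n] by linarith
      with 1 have "\<bar>L x - (\<Sum>i<?n. Q ((x, i), k + 1 + ?n))\<bar> \<le> (1/2) ^ (k + 1) + (1/2) ^ (k + 1)"
        by linarith
      thus ?thesis by (simp add: n_def)
    qed
  qed
qed

lemma computable_even: "computable f \<Longrightarrow> computable (\<lambda>x. even (f x :: nat))"
  unfolding even_iff_mod_2_eq_zero by (intro computable_intros)

lemma computable_frac_signed:
  assumes "computable s" "computable p" "computable q" "\<And>x. q x \<noteq> 0"
  shows "computable_frac (\<lambda>x. (-1) ^ s x * real (p x) / real (q x))"
proof -
  have "(-1) ^ s x * real (p x) / real (q x) =
      (real (if even (s x) then p x else 0) - real (if even (s x) then 0 else p x)) / real (q x)" for x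
    by auto
  thus ?thesis
    by (intro computable_frac_I[of "\<lambda>x. if even (s x) then p x else 0"
          "\<lambda>x. if even (s x) then 0 else p x" q] computable_intros computable_even assms)
qed

lemma signed_frac:
  fixes P N D :: nat
  shows "(-1) ^ (if P < N then 1 else 0) * of_nat ((P - N) + (N - P)) / of_nat D =
    ((of_nat P - of_nat N) / of_nat D :: 'a::field)"
  by (cases "P < N") (auto simp: of_nat_diff)

lemma computable_real_seq_iff: "computable_real_seq x \<longleftrightarrow> computable_real_fun x"
proof
  assume "computable_real_seq x"
  then obtain r s p q where
    rec: "recursive2 s" "recursive2 p" "recursive2 q" and
    r: "\<And>n k. q n k \<noteq> 0 \<and> r n k = (-1) ^ s n k * of_nat (p n k) / of_nat (q n k)" and
    x: "\<And>n k. \<bar>x n - of_rat (r n k)\<bar> < (1/2) ^ k"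
    unfolding computable_real_seq_def computable_rat_seq2_def by blast
  let ?Q = "\<lambda>w. (-1) ^ s (fst w) (snd w) * real (p (fst w) (snd w)) / real (q (fst w) (snd w))"
  have "computable_frac ?Q"
    using rec r by (intro computable_frac_signed) (auto simp: recursive2_iff)
  moreover have "of_rat (r n k) = ?Q (n, k)" for n k
    using r by (simp add: of_rat_mult of_rat_divide of_rat_power of_rat_minus)
  ultimately show "computable_real_fun x"
    by (intro computable_real_fun_I[of ?Q]) (use x in \<open>simp_all add: less_imp_le\<close>)
next
  assume "computable_real_fun x"
  then obtain Q where Q: "computable_frac Q" "\<And>n k. \<bar>x n - Q (n, k)\<bar> \<le> (1/2) ^ k"
    by (rule computable_real_fun_E) blast
  from Q(1) obtain P N D where 1: "computable P" "computable N" "computable D"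
    "\<And>x. D x \<noteq> 0" "\<And>x. Q x = (real (P x) - real (N x)) / real (D x)" by (rule computable_frac_E) blast
  define s where "s n k = (if P (n, Suc k) < N (n, Suc k) then 1 else 0 :: nat)" for n k
  define p where "p n k = (P (n, Suc k) - N (n, Suc k)) + (N (n, Suc k) - P (n, Suc k))" for n k
  define q where "q n k = D (n, Suc k)" for n k
  define r where "r n k = ((-1) ^ s n k * of_nat (p n k) / of_nat (q n k) :: rat)" for n k
  note cmp = computable_compose[OF 1(1)] computable_compose[OF 1(2)] computable_compose[OF 1(3)]
  have "recursive2 s" "recursive2 p" "recursive2 q"
    unfolding recursive2_iff s_def p_def q_def by (intro computable_intros cmp)+
  hence "computable_rat_seq2 r"
    unfolding computable_rat_seq2_def using 1(4)
    by (intro exI[of _ s] exI[of _ p] exI[of _ q]) (auto simp: r_def q_def)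
  moreover have "\<bar>x n - of_rat (r n k)\<bar> < (1/2) ^ k" for n k
  proof -
    have "of_rat (r n k) = Q (n, Suc k)"
      unfolding r_def s_def p_def q_def signed_frac 1(5)
      by (simp add: of_rat_divide of_rat_diff)
    hence "\<bar>x n - of_rat (r n k)\<bar> \<le> (1/2) ^ Suc k" using Q(2)[of n "Suc k"] by simp
    also have "\<dots> < (1/2) ^ k" by simp
    finally show ?thesis .
  qed
  ultimately show "computable_real_seq x" unfolding computable_real_seq_def by blast
qed

lemma computable_real_E:
  assumes "computable_real x"
  obtains Q :: "nat \<Rightarrow> real" where "computable_frac Q" "\<And>k. \<bar>x - Q k\<bar> \<le> (1/2) ^ k"
proof -
  obtain r s p q where
    rec: "recursive1 s" "recursive1 p" "recursive1 q" and
    r: "\<And>k. q k \<noteq> 0 \<and> r k = (-1) ^ s k * of_nat (p k) / of_nat (q k)" and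
    x: "\<And>k. \<bar>x - of_rat (r k)\<bar> \<le> (1/2) ^ k"
    using assms unfolding computable_real_def computable_rat_seq_def by blast
  have "computable_frac (\<lambda>k. (-1) ^ s k * real (p k) / real (q k))"
    using rec r by (intro computable_frac_signed) (auto simp: recursive1_iff)
  moreover have "of_rat (r k) = (-1) ^ s k * real (p k) / real (q k)" for k
    using r by (simp add: of_rat_mult of_rat_divide of_rat_power of_rat_minus)
  ultimately show ?thesis using x by (intro that) simp_all
qed

lemma computable_real_iff: "computable_real x \<longleftrightarrow> computable_real_fun (\<lambda>_::'a::encodable. x)"
proof
  assume "computable_real x"
  then obtain Q :: "nat \<Rightarrow> real" where Q: "computable_frac Q" "\<And>k. \<bar>x - Q k\<bar> \<le> (1/2) ^ k"
    by (rule computable_real_E) blast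
  have "computable_frac (\<lambda>p :: 'a \<times> nat. Q (snd p))"
    by (intro computable_frac_compose[OF Q(1)] computable_intros)
  thus "computable_real_fun (\<lambda>_::'a. x)" by (rule computable_real_fun_I) (simp add: Q(2))
next
  assume "computable_real_fun (\<lambda>_::'a. x)"
  then obtain Q where Q: "computable_frac Q" "\<And>(n::'a) k. \<bar>x - Q (n, k)\<bar> \<le> (1/2) ^ k"
    by (rule computable_real_fun_E) blast
  from Q(1) obtain P N D where 1: "computable P" "computable N" "computable D"
    "\<And>x. D x \<noteq> 0" "\<And>x. Q x = (real (P x) - real (N x)) / real (D x)" by (rule computable_frac_E) blast
  fix u :: 'a
  define s where "s k = (if P (u, k) < N (u, k) then 1 else 0 :: nat)" for k
  define p where "p k = (P (u, k) - N (u, k)) + (N (u, k) - P (u, k))" for k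
  define q where "q k = D (u, k)" for k
  define r where "r k = ((-1) ^ s k * of_nat (p k) / of_nat (q k) :: rat)" for k
  note cmp = computable_compose[OF 1(1)] computable_compose[OF 1(2)] computable_compose[OF 1(3)]
  have "recursive1 s" "recursive1 p" "recursive1 q"
    unfolding recursive1_iff s_def p_def q_def by (intro computable_intros cmp)+
  hence "computable_rat_seq r"
    unfolding computable_rat_seq_def using 1(4)
    by (intro exI[of _ s] exI[of _ p] exI[of _ q]) (auto simp: r_def q_def)
  moreover have "\<bar>x - of_rat (r k)\<bar> \<le> (1/2) ^ k" for k
  proof -
    have "of_rat (r k) = Q (u, k)"
      unfolding r_def s_def p_def q_def signed_frac 1(5)
      by (simp add: of_rat_divide of_rat_diff)
    thus ?thesis using Q(2)[of u k] by simp
  qed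
  ultimately show "computable_real x" unfolding computable_real_def by blast
qed

section \<open>A noncomputable supremum of a computable sequence\<close>

lemma computable_bex_less [computable_intros]:
  assumes "computable (\<lambda>p. P (fst p) (snd p))" "computable n"
  shows "computable (\<lambda>x. \<exists>t<n x. P x (t::nat))"
proof -
  have "rec_nat False (\<lambda>t b. if b then True else P x t) m \<longleftrightarrow> (\<exists>t<m. P x t)" for x m
    by (induction m) (auto simp: less_Suc_eq)
  moreover have "computable (\<lambda>x. rec_nat False (\<lambda>t b. if b then True else P x t) (n x))"
    by (intro computable_intros assms computable_app2[OF assms(1)])
  ultimately show ?thesis by simp
qed

text \<open>
The interval of length 3 does not reach from a last digit \<open>0\<close> to a last digit \<open>4\<close>, nor from \<open>4\<close> to
the next \<open>0\<close>.
\<close>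
lemma mod_8_digit:
  assumes "8 * real M + 4 * real d \<le> y" "y < 8 * real M + 4 * real d + 3" "d < 2"
    and "real z \<le> y" "y < real z + 1"
  shows "4 \<le> z mod 8 \<longleftrightarrow> d = 1"
proof -
  have "real (8 * M + 4 * d) < real (z + 1)" "real z < real (8 * M + 4 * d + 3)"
    using assms by simp_all
  hence "8 * M + 4 * d \<le> z" "z < 8 * M + 4 * d + 3" by (simp_all only: of_nat_less_iff)
  then obtain i where z: "z = 8 * M + (4 * d + i)" and i: "i < 3"
    by (metis le_iff_add nat_add_left_cancel_less add.assoc)
  have "4 * d + i < 8" using i assms(3) by simp
  hence "z mod 8 = 4 * d + i" by (simp add: z)
  thus ?thesis using i assms(3) by auto
qed

lemma summable_eighths: "summable (\<lambda>e. (1/8::real) ^ e)"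
  by (rule summable_geometric) simp

text \<open>
The contribution of digit \<open>e\<close> to the number whose base 8 digits, after \<open>j\<close> leading zeros, are \<open>4\<close> at
the elements of \<open>A\<close> and \<open>0\<close> elsewhere.
\<close>
definition octal :: "nat \<Rightarrow> (nat \<Rightarrow> bool) \<Rightarrow> nat \<Rightarrow> real" where
  "octal j A e = (if A e then 4 * (1/8) ^ (e + j + 1) else 0)"

lemma octal_le: "octal j A e \<le> 4 * (1/8) ^ (j + 1) * (1/8) ^ e"
  by (simp add: octal_def power_add)

lemma octal_nonneg: "0 \<le> octal j A e"
  by (simp add: octal_def)

lemma summable_octal: "summable (octal j A)"
  by (rule summable_comparison_test'[where N = 0, OF summable_mult[OF summable_eighths,
        of "4 * (1/8) ^ (j + 1)"]])
     (use octal_le octal_nonneg in \<open>simp add: octal_def power_add\<close>)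

lemma suminf_octal_less: "suminf (octal j A) < (1/8) ^ j"
proof -
  have "suminf (octal j A) \<le> (\<Sum>e. 4 * (1/8) ^ (j + 1) * (1/8::real) ^ e)"
    by (rule suminf_le[OF octal_le summable_octal summable_mult[OF summable_eighths]])
  also have "\<dots> = 4 * (1/8) ^ (j + 1) * (\<Sum>e. (1/8::real) ^ e)"
    by (rule suminf_mult[OF summable_eighths])
  also have "(\<Sum>e. (1/8::real) ^ e) = 8 / 7" by (subst suminf_geometric) auto
  finally show ?thesis by (simp add: field_simps)
qed

text \<open>
When the point is shifted behind digit \<open>e\<close>, the previous digits form a multiple of 8 and the
following ones a number below 1.
\<close>
lemma octal_digit:
  "\<exists>M. 8 * real M + 4 * of_bool (A e) \<le> 8 ^ (e + j + 1) * suminf (octal j A) \<and>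
     8 ^ (e + j + 1) * suminf (octal j A) < 8 * real M + 4 * of_bool (A e) + 1"
proof -
  let ?S = "8 ^ (e + j + 1) :: real"
  have split: "suminf (octal j A) = (\<Sum>i. octal j A (i + Suc e)) + (\<Sum>i<Suc e. octal j A i)"
    by (rule suminf_split_initial_segment[OF summable_octal])
  have shift: "octal j A (i + Suc e) = octal (j + Suc e) (\<lambda>i. A (i + Suc e)) i" for i
    by (simp add: octal_def add.assoc add.left_commute add.commute)
  have "(\<Sum>i. octal j A (i + Suc e)) < (1/8) ^ (j + Suc e)"
    unfolding shift using suminf_octal_less[of "j + Suc e" "\<lambda>i. A (i + Suc e)"] by simp
  hence "?S * (\<Sum>i. octal j A (i + Suc e)) < ?S * (1/8) ^ (j + Suc e)" by simp
  also have "\<dots> = 1" by (simp add: power_one_over add.commute)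
  finally have tail: "?S * (\<Sum>i. octal j A (i + Suc e)) < 1" .
  have tail0: "0 \<le> ?S * (\<Sum>i. octal j A (i + Suc e))"
    using summable_octal[of j A]
    by (intro mult_nonneg_nonneg suminf_nonneg) (auto simp: octal_nonneg summable_iff_shift simp del: add_Suc_right)
  define M where "M = (\<Sum>i<e. if A i then 4 * 8 ^ (e - Suc i) else 0 :: nat)"
  have digit: "?S * octal j A i = 8 * real (if A i then 4 * 8 ^ (e - Suc i) else 0)" if "i < e" for i
  proof -
    have "e + j + 1 = (i + j + 1) + Suc (e - Suc i)" using that by simp
    hence "?S = 8 ^ (i + j + 1) * 8 ^ Suc (e - Suc i)" by (metis power_add)
    thus ?thesis by (simp add: octal_def power_one_over)
  qed
  have "?S * (\<Sum>i<e. octal j A i) = 8 * real M"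
    unfolding M_def of_nat_sum sum_distrib_left by (rule sum.cong[OF refl], rule digit) simp
  moreover have "?S * octal j A e = 4 * of_bool (A e)" by (simp add: octal_def power_one_over)
  ultimately have "?S * suminf (octal j A) =
      ?S * (\<Sum>i. octal j A (i + Suc e)) + 8 * real M + 4 * of_bool (A e)"
    unfolding split by (simp add: algebra_simps)
  with tail tail0 show ?thesis by (intro exI[of _ M]) linarith
qed

text \<open>
Multiply an approximation with error at most \<open>8 ^ -(e + j + 1)\<close> by \<open>8 ^ (e + j + 1)\<close>, and add 1 to make it
an upper estimate.  The result exceeds a number with last digit \<open>0\<close> or \<open>4\<close> by less than 3, and its
integer part can be computed.
\<close>
lemma computable_if_octal_computable:
  assumes "computable_real (suminf (octal j A))"
  shows "computable A"
proof -
  let ?l = "suminf (octal j A)"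
  obtain Q :: "nat \<Rightarrow> real" where Q: "computable_frac Q" "\<And>k. \<bar>?l - Q k\<bar> \<le> (1/2) ^ k"
    using computable_real_E[OF assms] by blast
  from Q(1) obtain P N D where 1: "computable P" "computable N" "computable D"
    "\<And>x. D x \<noteq> 0" "\<And>x. Q x = (real (P x) - real (N x)) / real (D x)"
    by (rule computable_frac_E) blast
  define k where "k e = 3 * (e + j + 1)" for e :: nat
  have k: "computable k" unfolding k_def by (intro computable_intros)
  define z where "z e = (8 ^ (e + j + 1) * P (k e) + D (k e) - 8 ^ (e + j + 1) * N (k e)) div D (k e)" for e
  note cmp = computable_compose[OF 1(1) k] computable_compose[OF 1(2) k] computable_compose[OF 1(3) k]
  have "computable (\<lambda>e. 4 \<le> z e mod 8)" unfolding z_def by (intro computable_intros cmp)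
  moreover have "4 \<le> z e mod 8 \<longleftrightarrow> A e" for e
  proof -
    let ?S = "8 ^ (e + j + 1)"
    obtain M where M: "8 * real M + 4 * of_bool (A e) \<le> real ?S * ?l"
      "real ?S * ?l < 8 * real M + 4 * of_bool (A e) + 1"
      using octal_digit[of A e j] by auto
    define y where "y = real ?S * Q (k e) + 1"
    have "real ?S * \<bar>?l - Q (k e)\<bar> \<le> real ?S * (1/2) ^ k e"
      using Q(2)[of "k e"] by (intro mult_left_mono) auto
    also have "(1/2::real) ^ k e = (1/8) ^ (e + j + 1)"
      unfolding k_def power_mult by (simp add: power_one_over)
    also have "real ?S * (1/8) ^ (e + j + 1) = 1" by (simp add: power_one_over)
    finally have "\<bar>real ?S * ?l - real ?S * Q (k e)\<bar> \<le> 1"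
      by (simp only: right_diff_distrib[symmetric] abs_mult abs_of_nat)
    hence y: "8 * real M + 4 * of_bool (A e) \<le> y" "y < 8 * real M + 4 * of_bool (A e) + 3"
      using M unfolding y_def by linarith+
    have D: "0 < real (D (k e))" using 1(4)[of "k e"] by simp
    have yD: "y * real (D (k e)) = real (?S * P (k e) + D (k e)) - real (?S * N (k e))"
      using D by (simp add: y_def 1(5) field_simps)
    have "0 \<le> 8 * real M + 4 * of_bool (A e)" by simp
    with y(1) have "0 \<le> y" by linarith
    hence "0 \<le> y * real (D (k e))" by simp
    hence le: "?S * N (k e) \<le> ?S * P (k e) + D (k e)"
      unfolding yD by (simp only: diff_ge_0_iff_ge of_nat_le_iff)
    let ?n = "?S * P (k e) + D (k e) - ?S * N (k e)"
    have n: "y * real (D (k e)) = real ?n" unfolding yD using le by (simp only: of_nat_diff)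
    have ze: "z e = ?n div D (k e)" by (simp only: z_def)
    have "z e * D (k e) \<le> ?n" "?n < (z e + 1) * D (k e)"
      unfolding ze using 1(4)[of "k e"] dividend_less_div_times[of "D (k e)" ?n] by simp_all
    hence "real (z e * D (k e)) \<le> real ?n" "real ?n < real ((z e + 1) * D (k e))"
      by (simp_all only: of_nat_le_iff of_nat_less_iff)
    hence "real (z e) * real (D (k e)) \<le> y * real (D (k e))"
      "y * real (D (k e)) < (real (z e) + 1) * real (D (k e))"
      unfolding n by (simp_all only: of_nat_mult of_nat_add of_nat_1)
    hence "real (z e) \<le> y" "y < real (z e) + 1" using D by (simp_all only: mult_le_cancel_right_pos mult_less_cancel_right_pos)
    with y show ?thesis using mod_8_digit[of M "of_bool (A e)" y "z e"] by simp
  qed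
  ultimately show ?thesis by simp
qed

locale lower_approximation =
  fixes q :: "nat \<Rightarrow> real" and l :: real
  assumes q_nonneg: "\<And>n. 0 \<le> q n" and q_le: "\<And>n. q n \<le> l" and q_exceeds: "\<And>x. x < l \<Longrightarrow> \<exists>n. x < q n"

text \<open>
In stage \<open>n\<close> only the first \<open>n\<close> digits are considered, and digit \<open>e\<close> is set to \<open>4\<close> if membership of \<open>e\<close> is
witnessed by some \<open>t < n\<close>.  Leading zeros make the limit smaller than \<open>a\<close>.
\<close>
lemma noncomputable_limit:
  fixes a :: real
  assumes "0 < a"
  obtains q :: "nat \<Rightarrow> real" and l where "lower_approximation q l" "computable_frac q" "\<not> computable_real l" "0 < l" "l < a"
proof -
  obtain H :: "nat \<Rightarrow> nat \<Rightarrow> bool" where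
    H: "computable (\<lambda>p. H (fst p) (snd p))" "\<not> computable (\<lambda>n. \<exists>t. H n t)"
    using exists_undecidable_ce_predicate by blast
  obtain j where j: "(1/8) ^ j < a" using real_arch_pow_inv[OF assms, of "1/8"] by auto
  let ?A = "\<lambda>e. \<exists>t. H e t"
  define l where "l = suminf (octal j ?A)"
  define q where "q n = (\<Sum>e<n. octal j (\<lambda>e. \<exists>t<n. H e t) e)" for n
  have less: "octal j (\<lambda>e. \<exists>t<n. H e t) e \<le> octal j ?A e" for n e
    by (auto simp: octal_def)
  show ?thesis
  proof (rule that)
    have "computable_frac (\<lambda>n. \<Sum>e<n. if \<exists>t<n. H e t then real 4 / real (8 ^ (e + j + 1)) else real 0)"
      by (intro computable_frac_sum computable_frac_If computable_frac_ratio computable_frac_of_nat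
          computable_intros computable_app2[OF H(1)]) simp_all
    thus "computable_frac q" by (simp add: q_def [abs_def] octal_def power_one_over cong: if_cong)
    show "\<not> computable_real l" using computable_if_octal_computable H(2) unfolding l_def by blast
    show "l < a" using suminf_octal_less[of j ?A] j by (simp add: l_def)
    have "\<exists>e. ?A e"
    proof (rule ccontr)
      assume "\<nexists>e. ?A e"
      hence "?A = (\<lambda>_. False)" by auto
      thus False using H(2) by (simp add: computable_const)
    qed
    then obtain e where e: "?A e" by blast
    have "0 < octal j ?A e" using e by (simp add: octal_def)
    thus "0 < l" unfolding l_def by (rule suminf_pos2[OF summable_octal octal_nonneg])
    show "lower_approximation q l"
    proof
      show "0 \<le> q n" for n by (simp add: q_def sum_nonneg octal_nonneg)
      show "q n \<le> l" for n
      proof -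
        have "q n \<le> (\<Sum>e<n. octal j ?A e)" unfolding q_def by (rule sum_mono[OF less])
        also have "\<dots> \<le> l" unfolding l_def
          by (rule sum_le_suminf[OF summable_octal]) (auto simp: octal_nonneg)
        finally show ?thesis .
      qed
      show "\<exists>n. x < q n" if below: "x < l" for x
      proof -
        have lim: "(\<lambda>n. \<Sum>e<n. octal j ?A e) \<longlonglongrightarrow> l"
          unfolding l_def by (rule summable_LIMSEQ[OF summable_octal])
        obtain N where N: "x < (\<Sum>e<N. octal j ?A e)"
          using order_tendstoD(1)[OF lim below] by (auto simp: eventually_sequentially)
        have "\<exists>n\<ge>N. \<forall>e<m. ?A e \<longrightarrow> (\<exists>t<n. H e t)" for m
        proof (induction m)
          case (Suc m)
          then obtain n where n: "n \<ge> N" "\<forall>e<m. ?A e \<longrightarrow> (\<exists>t<n. H e t)" by blast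
          obtain t where "?A m \<longrightarrow> H m t" by blast
          hence "\<forall>e<Suc m. ?A e \<longrightarrow> (\<exists>t'<max n (Suc t). H e t')"
            using n(2) by (metis less_Suc_eq less_max_iff_disj)
          thus ?case using n(1) by (intro exI[of _ "max n (Suc t)"]) auto
        qed auto
        then obtain n where n: "n \<ge> N" "\<forall>e<N. ?A e \<longrightarrow> (\<exists>t<n. H e t)" by blast
        have "(\<Sum>e<N. octal j ?A e) \<le> (\<Sum>e<N. octal j (\<lambda>e. \<exists>t<n. H e t) e)"
          using n(2) by (intro sum_mono) (auto simp: octal_def)
        also have "\<dots> \<le> q n" unfolding q_def using n(1)
          by (intro sum_mono2) (auto simp: octal_nonneg)
        finally show ?thesis using N by (intro exI[of _ n]) linarith
      qed
    qed
  qed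
qed

section \<open>A smooth convex function with a half-line of zeros\<close>

definition ramp_term :: "(nat \<Rightarrow> real) \<Rightarrow> real \<Rightarrow> nat \<Rightarrow> real" where
  "ramp_term q x n = (1/2) ^ n * (max 0 (q n - x))\<^sup>2"

definition ramps :: "(nat \<Rightarrow> real) \<Rightarrow> real \<Rightarrow> real" where
  "ramps q x = (\<Sum>n. ramp_term q x n)"

definition ramps_deriv :: "(nat \<Rightarrow> real) \<Rightarrow> real \<Rightarrow> real" where
  "ramps_deriv q x = (\<Sum>n. (1/2) ^ n * (- 2 * max 0 (q n - x)))"

text \<open>
All estimates for \<open>ramps\<close> and its derivative reduce to estimates for the single terms by this lemma.
\<close>
lemma summable_weighted:
  fixes c :: "nat \<Rightarrow> real"
  assumes "\<And>n. \<bar>c n\<bar> \<le> B"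
  shows "summable (\<lambda>n. (1/2) ^ n * c n)" and "\<bar>\<Sum>n. (1/2) ^ n * c n\<bar> \<le> 2 * B"
    and "\<bar>(\<Sum>n. (1/2) ^ n * c n) - (\<Sum>n<m. (1/2) ^ n * c n)\<bar> \<le> 2 * B * (1/2) ^ m"
proof -
  have tail: "summable (\<lambda>n. (1/2) ^ n * c n) \<and> \<bar>\<Sum>n. (1/2) ^ n * c n\<bar> \<le> 2 * B"
    if c: "\<And>n. \<bar>c n\<bar> \<le> B" for c :: "nat \<Rightarrow> real"
  proof -
    have geo: "(\<lambda>n. (1/2) ^ n * B) sums (2 * B)"
      using sums_mult2[OF geometric_sums[of "1/2::real"], of B] by simp
    have le: "norm ((1/2) ^ n * c n) \<le> (1/2) ^ n * B" for n
      using c[of n] by (simp add: abs_mult)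
    have norm: "summable (\<lambda>n. norm ((1/2) ^ n * c n))"
      by (rule summable_comparison_test'[OF sums_summable[OF geo], of 0]) (use le in simp)
    have "norm (\<Sum>n. (1/2) ^ n * c n) \<le> (\<Sum>n. norm ((1/2) ^ n * c n))"
      by (rule summable_norm[OF norm])
    also have "\<dots> \<le> (\<Sum>n. (1/2) ^ n * B)" by (rule suminf_le[OF le norm sums_summable[OF geo]])
    also have "\<dots> = 2 * B" using sums_unique[OF geo] by simp
    finally show ?thesis using summable_norm_cancel[OF norm] by simp
  qed
  show "summable (\<lambda>n. (1/2) ^ n * c n)" "\<bar>\<Sum>n. (1/2) ^ n * c n\<bar> \<le> 2 * B"
    using tail[of c] assms by blast+
  have "(\<Sum>n. (1/2) ^ n * c n) - (\<Sum>n<m. (1/2) ^ n * c n) = (\<Sum>n. (1/2) ^ (n + m) * c (n + m))"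
    using suminf_split_initial_segment[OF \<open>summable (\<lambda>n. (1/2) ^ n * c n)\<close>, of m] by simp
  also have "\<dots> = (\<Sum>n. (1/2) ^ m * ((1/2) ^ n * c (n + m)))"
    by (simp add: power_add mult.assoc mult.left_commute)
  also have "\<dots> = (1/2) ^ m * (\<Sum>n. (1/2) ^ n * c (n + m))"
    by (rule suminf_mult) (use tail[of "\<lambda>n. c (n + m)"] assms in blast)
  finally show "\<bar>(\<Sum>n. (1/2) ^ n * c n) - (\<Sum>n<m. (1/2) ^ n * c n)\<bar> \<le> 2 * B * (1/2) ^ m"
    using tail[of "\<lambda>n. c (n + m)"] assms by (simp add: abs_mult mult.commute)
qed

text \<open>
The constant in this estimate does not depend on \<open>u\<close>, so it can be summed over all terms.
\<close>
lemma square_ramp_taylor: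
  fixes u h :: real
  shows "\<bar>(max 0 (u - h))\<^sup>2 - (max 0 u)\<^sup>2 + 2 * max 0 u * h\<bar> \<le> h\<^sup>2"
proof (cases "0 \<le> u"; cases "0 \<le> u - h")
  assume "0 \<le> u" "0 \<le> u - h"
  thus ?thesis by (simp add: power2_eq_square algebra_simps)
next
  assume "0 \<le> u" "\<not> 0 \<le> u - h"
  hence "(max 0 (u - h))\<^sup>2 - (max 0 u)\<^sup>2 + 2 * max 0 u * h = 2 * (u * h) - u * u"
    by (simp add: power2_eq_square)
  moreover have "u * u \<le> u * h" "0 \<le> u * h"
    using \<open>0 \<le> u\<close> \<open>\<not> 0 \<le> u - h\<close> by (intro mult_left_mono mult_nonneg_nonneg; simp)+
  moreover have "0 \<le> (h - u) * (h - u)" by simp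
  hence "0 \<le> h * h - 2 * (u * h) + u * u" by (simp only: algebra_simps)
  ultimately show ?thesis unfolding power2_eq_square[of h] by linarith
next
  assume "\<not> 0 \<le> u" "0 \<le> u - h"
  hence "(u - h)\<^sup>2 \<le> (- h)\<^sup>2" by (intro power_mono) auto
  with \<open>\<not> 0 \<le> u\<close> \<open>0 \<le> u - h\<close> show ?thesis by simp
qed simp

lemma square_ramp_convex:
  fixes u v t :: real
  assumes "0 \<le> t" "t \<le> 1"
  shows "(max 0 ((1 - t) * u + t * v))\<^sup>2 \<le> (1 - t) * (max 0 u)\<^sup>2 + t * (max 0 v)\<^sup>2"
proof -
  let ?U = "max 0 u" and ?V = "max 0 v"
  have "(1 - t) * u + t * v \<le> (1 - t) * ?U + t * ?V"
    using assms by (intro add_mono mult_left_mono) auto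
  moreover have "0 \<le> (1 - t) * ?U + t * ?V" using assms by simp
  ultimately have "(max 0 ((1 - t) * u + t * v))\<^sup>2 \<le> ((1 - t) * ?U + t * ?V)\<^sup>2"
    by (intro power_mono) auto
  also have "\<dots> = (1 - t) * ?U\<^sup>2 + t * ?V\<^sup>2 - t * (1 - t) * (?U - ?V)\<^sup>2"
    by (simp add: power2_eq_square algebra_simps)
  also have "\<dots> \<le> (1 - t) * ?U\<^sup>2 + t * ?V\<^sup>2" using assms by simp
  finally show ?thesis .
qed

context lower_approximation
begin

lemma ramp_bound: "max 0 (q n - x) \<le> l + \<bar>x\<bar>"
  using q_nonneg[of n] q_le[of n] by linarith

lemma ramp_square_bound: "\<bar>(max 0 (q n - x))\<^sup>2\<bar> \<le> (l + \<bar>x\<bar>)\<^sup>2"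
  using ramp_bound by (simp add: power_mono)

lemma summable_ramp_term: "summable (ramp_term q x)"
  unfolding ramp_term_def by (rule summable_weighted(1)[OF ramp_square_bound])

lemma ramps_nonneg: "0 \<le> ramps q x"
  unfolding ramps_def by (rule suminf_nonneg[OF summable_ramp_term]) (simp add: ramp_term_def)

lemma ramps_eq_0_iff: "ramps q x = 0 \<longleftrightarrow> l \<le> x"
proof -
  have "ramps q x = 0 \<longleftrightarrow> (\<forall>n. ramp_term q x n = 0)"
    unfolding ramps_def by (rule suminf_eq_zero_iff[OF summable_ramp_term]) (simp add: ramp_term_def)
  also have "max 0 (q n - x) = 0 \<longleftrightarrow> q n \<le> x" for n by linarith
  hence "(\<forall>n. ramp_term q x n = 0) \<longleftrightarrow> (\<forall>n. q n \<le> x)" by (simp add: ramp_term_def)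
  also have "\<dots> \<longleftrightarrow> l \<le> x" using q_exceeds q_le by (meson not_less order_trans)
  finally show ?thesis .
qed

lemma summable_ramps_deriv: "summable (\<lambda>n. (1/2) ^ n * (- 2 * max 0 (q n - x)))"
proof (rule summable_weighted(1))
  show "\<bar>- 2 * max 0 (q n - x)\<bar> \<le> 2 * (l + \<bar>x\<bar>)" for n
    using mult_left_mono[OF ramp_bound[of n x], of 2]
    by (simp only: abs_mult abs_minus_cancel abs_numeral abs_of_nonneg max.cobounded1)
qed

lemma ramps_taylor: "\<bar>ramps q (x + h) - ramps q x - ramps_deriv q x * h\<bar> \<le> 2 * h\<^sup>2"
proof -
  note d = summable_ramps_deriv
  have "ramps q (x + h) - ramps q x - ramps_deriv q x * h =
      (\<Sum>n. ramp_term q (x + h) n - ramp_term q x n - (1/2) ^ n * (- 2 * max 0 (q n - x)) * h)"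
    unfolding ramps_def ramps_deriv_def
    by (simp only: suminf_mult2[OF d] suminf_diff[OF summable_ramp_term summable_ramp_term]
        suminf_diff[OF summable_diff[OF summable_ramp_term summable_ramp_term] summable_mult2[OF d]])
  also have "\<dots> = (\<Sum>n. (1/2) ^ n * ((max 0 (q n - x - h))\<^sup>2 - (max 0 (q n - x))\<^sup>2 + 2 * max 0 (q n - x) * h))"
    by (intro suminf_cong) (simp add: ramp_term_def algebra_simps)
  also have "\<bar>\<dots>\<bar> \<le> 2 * h\<^sup>2" by (rule summable_weighted(2)[OF square_ramp_taylor])
  finally show ?thesis .
qed

text \<open>
The Taylor estimate gives the derivative directly, without interchanging limits.
\<close>
lemma ramps_has_derivative: "(ramps q has_field_derivative ramps_deriv q x) (at x)"
proof -
  have "((\<lambda>h. (ramps q (x + h) - ramps q x) / h - ramps_deriv q x) \<longlongrightarrow> 0) (at 0)"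
  proof (rule Lim_null_comparison)
    show "\<forall>\<^sub>F h in at 0. norm ((ramps q (x + h) - ramps q x) / h - ramps_deriv q x) \<le> 2 * \<bar>h\<bar>"
    proof (rule eventually_at_filter[THEN iffD2], intro always_eventually allI impI)
      fix h :: real assume h: "h \<noteq> 0"
      have "(ramps q (x + h) - ramps q x) / h - ramps_deriv q x =
          (ramps q (x + h) - ramps q x - ramps_deriv q x * h) / h"
        using h by (simp add: field_simps)
      hence "norm ((ramps q (x + h) - ramps q x) / h - ramps_deriv q x) \<le> 2 * h\<^sup>2 / \<bar>h\<bar>"
        using ramps_taylor[of x h] h by (simp add: abs_divide divide_right_mono)
      also have "\<dots> = 2 * \<bar>h\<bar>" using h by (simp add: power2_eq_square field_simps abs_mult_self_eq)
      finally show "norm ((ramps q (x + h) - ramps q x) / h - ramps_deriv q x) \<le> 2 * \<bar>h\<bar>" .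
    qed
    show "((\<lambda>h. 2 * \<bar>h\<bar>) \<longlongrightarrow> (0::real)) (at 0)" by (auto intro!: tendsto_eq_intros)
  qed
  thus ?thesis unfolding DERIV_def using LIM_zero_iff by blast
qed

lemma ramps_deriv_lipschitz: "\<bar>ramps_deriv q x - ramps_deriv q y\<bar> \<le> 4 * \<bar>x - y\<bar>"
proof -
  note d = summable_ramps_deriv
  have "ramps_deriv q x - ramps_deriv q y =
      (\<Sum>n. (1/2) ^ n * (2 * max 0 (q n - y) - 2 * max 0 (q n - x)))"
    unfolding ramps_deriv_def suminf_diff[OF d d] by (simp add: algebra_simps)
  also have "\<bar>\<dots>\<bar> \<le> 2 * (2 * \<bar>x - y\<bar>)"
  proof (rule summable_weighted(2))
    fix n
    have "\<bar>max 0 (q n - y) - max 0 (q n - x)\<bar> \<le> \<bar>x - y\<bar>" by linarith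
    thus "\<bar>2 * max 0 (q n - y) - 2 * max 0 (q n - x)\<bar> \<le> 2 * \<bar>x - y\<bar>"
      by (simp only: right_diff_distrib[symmetric] abs_mult) simp
  qed
  finally show ?thesis by simp
qed

lemma continuous_ramps_deriv: "continuous_on UNIV (ramps_deriv q)"
proof (rule lipschitz_on_continuous_on)
  show "4-lipschitz_on UNIV (ramps_deriv q)"
    by (rule lipschitz_onI) (use ramps_deriv_lipschitz in \<open>simp_all add: dist_real_def\<close>)
qed

lemma ramps_convex:
  assumes "0 \<le> t" "t \<le> 1"
  shows "ramps q ((1 - t) * x + t * y) \<le> (1 - t) * ramps q x + t * ramps q y"
proof -
  have "ramp_term q ((1 - t) * x + t * y) n \<le> (1 - t) * ramp_term q x n + t * ramp_term q y n" for n
  proof -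
    define U V where "U = (max 0 (q n - x))\<^sup>2" and "V = (max 0 (q n - y))\<^sup>2"
    have "q n - ((1 - t) * x + t * y) = (1 - t) * (q n - x) + t * (q n - y)"
      by (simp add: algebra_simps)
    hence "(max 0 (q n - ((1 - t) * x + t * y)))\<^sup>2 \<le> (1 - t) * U + t * V"
      using square_ramp_convex[OF assms, of "q n - x" "q n - y"] by (simp add: U_def V_def)
    hence "ramp_term q ((1 - t) * x + t * y) n \<le> (1/2) ^ n * ((1 - t) * U + t * V)"
      unfolding ramp_term_def by (intro mult_left_mono) auto
    also have "\<dots> = (1 - t) * ((1/2) ^ n * U) + t * ((1/2) ^ n * V)"
      by (simp add: algebra_simps)
    finally show ?thesis by (simp only: ramp_term_def U_def V_def)
  qed
  hence "ramps q ((1 - t) * x + t * y) \<le> (\<Sum>n. (1 - t) * ramp_term q x n + t * ramp_term q y n)"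
    unfolding ramps_def
    by (intro suminf_le summable_ramp_term summable_add summable_mult)
  also have "\<dots> = (1 - t) * ramps q x + t * ramps q y"
    unfolding ramps_def
    by (simp add: suminf_add[symmetric] suminf_mult summable_ramp_term summable_mult)
  finally show ?thesis .
qed

lemma ramps_lipschitz:
  assumes "\<bar>x\<bar> \<le> B" "\<bar>y\<bar> \<le> B"
  shows "\<bar>ramps q x - ramps q y\<bar> \<le> 4 * (l + B) * \<bar>x - y\<bar>"
proof -
  have "ramps q x - ramps q y = (\<Sum>n. (1/2) ^ n * ((max 0 (q n - x))\<^sup>2 - (max 0 (q n - y))\<^sup>2))"
    unfolding ramps_def suminf_diff[OF summable_ramp_term summable_ramp_term]
    by (simp add: ramp_term_def algebra_simps)
  also have "\<bar>\<dots>\<bar> \<le> 2 * (\<bar>x - y\<bar> * (2 * (l + B)))"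
  proof (rule summable_weighted(2))
    fix n
    let ?u = "max 0 (q n - x)" and ?v = "max 0 (q n - y)"
    have "?u\<^sup>2 - ?v\<^sup>2 = (?u - ?v) * (?u + ?v)" by (simp add: power2_eq_square algebra_simps)
    hence "\<bar>?u\<^sup>2 - ?v\<^sup>2\<bar> = \<bar>?u - ?v\<bar> * \<bar>?u + ?v\<bar>" by (simp add: abs_mult)
    also have "\<dots> \<le> \<bar>x - y\<bar> * (2 * (l + B))"
      using ramp_bound[of n x] ramp_bound[of n y] assms by (intro mult_mono) auto
    finally show "\<bar>?u\<^sup>2 - ?v\<^sup>2\<bar> \<le> \<bar>x - y\<bar> * (2 * (l + B))" .
  qed
  finally show ?thesis by (simp add: algebra_simps)
qed

lemma computable_ramps:
  fixes X :: "'a::encodable \<Rightarrow> real"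
  assumes "computable_frac q" "computable_real_fun X"
  shows "computable_real_fun (\<lambda>x. ramps q (X x))"
proof -
  obtain c where c: "computable c" "\<And>x. \<bar>X x\<bar> \<le> real (c x)"
    using computable_real_fun_bound[OF assms(2)] by blast
  obtain L where L: "l \<le> real L" using real_arch_simple by blast
  have l: "0 \<le> l" using q_nonneg[of 0] q_le[of 0] by simp
  show ?thesis
  proof (rule computable_real_fun_series)
    show "computable_real_fun (\<lambda>p. ramp_term q (X (fst p)) (snd p))"
      unfolding ramp_term_def power2_eq_square
      by (intro computable_real_fun_mult computable_real_fun_max_0 computable_real_fun_diff
          computable_real_fun_frac computable_frac_half_power computable_intros
          computable_frac_compose[OF assms(1)] computable_real_fun_compose[OF assms(2)])
    show "computable (\<lambda>x. 2 * (L + c x) ^ 2)"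
      by (intro computable_intros c)
    show "\<bar>ramps q (X x) - (\<Sum>n<m. ramp_term q (X x) n)\<bar> \<le> real (2 * (L + c x) ^ 2) * (1/2) ^ m" for x m
    proof -
      have "\<bar>(max 0 (q n - X x))\<^sup>2\<bar> \<le> real (L + c x) ^ 2" for n
      proof -
        have "(l + \<bar>X x\<bar>)\<^sup>2 \<le> real (L + c x) ^ 2"
          using L l c(2)[of x] by (intro power_mono) auto
        with ramp_square_bound[of n "X x"] show ?thesis by linarith
      qed
      from summable_weighted(3)[OF this, where m = m] show ?thesis
        unfolding ramps_def ramp_term_def by simp
    qed
  qed
qed

end

section \<open>The valley over a segment with a noncomputable end point\<close>

text \<open>
The factor \<open>1 + x\<^sup>2\<close> makes the slices with \<open>y \<noteq> 0\<close> strictly convex and draws their minimizers to the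
point of the zero set of \<open>ramps q\<close> that is nearest to \<open>0\<close>.
\<close>
definition valley :: "(nat \<Rightarrow> real) \<Rightarrow> real \<times> real \<Rightarrow> real" where
  "valley q p = ramps q (fst p) + (snd p)\<^sup>2 * (1 + (fst p)\<^sup>2)"

context lower_approximation
begin

lemma computable_valley:
  fixes X Y :: "'a::encodable \<Rightarrow> real"
  assumes "computable_frac q" "computable_real_fun X" "computable_real_fun Y"
  shows "computable_real_fun (\<lambda>x. valley q (X x, Y x))"
proof -
  have "computable_real_fun (\<lambda>_ :: 'a. 1)"
    using computable_real_fun_frac[OF computable_frac_of_nat[OF computable_const, of 1]] by simp
  thus ?thesis
    unfolding valley_def power2_eq_square fst_conv snd_conv
    by (intro computable_real_fun_add computable_real_fun_mult computable_ramps assms)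
qed

lemma valley_lipschitz:
  assumes "\<bar>x\<bar> \<le> B" "\<bar>x'\<bar> \<le> B" "\<bar>y\<bar> \<le> B" "\<bar>y'\<bar> \<le> B"
  shows "\<bar>valley q (x, y) - valley q (x', y')\<bar> \<le>
    (4 * (l + B) + 2 * B * (1 + B\<^sup>2) + 2 * B * B\<^sup>2) * (\<bar>x - x'\<bar> + \<bar>y - y'\<bar>)"
proof -
  have B: "0 \<le> B" using assms(1) by linarith
  have l: "0 \<le> l" using q_nonneg[of 0] q_le[of 0] by simp
  have sq: "\<bar>u\<^sup>2 - v\<^sup>2\<bar> \<le> 2 * B * \<bar>u - v\<bar>" if "\<bar>u\<bar> \<le> B" "\<bar>v\<bar> \<le> B" for u v :: real
  proof -
    have "\<bar>u\<^sup>2 - v\<^sup>2\<bar> = \<bar>u + v\<bar> * \<bar>u - v\<bar>"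
      by (simp add: power2_eq_square algebra_simps flip: abs_mult)
    also have "\<dots> \<le> (2 * B) * \<bar>u - v\<bar>" using that by (intro mult_right_mono) auto
    finally show ?thesis .
  qed
  have b: "\<bar>u\<^sup>2\<bar> \<le> B\<^sup>2" if "\<bar>u\<bar> \<le> B" for u :: real
    using power_mono[OF that, of 2] by simp
  have "valley q (x, y) - valley q (x', y') =
      (ramps q x - ramps q x') + (y\<^sup>2 - y'\<^sup>2) * (1 + x\<^sup>2) + y'\<^sup>2 * (x\<^sup>2 - x'\<^sup>2)"
    by (simp add: valley_def algebra_simps)
  also have "\<bar>\<dots>\<bar> \<le> \<bar>ramps q x - ramps q x'\<bar> + \<bar>y\<^sup>2 - y'\<^sup>2\<bar> * \<bar>1 + x\<^sup>2\<bar> + \<bar>y'\<^sup>2\<bar> * \<bar>x\<^sup>2 - x'\<^sup>2\<bar>"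
    by (simp only: abs_mult[symmetric])
  also have "\<dots> \<le> 4 * (l + B) * \<bar>x - x'\<bar> + (2 * B * \<bar>y - y'\<bar>) * (1 + B\<^sup>2) + B\<^sup>2 * (2 * B * \<bar>x - x'\<bar>)"
    using b[OF assms(1)] B
    by (intro add_mono mult_mono ramps_lipschitz sq b assms) auto
  also have "\<dots> \<le> 4 * (l + B) * (\<bar>x - x'\<bar> + \<bar>y - y'\<bar>) + (2 * B * (\<bar>x - x'\<bar> + \<bar>y - y'\<bar>)) * (1 + B\<^sup>2) +
      B\<^sup>2 * (2 * B * (\<bar>x - x'\<bar> + \<bar>y - y'\<bar>))"
    using B l by (intro add_mono mult_left_mono mult_right_mono) auto
  also have "\<dots> = (4 * (l + B) + 2 * B * (1 + B\<^sup>2) + 2 * B * B\<^sup>2) * (\<bar>x - x'\<bar> + \<bar>y - y'\<bar>)"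
    by (simp add: algebra_simps)
  finally show ?thesis .
qed

end

lemma effectively_uniformly_continuous_if_lipschitz:
  assumes "\<And>x y. x \<in> R \<Longrightarrow> y \<in> R \<Longrightarrow> \<bar>f x - f y\<bar> \<le> C * norm (x - y)"
  shows "effectively_uniformly_continuous_on R f"
proof -
  obtain c where c: "C \<le> real c" using real_arch_simple by blast
  have "recursive1 (\<lambda>k. k + c)" unfolding recursive1_iff by (intro computable_intros)
  moreover have "\<bar>f x - f y\<bar> \<le> (1/2) ^ k"
    if "x \<in> R" "y \<in> R" and close: "norm (x - y) \<le> (1/2) ^ (k + c)" for k x y
  proof -
    have "\<bar>f x - f y\<bar> \<le> C * norm (x - y)" using assms that by blast
    also have "\<dots> \<le> 2 ^ c * norm (x - y)"
      using order_trans[OF c nat_le_power2] by (intro mult_right_mono) auto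
    also have "\<dots> \<le> 2 ^ c * (1/2) ^ (k + c)" using close by (intro mult_left_mono) auto
    also have "\<dots> = (1/2) ^ k" by (simp add: power_add power_one_over field_simps)
    finally show ?thesis .
  qed
  ultimately show ?thesis unfolding effectively_uniformly_continuous_on_def by blast
qed

lemma Basis_real_pair: "(Basis :: (real \<times> real) set) = {(1, 0), (0, 1)}"
  by (auto simp: Basis_prod_def)

lemma computable_vec_real_iff: "computable_vec (x::real) \<longleftrightarrow> computable_real x"
  by (simp add: computable_vec_def)

lemma computable_vec_pair_iff:
  "computable_vec (p :: real \<times> real) \<longleftrightarrow> computable_real (fst p) \<and> computable_real (snd p)"
  by (cases p) (simp add: computable_vec_def Basis_real_pair)

lemma computable_vec_seq_real_iff: "computable_vec_seq (x :: nat \<Rightarrow> real) \<longleftrightarrow> computable_real_fun x"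
  by (simp add: computable_vec_seq_def computable_real_seq_iff)

lemma computable_vec_seq_pair_iff:
  "computable_vec_seq (x :: nat \<Rightarrow> real \<times> real) \<longleftrightarrow>
     computable_real_fun (\<lambda>n. fst (x n)) \<and> computable_real_fun (\<lambda>n. snd (x n))"
  by (simp add: computable_vec_seq_def Basis_real_pair computable_real_seq_iff inner_prod_def)

lemma computable_real_minus: "computable_real x \<Longrightarrow> computable_real (- x)"
  unfolding computable_real_iff[where 'a = nat] by (rule computable_real_fun_minus)

lemma computable_continuousI:
  assumes "\<And>X :: nat \<Rightarrow> real. computable_real_fun X \<Longrightarrow> computable_real_fun (\<lambda>n. f (X n))"
    and "\<And>l u. \<exists>C. \<forall>x\<in>{l..u}. \<forall>y\<in>{l..u}. \<bar>f x - f y\<bar> \<le> C * \<bar>x - y\<bar>"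
  shows "computable_continuous f"
  unfolding computable_continuous_def computable_continuous_on_def
proof (intro allI impI conjI)
  fix l u assume lu: "computable_real l \<and> computable_real u \<and> l \<le> u"
  show "computable_rectangle {l..u}"
    unfolding computable_rectangle_def
    by (intro exI[of _ l] exI[of _ u]) (use lu in \<open>simp add: computable_vec_real_iff\<close>)
  show "banach_mazur_computable_on {l..u} f"
    unfolding banach_mazur_computable_on_def computable_vec_seq_real_iff computable_real_seq_iff
    using assms(1) by blast
  show "effectively_uniformly_continuous_on {l..u} f"
    using assms(2)[of l u] effectively_uniformly_continuous_if_lipschitz[of "{l..u}" f]
    by (auto simp: Ball_def)
qed

lemma square_strictly_convex:
  fixes x y t :: real
  assumes "x \<noteq> y" "0 < t" "t < 1"
  shows "((1 - t) * x + t * y)\<^sup>2 < (1 - t) * x\<^sup>2 + t * y\<^sup>2"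
proof -
  have "(1 - t) * x\<^sup>2 + t * y\<^sup>2 - ((1 - t) * x + t * y)\<^sup>2 = t * (1 - t) * (x - y)\<^sup>2"
    by (simp add: power2_eq_square algebra_simps)
  also have "\<dots> > 0" using assms by simp
  finally show ?thesis by simp
qed

context lower_approximation
begin

lemma valley_strictly_convex_1:
  assumes "y \<noteq> 0"
  shows "strictly_convex_on UNIV (\<lambda>x. valley q (x, y))"
  unfolding strictly_convex_on_def
proof (intro conjI ballI allI impI)
  fix u v t :: real assume uvt: "u \<noteq> v \<and> 0 < t \<and> t < 1"
  have "ramps q ((1 - t) * u + t * v) \<le> (1 - t) * ramps q u + t * ramps q v"
    by (rule ramps_convex) (use uvt in auto)
  moreover have "y\<^sup>2 * ((1 - t) * u + t * v)\<^sup>2 < y\<^sup>2 * ((1 - t) * u\<^sup>2 + t * v\<^sup>2)"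
    using assms uvt by (intro mult_strict_left_mono square_strictly_convex) auto
  ultimately show "valley q ((1 - t) *\<^sub>R u + t *\<^sub>R v, y) < (1 - t) * valley q (u, y) + t * valley q (v, y)"
    by (simp add: valley_def algebra_simps)
qed simp

lemma valley_strictly_convex_2: "strictly_convex_on UNIV (\<lambda>y. valley q (x, y))"
  unfolding strictly_convex_on_def
proof (intro conjI ballI allI impI)
  fix u v t :: real assume uvt: "u \<noteq> v \<and> 0 < t \<and> t < 1"
  have "0 < 1 + x\<^sup>2" by (simp add: add_pos_nonneg)
  hence "((1 - t) * u + t * v)\<^sup>2 * (1 + x\<^sup>2) < ((1 - t) * u\<^sup>2 + t * v\<^sup>2) * (1 + x\<^sup>2)"
    using uvt by (intro mult_strict_right_mono square_strictly_convex) auto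
  thus "valley q (x, (1 - t) *\<^sub>R u + t *\<^sub>R v) < (1 - t) * valley q (x, u) + t * valley q (x, v)"
    by (simp add: valley_def algebra_simps)
qed simp

lemma valley_continuously_differentiable: "continuously_differentiable (valley q)"
proof -
  let ?g = "\<lambda>p :: real \<times> real. (ramps_deriv q (fst p) + 2 * fst p * (snd p)\<^sup>2, 2 * snd p * (1 + (fst p)\<^sup>2))"
  have ramps: "(ramps q has_derivative (\<lambda>h. ramps_deriv q x * h)) (at x)" for x
    using ramps_has_derivative[of x] by (simp add: has_field_derivative_def)
  have "(valley q has_derivative (\<lambda>h. ?g p \<bullet> h)) (at p)" for p
    unfolding valley_def
    by (rule has_derivative_eq_rhs, (rule derivative_eq_intros has_derivative_compose[OF _ ramps] refl)+)
       (auto simp: inner_prod_def fun_eq_iff algebra_simps power2_eq_square)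
  moreover have "continuous_on UNIV ?g"
    by (intro continuous_intros continuous_on_compose2[OF continuous_ramps_deriv]) auto
  hence "continuous_on UNIV (\<lambda>p. blinfun_inner_right (?g p))"
    by (rule bounded_linear.continuous_on[OF bounded_linear_blinfun_inner_right])
  ultimately show ?thesis unfolding continuously_differentiable_def
    by (intro exI[of _ "\<lambda>p. blinfun_inner_right (?g p)"]) simp
qed

lemma valley_nonneg: "0 \<le> valley q p"
  using ramps_nonneg[of "fst p"] by (simp add: valley_def)

lemma valley_eq_0_iff: "valley q p = 0 \<longleftrightarrow> l \<le> fst p \<and> snd p = 0"
proof -
  have "0 < 1 + (fst p)\<^sup>2" by (simp add: add_pos_nonneg)
  hence "valley q p = 0 \<longleftrightarrow> ramps q (fst p) = 0 \<and> (snd p)\<^sup>2 * (1 + (fst p)\<^sup>2) = 0"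
    unfolding valley_def using ramps_nonneg[of "fst p"] by (intro add_nonneg_eq_0_iff) auto
  thus ?thesis using \<open>0 < 1 + (fst p)\<^sup>2\<close> ramps_eq_0_iff[of "fst p"] by simp
qed

lemma valley_minimizers:
  assumes "(l, 0) \<in> R1 \<times> R2"
  shows "minimizers (R1 \<times> R2) (valley q) = {p \<in> R1 \<times> R2. l \<le> fst p \<and> snd p = 0}"
proof -
  have "valley q (l, 0) = 0" by (simp add: valley_eq_0_iff)
  hence "is_arg_min (valley q) (\<lambda>p. p \<in> R1 \<times> R2) p \<longleftrightarrow> p \<in> R1 \<times> R2 \<and> valley q p = 0" for p
    unfolding is_arg_min_def using assms valley_nonneg by (metis less_le not_le)
  thus ?thesis by (auto simp: minimizers_def valley_eq_0_iff)
qed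

text \<open>
From a point off the axis \<open>valley q\<close> decreases along the second coordinate, which has its minimum
at \<open>0\<close>; from a point \<open>(x, 0)\<close> with \<open>x < l\<close> it decreases along the axis towards \<open>(l, 0)\<close>.
\<close>
lemma valley_local_minimizers:
  assumes "l \<in> R1" "0 \<in> R2" "convex R1" "convex R2"
  shows "local_minimizers (R1 \<times> R2) (valley q) \<subseteq> minimizers (R1 \<times> R2) (valley q)"
proof
  fix p assume p: "p \<in> local_minimizers (R1 \<times> R2) (valley q)"
  obtain x y where xy: "p = (x, y)" "x \<in> R1" "y \<in> R2"
    using p by (auto simp: local_minimizers_def)
  obtain e where e: "e > 0" "\<And>p'. p' \<in> R1 \<times> R2 \<Longrightarrow> dist p' (x, y) < e \<Longrightarrow> valley q (x, y) \<le> valley q p'"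
    using p by (auto simp: local_minimizers_def xy(1))
  have small: "\<exists>s. 0 < s \<and> s < 1 \<and> s * D < e" if "0 \<le> D" for D :: real
  proof -
    have "0 < min 1 e / (2 * (D + 1))" using e(1) that by simp
    moreover have "min 1 e / (2 * (D + 1)) < 1"
      using that by (simp add: divide_less_eq)
    moreover have "min 1 e / (2 * (D + 1)) * D < e"
    proof -
      have "min 1 e / (2 * (D + 1)) * D \<le> e * (D / (2 * (D + 1)))"
        using that by (simp add: mult_right_mono divide_right_mono)
      also have "\<dots> < e * 1" using that e(1) by (intro mult_strict_left_mono) (auto simp: divide_less_eq)
      finally show ?thesis by simp
    qed
    ultimately show ?thesis by blast
  qed
  have "y = 0"
  proof (rule ccontr)
    assume y: "y \<noteq> 0"
    obtain s where s: "0 < s" "s < 1" "s * \<bar>y\<bar> < e" using small[of "\<bar>y\<bar>"] by auto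
    have "valley q (x, (1 - s) *\<^sub>R y + s *\<^sub>R 0) < (1 - s) * valley q (x, y) + s * valley q (x, 0)"
      using valley_strictly_convex_2[of x] s y unfolding strictly_convex_on_def by blast
    moreover have "valley q (x, 0) \<le> valley q (x, y)" by (simp add: valley_def)
    hence "s * valley q (x, 0) \<le> s * valley q (x, y)" using s by simp
    moreover have "(1 - s) *\<^sub>R y + s *\<^sub>R 0 \<in> R2"
      using assms(4) xy(3) assms(2) s by (intro convexD) auto
    moreover have "(1 - s) *\<^sub>R y + s *\<^sub>R 0 - y = - (s * y)" by (simp add: algebra_simps)
    hence "dist ((1 - s) *\<^sub>R y + s *\<^sub>R 0) y < e" using s by (simp only: dist_real_def) (simp add: abs_mult)
    hence "dist (x, (1 - s) *\<^sub>R y + s *\<^sub>R 0) (x, y) < e" by (simp add: dist_Pair_Pair)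
    ultimately show False using e(2)[of "(x, (1 - s) *\<^sub>R y + s *\<^sub>R 0)"] xy(2)
      by (simp add: algebra_simps)
  qed
  moreover have "l \<le> x"
  proof (rule ccontr)
    assume x: "\<not> l \<le> x"
    obtain s where s: "0 < s" "s < 1" "s * \<bar>l - x\<bar> < e" using small[of "\<bar>l - x\<bar>"] by auto
    let ?x = "(1 - s) * x + s * l"
    have "ramps q ?x \<le> (1 - s) * ramps q x + s * ramps q l" using s by (intro ramps_convex) auto
    moreover have "ramps q l = 0" by (simp add: ramps_eq_0_iff)
    moreover have "0 < ramps q x" using ramps_eq_0_iff[of x] ramps_nonneg[of x] x by simp
    hence "0 < s * ramps q x" using s by simp
    moreover have "?x \<in> R1" using convexD[OF assms(3) xy(2) assms(1), of "1 - s" s] s by simp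
    moreover have "?x - x = s * (l - x)" by (simp add: algebra_simps)
    hence "dist ?x x < e" using s by (simp only: dist_real_def) (simp add: abs_mult)
    hence "dist (?x, 0) (x, 0::real) < e" by (simp add: dist_Pair_Pair)
    ultimately show False using e(2)[of "(?x, 0)"] assms(2) \<open>y = 0\<close>
      by (simp add: valley_def algebra_simps)
  qed
  ultimately show "p \<in> minimizers (R1 \<times> R2) (valley q)"
    using valley_minimizers[of R1 R2] assms xy by simp
qed

text \<open>
A minimizer \<open>G y\<close> of a slice is compared with \<open>l\<close>, at which \<open>ramps q\<close> vanishes: this gives
\<open>(G y)\<^sup>2 \<le> l\<^sup>2\<close>, which is preserved by the limit.
\<close>
lemma valley_one_sided_limit:
  assumes "l \<in> R1" "0 < l" "(x, 0) \<in> one_sided_limits R1 R2 (valley q) 0 side" "l \<le> x"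
  shows "x = l"
proof -
  define F where "F = at (0::real) within (R2 \<inter> side)"
  obtain G where F: "F \<noteq> bot" and G: "\<And>y. y \<in> R2 \<Longrightarrow> G y \<in> minimizers R1 (\<lambda>x. valley q (x, y))"
    and lim: "((\<lambda>y. (G y, y)) \<longlongrightarrow> (x, 0)) F"
    using assms(3) by (auto simp: one_sided_limits_def assignments1_def F_def)
  have le: "(G y)\<^sup>2 \<le> l\<^sup>2" if "y \<in> R2" "y \<noteq> 0" for y
  proof -
    have "valley q (G y, y) \<le> valley q (l, y)"
      using G[OF that(1)] assms(1) by (auto simp: minimizers_def is_arg_min_def not_less)
    hence "y\<^sup>2 * (1 + (G y)\<^sup>2) \<le> y\<^sup>2 * (1 + l\<^sup>2)"
      using ramps_nonneg[of "G y"] ramps_eq_0_iff[of l] by (simp add: valley_def)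
    thus ?thesis using that(2) by simp
  qed
  have "((\<lambda>y. (G y)\<^sup>2) \<longlongrightarrow> x\<^sup>2) F"
    using tendsto_fst[OF lim] by (auto intro: tendsto_power)
  moreover have "\<forall>\<^sub>F y in F. (G y)\<^sup>2 \<le> l\<^sup>2"
    unfolding F_def eventually_at_filter by (intro always_eventually) (use le in auto)
  ultimately have "x\<^sup>2 \<le> l\<^sup>2" using F by (rule tendsto_upperbound)
  hence "x \<le> l" using assms(2) by (simp add: power2_le_iff_abs_le)
  thus ?thesis using assms(4) by simp
qed

end

theorem theorem5p1:
  fixes a b :: real
  assumes "0 < a" and "0 < b"
    and "computable_real a" and "computable_real b"
  shows "\<exists>f2 :: real \<times> real \<Rightarrow> real.
    computable_continuous_on ({-a..a} \<times> {-b..b}) f2 \<and>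
    continuously_differentiable f2 \<and>
    (\<forall>x2. x2 \<noteq> 0 \<longrightarrow> strictly_convex_on UNIV (\<lambda>x1. f2 (x1, x2))) \<and>
    (\<forall>x2. computable_real x2 \<longrightarrow> computable_continuous (\<lambda>x1. f2 (x1, x2))) \<and>
    (\<forall>x1. strictly_convex_on UNIV (\<lambda>x2. f2 (x1, x2))) \<and>
    (\<forall>x1. computable_real x1 \<longrightarrow> computable_continuous (\<lambda>x2. f2 (x1, x2))) \<and>
    local_minimizers ({-a..a} \<times> {-b..b}) f2 \<subseteq> minimizers ({-a..a} \<times> {-b..b}) f2 \<and>
    (\<exists>l u. l < u \<and> minimizers ({-a..a} \<times> {-b..b}) f2 = {l..u} \<times> {0}) \<and>
    (\<forall>p \<in> minimizers ({-a..a} \<times> {-b..b}) f2.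
       reachable_along_x2 {-a..a} {-b..b} f2 p \<longrightarrow> \<not> computable_vec p)"
proof -
  obtain q :: "nat \<Rightarrow> real" and l where
    ql: "lower_approximation q l" and q: "computable_frac q" and
    l: "\<not> computable_real l" "0 < l" "l < a"
    by (rule noncomputable_limit[OF assms(1)]) blast
  interpret lower_approximation q l by (fact ql)
  let ?R = "{-a..a} \<times> {-b..b}"
  note lip = valley_lipschitz
  note cmp = computable_valley[OF q]
  have "(l, 0) \<in> ?R" using l assms(2) by simp
  hence "minimizers ?R (valley q) = {p \<in> ?R. l \<le> fst p \<and> snd p = 0}" by (rule valley_minimizers)
  also have "\<dots> = {l..a} \<times> {0}" using l assms(2) by (auto simp: mem_Times_iff)
  finally have min: "minimizers ?R (valley q) = {l..a} \<times> {0}" .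
  have R: "computable_continuous_on ?R (valley q)"
    unfolding computable_continuous_on_def
  proof (intro conjI)
    have "?R = cbox (-a, -b) (a, b)" by (simp add: cbox_Pair_eq)
    thus "computable_rectangle ?R"
      unfolding computable_rectangle_def
      by (intro exI[of _ "(-a, -b)"] exI[of _ "(a, b)"])
         (use assms in \<open>simp add: computable_vec_pair_iff Basis_real_pair computable_real_minus\<close>)
    show "banach_mazur_computable_on ?R (valley q)"
      unfolding banach_mazur_computable_on_def computable_vec_seq_pair_iff computable_real_seq_iff
      using cmp by fastforce
    show "effectively_uniformly_continuous_on ?R (valley q)"
    proof (rule effectively_uniformly_continuous_if_lipschitz)
      fix p p' assume p: "p \<in> ?R" "p' \<in> ?R"
      let ?B = "max a b"
      let ?K = "4 * (l + ?B) + 2 * ?B * (1 + ?B\<^sup>2) + 2 * ?B * ?B\<^sup>2"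
      have "\<bar>valley q (fst p, snd p) - valley q (fst p', snd p')\<bar> \<le>
          ?K * (\<bar>fst p - fst p'\<bar> + \<bar>snd p - snd p'\<bar>)"
        by (rule lip) (use p in auto)
      also have "\<dots> \<le> ?K * (2 * norm (p - p'))"
      proof (rule mult_left_mono)
        show "\<bar>fst p - fst p'\<bar> + \<bar>snd p - snd p'\<bar> \<le> 2 * norm (p - p')"
          using norm_fst_le[of "fst (p - p')" "snd (p - p')"] norm_snd_le[of "snd (p - p')" "fst (p - p')"]
          by (simp only: prod.collapse) simp
        show "0 \<le> ?K" using assms l by (intro add_nonneg_nonneg mult_nonneg_nonneg) auto
      qed
      finally show "\<bar>valley q p - valley q p'\<bar> \<le> ?K * 2 * norm (p - p')" by (simp only: prod.collapse mult.assoc)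
    qed
  qed
  have slice1: "computable_continuous (\<lambda>x. valley q (x, y))" if "computable_real y" for y
  proof (rule computable_continuousI)
    fix X :: "nat \<Rightarrow> real" assume "computable_real_fun X"
    thus "computable_real_fun (\<lambda>n. valley q (X n, y))"
      using that by (intro cmp) (simp_all add: computable_real_iff[where 'a = nat])
  next
    fix u v :: real
    let ?B = "max \<bar>y\<bar> (max \<bar>u\<bar> \<bar>v\<bar>)"
    have "\<bar>valley q (x, y) - valley q (x', y)\<bar> \<le>
        (4 * (l + ?B) + 2 * ?B * (1 + ?B\<^sup>2) + 2 * ?B * ?B\<^sup>2) * (\<bar>x - x'\<bar> + \<bar>y - y\<bar>)"
      if "x \<in> {u..v}" "x' \<in> {u..v}" for x x'
      by (rule lip) (use that in auto)
    thus "\<exists>C. \<forall>x\<in>{u..v}. \<forall>x'\<in>{u..v}. \<bar>valley q (x, y) - valley q (x', y)\<bar> \<le> C * \<bar>x - x'\<bar>"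
      by (simp only: diff_self abs_zero add_0_right) blast
  qed
  have slice2: "computable_continuous (\<lambda>y. valley q (x, y))" if "computable_real x" for x
  proof (rule computable_continuousI)
    fix Y :: "nat \<Rightarrow> real" assume "computable_real_fun Y"
    thus "computable_real_fun (\<lambda>n. valley q (x, Y n))"
      using that by (intro cmp) (simp_all add: computable_real_iff[where 'a = nat])
  next
    fix u v :: real
    let ?B = "max \<bar>x\<bar> (max \<bar>u\<bar> \<bar>v\<bar>)"
    have "\<bar>valley q (x, y) - valley q (x, y')\<bar> \<le>
        (4 * (l + ?B) + 2 * ?B * (1 + ?B\<^sup>2) + 2 * ?B * ?B\<^sup>2) * (\<bar>x - x\<bar> + \<bar>y - y'\<bar>)"
      if "y \<in> {u..v}" "y' \<in> {u..v}" for y y'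
      by (rule lip) (use that in auto)
    thus "\<exists>C. \<forall>y\<in>{u..v}. \<forall>y'\<in>{u..v}. \<bar>valley q (x, y) - valley q (x, y')\<bar> \<le> C * \<bar>y - y'\<bar>"
      by (simp only: diff_self abs_zero add_0_left) blast
  qed
  have reach: "\<not> computable_vec p"
    if p: "p \<in> minimizers ?R (valley q)" and r: "reachable_along_x2 {-a..a} {-b..b} (valley q) p" for p
  proof -
    obtain x where x: "p = (x, 0)" "l \<le> x" using p min by auto
    have "x = l"
      using r valley_one_sided_limit[of "{-a..a}" x "{-b..b}"] l x
      by (auto simp: reachable_along_x2_def G1_plus_def G1_minus_def)
    thus ?thesis using l(1) x(1) by (simp add: computable_vec_pair_iff)
  qed
  have local: "local_minimizers ?R (valley q) \<subseteq> minimizers ?R (valley q)"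
    using l assms(2) by (intro valley_local_minimizers) auto
  show ?thesis
    by (intro exI[of _ "valley q"] conjI allI impI ballI R slice1 slice2 local reach
        valley_continuously_differentiable valley_strictly_convex_1
        valley_strictly_convex_2 exI[of _ l] exI[of _ a] l(3) min)
qed

end
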